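(* Let $n\ge 2$, let $\mathbb{E}$ be an $n$-dimensional Euclidean space and let $S\colon\mathbb{E}\to\mathbb{R}^n$ be a $C^1$-vector field whose equation $\dot w=S(w)$ induces a flow $\phi\colon\mathbb{R}\times\mathbb{E}\to\mathbb{E}$, $(t,w)\mapsto t_\cdot w$. Let $\Lambda\subset\mathbb{E}$ be a hyperbolic set for $S$ (a $\phi$-invariant closed set, not necessarily compact, hyperbolic in the sense defined in the context) satisfying: (U1) the first derivative $S'(w)$ is uniformly bounded on $\Lambda$; (U2) $0<\inf_{w\in\Lambda}\|S(w)\|\le\sup_{w\in\Lambda}\|S(w)\|<\infty$; (U3) $S'$ is uniformly continuous at $\Lambda$: for every $\epsilon>0$ there is $\delta>0$ such that for every $\mathfrak{w}\in\Lambda$ and every $w\in\mathbb{E}$, $\|S'(w)-S'(\mathfrak{w})\|<\epsilon$ whenever $\|w-\mathfrak{w}\|<\delta$. Then for every $\varepsilon>0$ there is a $C^1$-neighborhood $\mathcal{U}$ of $S$ in $\mathfrak{X}^1(\mathbb{E})$ such that for every $V\in\mathcal{U}$ there exist a closed subset $\Lambda_V\subset\mathbb{E}$ and an $\varepsilon$-topological mapping $H$ from $\Lambda$ onto $\Lambda_V$ (i.e. a homeomorphism $H\colon\Lambda\to\Lambda_V$ with $\|H(w)-w\|<\varepsilon$ for all $w\in\Lambda$) which sends orbits of $S$ in $\Lambda$ into orbits of $V$ in $\Lambda_V$, and such that $H(w)\in\Sigma_w$ and $\psi_V(t,H(w))=H(t_\cdot w)$ for all $w\in\Lambda$ and all $t\in\mathbb{R}$,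 where $H(w)$ is regarded as a point of the fibre $\Sigma_w$ over $w$.
   Context: $T_w\mathbb{E}=\mathbb{R}^n$ for all $w\in\mathbb{E}$. $\mathfrak{X}^1(\mathbb{E})$ is the space of all $C^1$-vector fields on $\mathbb{E}$ with the topology induced by the usual $C^1$-norm $\|\cdot\|_1$ (the supremum over $\mathbb{E}$ of the vector field and its first derivative; a neighborhood of $S$ contains some $\{V:\|V-S\|_1<\delta\}$). Cross-sections: $\Sigma_w=\{w'\in\mathbb{E}\mid\langle S(w),w'-w\rangle=0\}$ and $\Sigma=\bigcup_w\Sigma_w$ (disjoint union as a bundle). A point of $\Sigma_w$ is written $w+x$, with $x\in\mathbb{T}_w:=\Sigma_w-w=\{x\in\mathbb{R}^n\mid\langle S(w),x\rangle=0\}$. Cross-section flows: for $V\in\mathfrak{X}^1(\mathbb{E})$ (near $S$), with (local) flow $\phi_V$, the local cross-section flow of $V$ relative to $S$ is the local skew-product flow over $\phi$, $\psi_V(t,w+x)=t_\cdot w+\psi_{V;t,w}x\in\Sigma_{t_\cdot w}$, given by $\psi_{V;t,w}x=\phi_V(t_0,w+x)-t_\cdot w$, where $t_0$ is the first $t'>0$ when $t>0$ (respectively first $t'<0$ when $t<0$) with $\phi_V(t',w+x)\in\Sigma_{t_\cdot w}$. This is a local definition (for $|t|$ and $\|x\|$ small), extended to other $t$ by the flow property $\psi_V(t+s,\cdot)=\psi_V(t,\psi_V(s,\cdot))$, $\psi_V(0,\cdot)=\mathrm{id}$, as long as it is defined. For $V=S$ write $\psi=\psi_S$ and $\psi_{t,w}=\psi_{S;t,w}$;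 then $\psi_{t,w}\mathbf{0}=\mathbf{0}$. Transversal linear flow: $\Psi_{t,w}=D_{\mathbf 0}\psi_{t,w}\colon\mathbb{T}_w\to\mathbb{T}_{t_\cdot w}$, the derivative at $\mathbf 0$. Hyperbolicity: a $\phi$-invariant closed set $\Lambda$ is hyperbolic for $S$ if there are constants $C\ge1$, $\lambda<0$ and a continuous $\Psi$-invariant splitting $\mathbb{T}_w=T_w^s\oplus T_w^u$, $w\in\Lambda$, such that for all $w\in\Lambda$, $t_0\in\mathbb{R}$ and $t>0$, $$\|\Psi_{t_0+t,w}x\|\le C\exp(\lambda t)\|\Psi_{t_0,w}x\|\quad\forall x\in T_w^s,\qquad \|\Psi_{t_0+t,w}x\|\ge C^{-1}\exp(-\lambda t)\|\Psi_{t_0,w}x\|\quad\forall x\in T_w^u.$$ *)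

theory Defs
  imports "HOL-Analysis.Analysis"
begin

section \<open>Vector fields of class C1 and the C1 topology\<close>

definition vf_deriv :: "('a::euclidean_space \<Rightarrow> 'a) \<Rightarrow> 'a \<Rightarrow> 'a \<Rightarrow>\<^sub>L 'a" where
  "vf_deriv X w = Blinfun (frechet_derivative X (at w))"

definition C1_field :: "('a::euclidean_space \<Rightarrow> 'a) \<Rightarrow> bool" where
  "C1_field X \<longleftrightarrow> (\<forall>w. X differentiable (at w)) \<and> continuous_on UNIV (vf_deriv X)"

text \<open>The C1 norm is extended-real valued: fields of class C1 need not be bounded, and only
  differences of fields are required to be small.\<close>

definition C1_norm :: "('a::euclidean_space \<Rightarrow> 'a) \<Rightarrow> ereal" where
  "C1_norm X = (SUP w. ereal (max (norm (X w)) (norm (vf_deriv X w))))"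

definition C1_neighborhood :: "('a::euclidean_space \<Rightarrow> 'a) \<Rightarrow> ('a \<Rightarrow> 'a) set \<Rightarrow> bool" where
  "C1_neighborhood S U \<longleftrightarrow> U \<subseteq> Collect C1_field \<and>
     (\<exists>\<delta>>0. {V. C1_field V \<and> C1_norm (\<lambda>w. V w - S w) < ereal \<delta>} \<subseteq> U)"

section \<open>Flows\<close>

definition is_flow_of :: "('a::euclidean_space \<Rightarrow> 'a) \<Rightarrow> (real \<Rightarrow> 'a \<Rightarrow> 'a) \<Rightarrow> bool" where
  "is_flow_of S \<phi> \<longleftrightarrow> (\<forall>w. \<phi> 0 w = w) \<and>
     (\<forall>w t. ((\<lambda>s. \<phi> s w) has_vector_derivative S (\<phi> t w)) (at t))"

text \<open>A perturbation of \<open>S\<close> need not be complete, so its local flow is given by its graph: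
  \<open>local_flow V t p q\<close> says that the maximal solution starting at \<open>p\<close> is defined at time \<open>t\<close>
  and has the value \<open>q\<close> there.\<close>

definition local_flow :: "('a::euclidean_space \<Rightarrow> 'a) \<Rightarrow> real \<Rightarrow> 'a \<Rightarrow> 'a \<Rightarrow> bool" where
  "local_flow V t p q \<longleftrightarrow> (\<exists>u. u 0 = p \<and> u t = q \<and>
     (\<forall>s\<in>closed_segment 0 t.
        (u has_vector_derivative V (u s)) (at s within closed_segment 0 t)))"

definition orbit :: "('a::euclidean_space \<Rightarrow> 'a) \<Rightarrow> 'a \<Rightarrow> 'a set" where
  "orbit V p = {q. \<exists>t. local_flow V t p q}"

section \<open>Cross-sections and cross-section flows\<close>

definition cross_section :: "('a::euclidean_space \<Rightarrow> 'a) \<Rightarrow> 'a \<Rightarrow> 'a set" where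
  "cross_section S w = {w'. S w \<bullet> (w' - w) = 0}"

definition transversal :: "('a::euclidean_space \<Rightarrow> 'a) \<Rightarrow> 'a \<Rightarrow> 'a set" where
  "transversal S w = {x. S w \<bullet> x = 0}"

text \<open>First-hit map from the section at \<open>w\<close> to the section at \<open>\<phi> t w\<close>: the hitting
  time has the same sign as \<open>t\<close>, and the trajectory does not meet the target section strictly
  before it (for \<open>t = 0\<close> the map is the identity).\<close>

definition first_hit ::
  "('a::euclidean_space \<Rightarrow> 'a) \<Rightarrow> (real \<Rightarrow> 'a \<Rightarrow> 'a) \<Rightarrow> ('a \<Rightarrow> 'a) \<Rightarrow> real \<Rightarrow> 'a \<Rightarrow> 'a \<Rightarrow> 'a \<Rightarrow> bool"
  where
  "first_hit S \<phi> V t w p q \<longleftrightarrow>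
     p \<in> cross_section S w \<and> q \<in> cross_section S (\<phi> t w) \<and>
     (\<exists>t0. sgn t0 = sgn t \<and> local_flow V t0 p q \<and>
        (\<forall>t'\<in>open_segment 0 t0. \<forall>q'. local_flow V t' p q' \<longrightarrow> q' \<notin> cross_section S (\<phi> t w)))"

text \<open>Graph of the cross-section flow of \<open>V\<close> relative to \<open>S\<close>. The first-hit map describes
  it for small times only, and it is extended by the flow property. Thus \<open>q\<close> is the
  image of \<open>p\<close> after time \<open>t\<close> iff \<open>p\<close> and \<open>q\<close> are joined by a continuous curve \<open>c\<close>, with
  \<open>c s\<close> in the section at \<open>\<phi> s w\<close>, any two sufficiently close points of which are related
  by the first-hit map. Points of the disjoint union of the sections are represented by the base
  point \<open>w\<close> together with a point of the section at \<open>w\<close>.\<close>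

definition cs_flow ::
  "('a::euclidean_space \<Rightarrow> 'a) \<Rightarrow> (real \<Rightarrow> 'a \<Rightarrow> 'a) \<Rightarrow> ('a \<Rightarrow> 'a) \<Rightarrow> real \<Rightarrow> 'a \<Rightarrow> 'a \<Rightarrow> 'a \<Rightarrow> bool"
  where
  "cs_flow S \<phi> V t w p q \<longleftrightarrow>
     (\<exists>c. c 0 = p \<and> c t = q \<and> continuous_on (closed_segment 0 t) c \<and>
        (\<exists>\<eta>>0. \<forall>s\<in>closed_segment 0 t. \<forall>s'\<in>closed_segment 0 t. \<bar>s' - s\<bar> < \<eta> \<longrightarrow>
           first_hit S \<phi> V (s' - s) (\<phi> s w) (c s) (c s')))"

text \<open>The same flow in fibre coordinates, as a map between transversals. It is meaningful only
  where the cross-section flow is defined, which includes a neighbourhood of \<open>0\<close> when \<open>V = S\<close>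
  and \<open>S w \<noteq> 0\<close>.\<close>

definition cs_map ::
  "('a::euclidean_space \<Rightarrow> 'a) \<Rightarrow> (real \<Rightarrow> 'a \<Rightarrow> 'a) \<Rightarrow> ('a \<Rightarrow> 'a) \<Rightarrow> real \<Rightarrow> 'a \<Rightarrow> 'a \<Rightarrow> 'a" where
  "cs_map S \<phi> V t w x = (THE q. cs_flow S \<phi> V t w (w + x) q) - \<phi> t w"

text \<open>Only the values on \<open>transversal S w\<close> are determined (uniquely) by this derivative.\<close>

definition transversal_flow ::
  "('a::euclidean_space \<Rightarrow> 'a) \<Rightarrow> (real \<Rightarrow> 'a \<Rightarrow> 'a) \<Rightarrow> real \<Rightarrow> 'a \<Rightarrow> 'a \<Rightarrow> 'a" where
  "transversal_flow S \<phi> t w =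
     frechet_derivative (cs_map S \<phi> S t w) (at 0 within transversal S w)"

section \<open>Hyperbolic sets\<close>

text \<open>Continuity of a field of subspaces, as for vector subbundles: local continuous frames.\<close>

definition continuous_subbundle_on ::
  "'a::euclidean_space set \<Rightarrow> ('a \<Rightarrow> 'a set) \<Rightarrow> bool" where
  "continuous_subbundle_on \<Lambda> F \<longleftrightarrow>
     (\<forall>w0\<in>\<Lambda>. \<exists>N k. \<exists>e :: nat \<Rightarrow> 'a \<Rightarrow> 'a. open N \<and> w0 \<in> N \<and>
        (\<forall>i<k. continuous_on (\<Lambda> \<inter> N) (e i)) \<and>
        (\<forall>w\<in>\<Lambda> \<inter> N. inj_on (\<lambda>i. e i w) {..<k} \<and> independent ((\<lambda>i. e i w) ` {..<k}) \<and>
           span ((\<lambda>i. e i w) ` {..<k}) = F w))"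

definition direct_sum :: "'a::euclidean_space set \<Rightarrow> 'a set \<Rightarrow> 'a set \<Rightarrow> bool" where
  "direct_sum T A B \<longleftrightarrow> subspace A \<and> subspace B \<and> A \<inter> B = {0} \<and> {x + y | x y. x \<in> A \<and> y \<in> B} = T"

definition hyperbolic_set ::
  "('a::euclidean_space \<Rightarrow> 'a) \<Rightarrow> (real \<Rightarrow> 'a \<Rightarrow> 'a) \<Rightarrow> 'a set \<Rightarrow> bool" where
  "hyperbolic_set S \<phi> \<Lambda> \<longleftrightarrow> closed \<Lambda> \<and> (\<forall>t. \<phi> t ` \<Lambda> = \<Lambda>) \<and>
     (\<exists>C \<mu> Ts Tu. C \<ge> 1 \<and> \<mu> < 0 \<and>
        continuous_subbundle_on \<Lambda> Ts \<and> continuous_subbundle_on \<Lambda> Tu \<and>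
        (\<forall>w\<in>\<Lambda>. direct_sum (transversal S w) (Ts w) (Tu w)) \<and>
        (\<forall>w\<in>\<Lambda>. \<forall>t. transversal_flow S \<phi> t w ` Ts w = Ts (\<phi> t w) \<and>
                    transversal_flow S \<phi> t w ` Tu w = Tu (\<phi> t w)) \<and>
        (\<forall>w\<in>\<Lambda>. \<forall>t0. \<forall>t>0.
           (\<forall>x\<in>Ts w. norm (transversal_flow S \<phi> (t0 + t) w x)
                       \<le> C * exp (\<mu> * t) * norm (transversal_flow S \<phi> t0 w x)) \<and>
           (\<forall>x\<in>Tu w. norm (transversal_flow S \<phi> (t0 + t) w x)
                       \<ge> inverse C * exp (- \<mu> * t) * norm (transversal_flow S \<phi> t0 w x))))"

end

theory Submission
  imports Defs
begin

text \<open>A solution \<open>x\<close> of the non-autonomous equation \<open>x' = g V(w + x) - S w\<close> along \<open>w = \<phi> s w0\<close>,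
  with the scalar \<open>g\<close> chosen so that \<open>x\<close> stays transversal to \<open>S w\<close>, describes the
  cross-section flow of \<open>V\<close>.  The right-hand side is the generator of the transversal linear flow
  plus a remainder which, for \<open>V\<close> near \<open>S\<close>, has a small Lipschitz constant near \<open>0\<close> uniformly over
  \<open>\<Lambda>\<close>.  After truncating the remainder and sampling at multiples of a large time, hyperbolicity
  turns the search for a bounded solution along each orbit into a contraction on bounded sequences;
  its unique solution at time \<open>0\<close> is \<open>H w - w\<close>.  Uniqueness gives equivariance, continuity (through
  a closed graph) and injectivity.\<close>

subsection \<open>Differential inequalities and the Picard-Lindeloef theorem\<close>

text \<open>As \<Lambda> need not be compact, every constant has to be uniform in the base point,
  and a field V near S may have incomplete orbits. The equation for x meets both difficulties: it
  lives over the complete flow of S, its linear part is bounded in terms of \<open>K\<close>, and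
  truncating only the remainder makes it globally Lipschitz without leaving the transversals. Two
  small quantities are kept apart: the Lipschitz constant \<eta> of the remainder is fixed by
  hyperbolicity and the uniform bounds, whereas its value at 0, at most 2 \<delta>, is shrunk
  afterwards and controls how far H moves points. First hits are tied to the equation twice: for V =
  S, to identify the transversal linear flow that hyperbolicity speaks of, and for V itself, to
  recognise the solution as an orbit of the cross-section flow. Injectivity needs more than
  uniqueness over one orbit, since w and w' may lie on different orbits that carry different time
  changes; the difference of these orbits must first be projected to the transversal of one of
  them.\<close>

lemma antiderivative_exists:
  fixes f :: "real \<Rightarrow> 'a::euclidean_space"
  assumes "continuous_on UNIV f"
  obtains F where "F 0 = 0" "\<And>t. (F has_vector_derivative f t) (at t)"
proof -
  obtain F where F: "\<And>x::real. (F has_vector_derivative f x) (at x)"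
    using einterval_antiderivative[of "-\<infinity>" \<infinity> f] assms
    by (auto simp: continuous_on_eq_continuous_at)
  have "((\<lambda>t. F t - F 0) has_vector_derivative f t) (at t)" for t
    using has_vector_derivative_diff[OF F[of t] has_vector_derivative_const] by simp
  then show thesis
    by (intro that[of "\<lambda>t. F t - F 0"]) auto
qed

text \<open>With the weight exp(-2Ls), integrating up to the point \<open>s0\<close> of the weighted
  maximum returns at most half of that maximum, which is absorbed on the left. The price is the
  factor 2 and the exponent 2L in place of L; only uniformity of the bound matters later.\<close>

lemma gronwall_nonneg:
  fixes d :: "real \<Rightarrow> 'a::real_normed_vector"
  assumes t: "0 \<le> t" and L: "0 \<le> L" and e: "0 \<le> e"
    and cont: "continuous_on {0..t} d"
    and der: "\<And>s. 0 < s \<Longrightarrow> s < t \<Longrightarrow> (d has_vector_derivative d' s) (at s)"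
    and bnd: "\<And>s. 0 < s \<Longrightarrow> s < t \<Longrightarrow> norm (d' s) \<le> L * norm (d s) + e"
  shows "norm (d t) \<le> 2 * (norm (d 0) + e * t) * exp (2 * L * t)"
proof -
  have "continuous_on {0..t} (\<lambda>s. exp (- (2 * L * s)) * norm (d s))"
    by (intro continuous_intros cont)
  then obtain s0 where s0: "s0 \<in> {0..t}"
    and max: "\<And>s. s \<in> {0..t} \<Longrightarrow>
       exp (- (2 * L * s)) * norm (d s) \<le> exp (- (2 * L * s0)) * norm (d s0)"
    using continuous_attains_sup[of "{0..t}" "\<lambda>s. exp (- (2 * L * s)) * norm (d s)"] t by fastforce
  define M where "M = exp (- (2 * L * s0)) * norm (d s0)"
  have M0: "0 \<le> M" by (simp add: M_def)
  have ds: "norm (d s) \<le> M * exp (2 * L * s)" if "s \<in> {0..t}" for s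
    using max[OF that] by (simp add: M_def exp_minus field_simps)
  have ds0: "norm (d s0) = M * exp (2 * L * s0)"
    by (simp add: M_def exp_minus field_simps)
  \<comment> \<open>The comparison function M/2 exp(2Ls) + es has derivative L M exp(2Ls) + e, so
    the mean value inequality replaces an integral.\<close>
  have "norm (d s0 - d 0) \<le> (M / 2 * exp (2 * L * s0) + e * s0) - (M / 2 * exp (2 * L * 0) + e * 0)"
  proof (cases "s0 = 0")
    case False
    show ?thesis
    proof (rule differentiable_bound_general[where f' = d' and \<phi>' = "\<lambda>s. L * (M * exp (2 * L * s)) + e"])
      show "0 < s0" using s0 False by auto
      show "continuous_on {0..s0} d" using cont by (rule continuous_on_subset) (use s0 in auto)
      show "continuous_on {0..s0} (\<lambda>s. M / 2 * exp (2 * L * s) + e * s)" by (intro continuous_intros)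
      fix s assume s: "0 < s" "s < s0"
      show "(d has_vector_derivative d' s) (at s)" using der s s0 by auto
      show "((\<lambda>s. M / 2 * exp (2 * L * s) + e * s) has_vector_derivative L * (M * exp (2 * L * s)) + e) (at s)"
        by (auto intro!: derivative_eq_intros simp: has_real_derivative_iff_has_vector_derivative[symmetric])
      have "norm (d' s) \<le> L * norm (d s) + e" using bnd s s0 by auto
      also have "\<dots> \<le> L * (M * exp (2 * L * s)) + e"
        using ds[of s] s s0 L by (intro add_right_mono mult_left_mono) auto
      finally show "norm (d' s) \<le> L * (M * exp (2 * L * s)) + e" .
    qed
  qed auto
  moreover have "norm (d s0) \<le> norm (d 0) + norm (d s0 - d 0)"
    using norm_triangle_sub by blast
  ultimately have "M * exp (2 * L * s0) \<le> 2 * (norm (d 0) + e * s0)"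
    using M0 ds0 by auto
  moreover have "M \<le> M * exp (2 * L * s0)"
    using M0 L s0 by (simp add: mult_le_cancel_left1)
  moreover have "e * s0 \<le> e * t" using s0 e by (simp add: mult_left_mono)
  ultimately have "M \<le> 2 * (norm (d 0) + e * t)" by simp
  moreover have "norm (d t) \<le> M * exp (2 * L * t)" using ds t by simp
  ultimately show ?thesis
    by (meson exp_ge_zero mult_right_mono order_trans)
qed

text \<open>Derivatives within the segment are what \<open>local_flow\<close> provides. Negative
  times are reduced to positive ones by reversing time.\<close>

lemma gronwall:
  fixes d :: "real \<Rightarrow> 'a::real_normed_vector"
  assumes L: "0 \<le> L" and e: "0 \<le> e"
    and der: "\<And>s. s \<in> closed_segment 0 t \<Longrightarrow>
       (d has_vector_derivative d' s) (at s within closed_segment 0 t)"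
    and bnd: "\<And>s. s \<in> closed_segment 0 t \<Longrightarrow> norm (d' s) \<le> L * norm (d s) + e"
  shows "norm (d t) \<le> 2 * (norm (d 0) + e * \<bar>t\<bar>) * exp (2 * L * \<bar>t\<bar>)"
proof (cases "0 \<le> t")
  case True
  have seg: "closed_segment 0 t = {0..t}" using True by (simp add: closed_segment_eq_real_ivl)
  have "norm (d t) \<le> 2 * (norm (d 0) + e * t) * exp (2 * L * t)"
  proof (rule gronwall_nonneg[OF True L e, where d' = d'])
    show "continuous_on {0..t} d"
      using der has_vector_derivative_continuous unfolding seg continuous_on_eq_continuous_within by blast
    fix s assume s: "0 < s" "s < t"
    have "(d has_vector_derivative d' s) (at s within {0<..<t})"
      using der[of s] s seg has_vector_derivative_within_subset[of d "d' s" s "{0..t}" "{0<..<t}"] by force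
    then show "(d has_vector_derivative d' s) (at s)"
      using s at_within_open[of s "{0<..<t}"] by auto
    show "norm (d' s) \<le> L * norm (d s) + e" using bnd s seg by auto
  qed
  then show ?thesis using True by simp
next
  case False
  have seg: "closed_segment 0 t = {t..0}" using False by (simp add: closed_segment_eq_real_ivl)
  have "norm ((\<lambda>s. d (- s)) (- t)) \<le> 2 * (norm ((\<lambda>s. d (- s)) 0) + e * (- t)) * exp (2 * L * (- t))"
  proof (rule gronwall_nonneg[OF _ L e, where d' = "\<lambda>s. - d' (- s)"])
    show "0 \<le> - t" using False by simp
    have "continuous_on {t..0} d"
      using der has_vector_derivative_continuous unfolding seg continuous_on_eq_continuous_within by blast
    then show "continuous_on {0..-t} (\<lambda>s. d (- s))"
      by (rule continuous_on_compose2) (auto intro!: continuous_intros)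
    fix s assume s: "0 < s" "s < - t"
    have "(d has_vector_derivative d' (-s)) (at (-s) within {t<..<0})"
      using der[of "-s"] s seg has_vector_derivative_within_subset[of d "d' (-s)" "-s" "{t..0}" "{t<..<0}"] by force
    then have "(d has_vector_derivative d' (-s)) (at (-s))"
      using s at_within_open[of "-s" "{t<..<0}"] by auto
    moreover have "((\<lambda>s. - s) has_vector_derivative (-1::real)) (at s)"
      by (auto intro!: derivative_eq_intros simp: has_real_derivative_iff_has_vector_derivative[symmetric])
    ultimately show "((\<lambda>s. d (- s)) has_vector_derivative - d' (- s)) (at s)"
      using vector_diff_chain_at[of "\<lambda>s. -s" "-1" s d "d' (-s)"] by (simp add: o_def)
    show "norm (- d' (-s)) \<le> L * norm (d (- s)) + e" using bnd[of "-s"] s seg by auto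
  qed
  then show ?thesis using False by simp
qed

text \<open>Bootstrap: the Lipschitz bound is known only while \<open>norm (d s) < \<delta>\<close>.
  At the first time where \<delta> is reached the Gronwall bound would still apply and give a value
  below \<delta>. This serves S, which is uniformly Lipschitz only near \<Lambda>.\<close>

lemma gronwall_local_nonneg:
  fixes d :: "real \<Rightarrow> 'a::real_normed_vector"
  assumes t: "0 \<le> t" and L: "0 \<le> L"
    and der: "\<And>s. (d has_vector_derivative d' s) (at s)"
    and bnd: "\<And>s. norm (d s) < \<delta> \<Longrightarrow> norm (d' s) \<le> L * norm (d s)"
    and small: "2 * norm (d 0) * exp (2 * L * t) < \<delta>"
  shows "norm (d t) \<le> 2 * norm (d 0) * exp (2 * L * t)"
proof -
  have cont: "continuous_on A d" for A
    using der by (meson continuous_at_imp_continuous_on has_vector_derivative_continuous)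
  have est: "norm (d r) \<le> 2 * norm (d 0) * exp (2 * L * t)"
    if r: "0 \<le> r" "r \<le> t" and "\<And>s. 0 < s \<Longrightarrow> s < r \<Longrightarrow> norm (d s) < \<delta>" for r
  proof -
    have "norm (d r) \<le> 2 * (norm (d 0) + 0 * r) * exp (2 * L * r)"
      by (rule gronwall_nonneg[where d' = d']) (use that L der bnd cont in auto)
    also have "\<dots> \<le> 2 * norm (d 0) * exp (2 * L * t)"
      using L r by (simp add: mult_left_mono)
    finally show ?thesis .
  qed
  have "norm (d s) < \<delta>" if s: "s \<in> {0..t}" for s
  proof (rule ccontr)
    assume s': "\<not> norm (d s) < \<delta>"
    have "compact ({0..t} \<inter> {s. \<delta> \<le> norm (d s)})"
      by (intro compact_Int_closed compact_Icc closed_Collect_le continuous_intros cont)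
    moreover have "s \<in> {0..t} \<inter> {s. \<delta> \<le> norm (d s)}" using s s' by auto
    ultimately obtain r where r: "r \<in> {0..t}" "\<delta> \<le> norm (d r)"
      and min: "\<And>s. s \<in> {0..t} \<Longrightarrow> \<delta> \<le> norm (d s) \<Longrightarrow> r \<le> s"
      using compact_attains_inf[of "{0..t} \<inter> {s. \<delta> \<le> norm (d s)}"] by fastforce
    have "norm (d r) \<le> 2 * norm (d 0) * exp (2 * L * t)"
    proof (rule est)
      show "norm (d s) < \<delta>" if "0 < s" "s < r" for s
        using min[of s] that r by force
    qed (use r in auto)
    then show False using small r by simp
  qed
  then show ?thesis using t by (intro est) auto
qed

lemma gronwall_local:
  fixes d :: "real \<Rightarrow> 'a::real_normed_vector"
  assumes L: "0 \<le> L"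
    and der: "\<And>s. (d has_vector_derivative d' s) (at s)"
    and bnd: "\<And>s. norm (d s) < \<delta> \<Longrightarrow> norm (d' s) \<le> L * norm (d s)"
    and small: "2 * norm (d 0) * exp (2 * L * \<bar>t\<bar>) < \<delta>"
  shows "norm (d t) \<le> 2 * norm (d 0) * exp (2 * L * \<bar>t\<bar>)"
proof (cases "0 \<le> t")
  case True
  then show ?thesis using gronwall_local_nonneg[OF True L der bnd] small by simp
next
  case False
  have "((\<lambda>s. d (- s)) has_vector_derivative - d' (- s)) (at s)" for s
  proof -
    have "((\<lambda>s. - s) has_vector_derivative (-1::real)) (at s)"
      by (auto intro!: derivative_eq_intros simp: has_real_derivative_iff_has_vector_derivative[symmetric])
    then show ?thesis
      using vector_diff_chain_at[of "\<lambda>s. -s" "-1" s d "d' (-s)"] der by (simp add: o_def)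
  qed
  then show ?thesis
    using gronwall_local_nonneg[of "- t" L "\<lambda>s. d (- s)" "\<lambda>s. - d' (- s)" \<delta>] False L bnd small by simp
qed

lemma gronwall_UNIV:
  fixes d :: "real \<Rightarrow> 'a::real_normed_vector"
  assumes "0 \<le> L" "0 \<le> e"
    and "\<And>s. (d has_vector_derivative d' s) (at s)"
    and "\<And>s. s \<in> closed_segment 0 t \<Longrightarrow> norm (d' s) \<le> L * norm (d s) + e"
  shows "norm (d t) \<le> 2 * (norm (d 0) + e * \<bar>t\<bar>) * exp (2 * L * \<bar>t\<bar>)"
  using assms by (intro gronwall[where d' = d']) (auto intro: has_vector_derivative_at_within)

lemma ode_unique:
  fixes x y :: "real \<Rightarrow> 'a::real_normed_vector"
  assumes L: "0 \<le> L"
    and x: "\<And>s. s \<in> closed_segment 0 t \<Longrightarrow>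
       (x has_vector_derivative f s (x s)) (at s within closed_segment 0 t)"
    and y: "\<And>s. s \<in> closed_segment 0 t \<Longrightarrow>
       (y has_vector_derivative f s (y s)) (at s within closed_segment 0 t)"
    and lip: "\<And>s. s \<in> closed_segment 0 t \<Longrightarrow> norm (f s (x s) - f s (y s)) \<le> L * norm (x s - y s)"
    and "x 0 = y 0"
  shows "x t = y t"
  using gronwall[OF L order_refl, of t "\<lambda>s. x s - y s" "\<lambda>s. f s (x s) - f s (y s)"] assms
  by (auto intro: has_vector_derivative_diff)

text \<open>Quantitative core of the Picard iteration: integrating the weight exp(L|s|) divides its
  coefficient by L, and this division produces the contraction factor.\<close>

lemma antiderivative_exp_bound:
  fixes F :: "real \<Rightarrow> 'a::real_normed_vector"
  assumes L: "0 < L" and B: "0 \<le> B"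
    and F0: "F 0 = 0" and der: "\<And>s. (F has_vector_derivative h s) (at s)"
    and bnd: "\<And>s. norm (h s) \<le> B + a * exp (L * \<bar>s\<bar>)"
  shows "norm (F t) \<le> B * \<bar>t\<bar> + a / L * exp (L * \<bar>t\<bar>) - a / L"
proof -
  have *: "norm (G r) \<le> B * r + a / L * exp (L * r) - a / L"
    if r: "0 \<le> r" and G0: "G 0 = 0" and G: "\<And>s. (G has_vector_derivative g s) (at s)"
      and g: "\<And>s. 0 < s \<Longrightarrow> norm (g s) \<le> B + a * exp (L * s)" for G g and r :: real
  proof (cases "r = 0")
    case False
    have "norm (G r - G 0) \<le> (B * r + a / L * exp (L * r)) - (B * 0 + a / L * exp (L * 0))"
    proof (rule differentiable_bound_general[where f' = g and \<phi>' = "\<lambda>s. B + a * exp (L * s)"])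
      show "0 < r" using r False by simp
      show "continuous_on {0..r} G"
        using G by (meson continuous_at_imp_continuous_on has_vector_derivative_continuous)
      show "continuous_on {0..r} (\<lambda>r. B * r + a / L * exp (L * r))" by (intro continuous_intros)
      show "((\<lambda>r. B * r + a / L * exp (L * r)) has_vector_derivative B + a * exp (L * s)) (at s)" for s
        using L by (auto intro!: derivative_eq_intros simp: has_real_derivative_iff_has_vector_derivative[symmetric])
    qed (use G g in auto)
    then show ?thesis using G0 by simp
  qed (use G0 in auto)
  show ?thesis
  proof (cases "0 \<le> t")
    case True
    show ?thesis using *[OF True F0 der] bnd True by (smt (verit))
  next
    case False
    have "((\<lambda>s. F (- s)) has_vector_derivative - h (- s)) (at s)" for s
    proof -
      have "((\<lambda>s. - s) has_vector_derivative (-1::real)) (at s)"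
        by (auto intro!: derivative_eq_intros simp: has_real_derivative_iff_has_vector_derivative[symmetric])
      then show ?thesis
        using vector_diff_chain_at[of "\<lambda>s. -s" "-1" s F "h (-s)"] der by (simp add: o_def)
    qed
    moreover have "norm (- h (- s)) \<le> B + a * exp (L * s)" if "0 < s" for s
      using bnd[of "-s"] that by simp
    ultimately show ?thesis
      using *[of "- t" "\<lambda>s. F (- s)" "\<lambda>s. - h (- s)"] F0 False by simp
  qed
qed

text \<open>The solution is obtained on the whole line at once, without continuation: the fixed
  point is sought for the rescaled function exp(-2L|s|) x(s), which is bounded.\<close>

lemma picard_lindeloef_global:
  fixes f :: "real \<Rightarrow> 'a \<Rightarrow> 'a::euclidean_space"
  assumes L: "0 < L" and B: "0 \<le> B"
    and cont: "continuous_on UNIV (\<lambda>(s, x). f s x)"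
    and lip: "\<And>s x y. norm (f s x - f s y) \<le> L * norm (x - y)"
    and bnd: "\<And>s. norm (f s 0) \<le> B"
  obtains x where "x 0 = p" "\<And>s. (x has_vector_derivative f s (x s)) (at s)"
proof -
  \<comment> \<open>\<open>z\<close> is the rescaled unknown and \<open>?X z\<close> the candidate
    solution. The rate 2L, twice the Lipschitz constant, makes the integral operator contract by L /
    (2L) = 1/2.\<close>
  let ?e = "\<lambda>s::real. exp (2 * L * \<bar>s\<bar>)"
  let ?X = "\<lambda>z s. ?e s *\<^sub>R apply_bcontfun z s"
  have "\<exists>F. \<forall>z::real \<Rightarrow>\<^sub>C 'a. F z 0 = 0 \<and> (\<forall>s. (F z has_vector_derivative f s (?X z s)) (at s))"
  proof (rule choice, rule allI)
    fix z :: "real \<Rightarrow>\<^sub>C 'a"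
    have "continuous_on UNIV (\<lambda>s. case (s, ?X z s) of (s, x) \<Rightarrow> f s x)"
      by (rule continuous_on_compose2[OF cont]) (auto intro!: continuous_intros)
    then show "\<exists>F. F 0 = 0 \<and> (\<forall>s. (F has_vector_derivative f s (?X z s)) (at s))"
      using antiderivative_exists[of "\<lambda>s. f s (?X z s)"] by auto
  qed
  then obtain F where F0: "\<And>z::real \<Rightarrow>\<^sub>C 'a. F z 0 = 0"
    and F: "\<And>z s. (F z has_vector_derivative f s (?X z s)) (at s)" by blast
  define G where "G z s = exp (- (2 * L * \<bar>s\<bar>)) *\<^sub>R (p + F z s)" for z s
  have Fcont: "continuous_on UNIV (F z)" for z
    using F by (meson continuous_at_imp_continuous_on has_vector_derivative_continuous)
  have G: "G z \<in> bcontfun" for z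
  proof (rule bcontfun_normI)
    show "continuous_on UNIV (G z)"
      unfolding G_def by (intro continuous_intros Fcont)
    fix t
    have "norm (f s (?X z s)) \<le> B + (L * norm z) * exp (2 * L * \<bar>s\<bar>)" for s
    proof -
      have "norm (f s (?X z s)) \<le> norm (f s 0) + norm (f s (?X z s) - f s 0)"
        using norm_triangle_sub by blast
      also have "\<dots> \<le> B + L * norm (?X z s - 0)"
        using bnd lip by (intro add_mono)
      also have "\<dots> \<le> B + L * (?e s * norm z)"
        using L norm_bounded[of z s] by (auto intro!: mult_left_mono)
      finally show ?thesis by (simp add: mult_ac)
    qed
    then have "norm (F z t) \<le> B * \<bar>t\<bar> + (L * norm z) / (2 * L) * ?e t - (L * norm z) / (2 * L)"
      by (rule antiderivative_exp_bound[OF _ B F0 F, rotated]) (use L in simp)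
    also have "\<dots> \<le> B * \<bar>t\<bar> + norm z * ?e t"
    proof -
      have *: "(L * norm z) / (2 * L) = norm z / 2" using L by simp
      have "0 \<le> norm z * ?e t" "0 \<le> norm z" by simp_all
      then show ?thesis unfolding * by linarith
    qed
    also have "\<dots> \<le> (B / (2 * L)) * ?e t + norm z * ?e t"
    proof -
      have "2 * L * \<bar>t\<bar> \<le> ?e t"
        using exp_ge_add_one_self[of "2 * L * \<bar>t\<bar>"] by linarith
      then have "(B / (2 * L)) * (2 * L * \<bar>t\<bar>) \<le> (B / (2 * L)) * ?e t"
        using B L by (intro mult_left_mono) auto
      then show ?thesis using L by simp
    qed
    finally have "norm (p + F z t) \<le> norm p * ?e t + ((B / (2 * L)) * ?e t + norm z * ?e t)"
    proof -
      assume a: "norm (F z t) \<le> (B / (2 * L)) * ?e t + norm z * ?e t"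
      have "norm p \<le> norm p * ?e t" using L by (simp add: mult_le_cancel_left1)
      then show ?thesis using a norm_triangle_ineq[of p "F z t"] by linarith
    qed
    also have "\<dots> = (norm p + B / (2 * L) + norm z) * ?e t" by (simp add: algebra_simps)
    finally have "norm (p + F z t) / ?e t \<le> norm p + B / (2 * L) + norm z"
      by (simp add: pos_divide_le_eq)
    moreover have "norm (G z t) = norm (p + F z t) / ?e t"
      by (simp add: G_def exp_minus divide_inverse)
    ultimately show "norm (G z t) \<le> norm p + B / (2 * L) + norm z" by simp
  qed
  have contr: "dist (Bcontfun (G z)) (Bcontfun (G z')) \<le> (1 / 2) * dist z z'" for z z'
  proof (rule dist_bound)
    fix t
    have "norm ((\<lambda>s. F z s - F z' s) t) \<le> 0 * \<bar>t\<bar> + (L * dist z z') / (2 * L) * ?e t - (L * dist z z') / (2 * L)"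
    proof (rule antiderivative_exp_bound[where h = "\<lambda>s. f s (?X z s) - f s (?X z' s)"])
      fix s
      have "norm (f s (?X z s) - f s (?X z' s)) \<le> L * norm (?X z s - ?X z' s)" by (rule lip)
      also have "\<dots> = L * (?e s * dist (apply_bcontfun z s) (apply_bcontfun z' s))"
        by (simp add: dist_norm flip: scaleR_diff_right)
      also have "\<dots> \<le> L * (?e s * dist z z')"
        using L by (intro mult_left_mono dist_bounded) auto
      finally show "norm (f s (?X z s) - f s (?X z' s)) \<le> 0 + L * dist z z' * exp (2 * L * \<bar>s\<bar>)"
        by (simp add: mult_ac)
    qed (use L F F0 in \<open>auto intro: has_vector_derivative_diff\<close>)
    moreover have "(L * dist z z') / (2 * L) = dist z z' / 2" using L by simp
    ultimately have "norm (F z t - F z' t) \<le> 1 / 2 * dist z z' * ?e t"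
      using zero_le_dist[of z z'] unfolding \<open>(L * dist z z') / (2 * L) = dist z z' / 2\<close> by linarith
    then have "norm (F z t - F z' t) / ?e t \<le> 1 / 2 * dist z z'"
      by (simp add: pos_divide_le_eq)
    moreover have "dist (G z t) (G z' t) = norm (F z t - F z' t) / ?e t"
      by (simp add: G_def dist_norm exp_minus divide_inverse flip: scaleR_diff_right)
    ultimately show "dist (Bcontfun (G z) t) (Bcontfun (G z') t) \<le> (1 / 2) * dist z z'"
      by (simp add: Bcontfun_inverse G)
  qed
  obtain z where z: "Bcontfun (G z) = z"
    using banach_fix_type[of "1/2" "\<lambda>z. Bcontfun (G z)"] contr by auto
  have "?X z s = p + F z s" for s
  proof -
    have "apply_bcontfun z s = G z s" by (metis z Bcontfun_inverse G)
    then show ?thesis by (simp add: G_def exp_minus)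
  qed
  then have X: "?X z = (\<lambda>s. p + F z s)" by blast
  show thesis
  proof (rule that[of "?X z"])
    show "?X z 0 = p" using X F0 by (metis add.right_neutral)
    fix s
    have "((\<lambda>s. p + F z s) has_vector_derivative f s (?X z s)) (at s)"
      using has_vector_derivative_add[OF has_vector_derivative_const F[of z s]] by simp
    then show "(?X z has_vector_derivative f s (?X z s)) (at s)"
      unfolding X .
  qed
qed

subsection \<open>Vector fields of class C1 and their local flows\<close>

lemma C1_field_has_derivative:
  assumes "C1_field X"
  shows "(X has_derivative blinfun_apply (vf_deriv X w)) (at w)"
proof -
  have d: "(X has_derivative frechet_derivative X (at w)) (at w)"
    using assms by (simp add: C1_field_def frechet_derivative_works)
  then have "bounded_linear (frechet_derivative X (at w))"
    by (rule has_derivative_bounded_linear)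
  then show ?thesis using d by (simp add: vf_deriv_def bounded_linear_Blinfun_apply)
qed

lemma C1_field_continuous: "C1_field X \<Longrightarrow> continuous_on A X"
  by (meson C1_field_has_derivative continuous_at_imp_continuous_on has_derivative_continuous)

lemma C1_field_continuous_deriv: "C1_field X \<Longrightarrow> continuous_on A (vf_deriv X)"
  unfolding C1_field_def by (meson continuous_on_subset subset_UNIV)

lemma vf_deriv_eqI:
  assumes "(X has_derivative blinfun_apply D) (at w)"
  shows "vf_deriv X w = D"
  using frechet_derivative_at[OF assms] by (metis vf_deriv_def blinfun_apply_inverse)

lemma vf_deriv_diff:
  assumes "C1_field V" "C1_field S"
  shows "vf_deriv (\<lambda>w. V w - S w) w = vf_deriv V w - vf_deriv S w"
proof (rule vf_deriv_eqI)
  have "blinfun_apply (vf_deriv V w - vf_deriv S w) = (\<lambda>h. vf_deriv V w h - vf_deriv S w h)"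
    by (simp add: fun_eq_iff minus_blinfun.rep_eq)
  then show "((\<lambda>w. V w - S w) has_derivative blinfun_apply (vf_deriv V w - vf_deriv S w)) (at w)"
    using has_derivative_diff[OF C1_field_has_derivative[OF assms(1), of w] C1_field_has_derivative[OF assms(2), of w]] by simp
qed

lemma C1_norm_lessD:
  assumes "C1_norm X < ereal \<delta>"
  shows "norm (X w) < \<delta>" "norm (vf_deriv X w) < \<delta>"
proof -
  have "ereal (max (norm (X w)) (norm (vf_deriv X w))) \<le> C1_norm X"
    unfolding C1_norm_def by (rule SUP_upper) simp
  then have "ereal (max (norm (X w)) (norm (vf_deriv X w))) < ereal \<delta>" using assms by (rule order_le_less_trans)
  then show "norm (X w) < \<delta>" "norm (vf_deriv X w) < \<delta>" by simp_all
qed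

lemma C1_field_lipschitz_cball:
  assumes V: "C1_field V"
  shows "\<exists>L\<ge>0. \<forall>x\<in>cball 0 R. \<forall>y\<in>cball 0 R. norm (V x - V y) \<le> L * norm (x - y)"
proof -
  have "compact (vf_deriv V ` cball 0 R)"
    using V by (intro compact_continuous_image C1_field_continuous_deriv) auto
  then obtain L where L: "\<And>x. x \<in> cball 0 R \<Longrightarrow> norm (vf_deriv V x) \<le> L"
    using compact_imp_bounded bounded_iff by (metis imageI)
  show ?thesis
  proof (intro exI[of _ "max 0 L"] conjI ballI)
    fix x y :: 'a assume xy: "x \<in> cball 0 R" "y \<in> cball 0 R"
    show "norm (V x - V y) \<le> max 0 L * norm (x - y)"
    proof (rule differentiable_bound[OF convex_cball _ _ xy])
      show "(V has_derivative blinfun_apply (vf_deriv V x)) (at x within cball 0 R)" for x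
        using C1_field_has_derivative[OF V] has_derivative_at_withinI by blast
      show "onorm (blinfun_apply (vf_deriv V x)) \<le> max 0 L" if "x \<in> cball 0 R" for x
        using L[OF that] by (simp flip: norm_blinfun.rep_eq)
    qed
  qed simp
qed

text \<open>On the compact segment both solutions stay in one ball, and there a C1 field is
  Lipschitz even if it is not so globally.\<close>

lemma C1_ode_unique:
  assumes V: "C1_field V"
    and u: "\<And>s. s \<in> closed_segment 0 t \<Longrightarrow>
       (u has_vector_derivative V (u s)) (at s within closed_segment 0 t)"
    and v: "\<And>s. s \<in> closed_segment 0 t \<Longrightarrow>
       (v has_vector_derivative V (v s)) (at s within closed_segment 0 t)"
    and "u 0 = v 0"
  shows "u t = v t"
proof -
  have c: "continuous_on (closed_segment 0 t) u" "continuous_on (closed_segment 0 t) v"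
    using u v has_vector_derivative_continuous unfolding continuous_on_eq_continuous_within by blast+
  then have "bounded (u ` closed_segment 0 t \<union> v ` closed_segment 0 t)"
    by (simp add: compact_imp_bounded compact_continuous_image)
  then obtain R where R: "u ` closed_segment 0 t \<union> v ` closed_segment 0 t \<subseteq> cball 0 R"
    using bounded_subset_ballD[of _ 0] ball_subset_cball by (metis order_trans)
  obtain L where L: "0 \<le> L"
    "\<forall>x\<in>cball 0 R. \<forall>y\<in>cball 0 R. norm (V x - V y) \<le> L * norm (x - y)"
    using C1_field_lipschitz_cball[OF V, of R] by blast
  show ?thesis
  proof (rule ode_unique[where f = "\<lambda>s. V", OF L(1) u v])
    fix s assume "s \<in> closed_segment 0 t"
    then have "u s \<in> cball 0 R" "v s \<in> cball 0 R" using R by blast+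
    then show "norm (V (u s) - V (v s)) \<le> L * norm (u s - v s)" using L(2) by blast
  qed (use \<open>u 0 = v 0\<close> in auto)
qed

section \<open>Uniqueness of local flows, first hits and cross-section flows\<close>

lemma closed_segment_0_subset:
  fixes t :: real
  assumes "t' \<in> closed_segment 0 t"
  shows "closed_segment 0 t' \<subseteq> closed_segment 0 t"
  using assms by (auto simp: closed_segment_eq_real_ivl split: if_splits)

lemma local_flow_unique:
  assumes "C1_field V" "local_flow V t p q" "local_flow V t p q'"
  shows "q = q'"
  using assms C1_ode_unique[OF assms(1)] unfolding local_flow_def by metis

lemma local_flowI:
  assumes "\<And>s. s \<in> closed_segment 0 t \<Longrightarrow>
       (u has_vector_derivative V (u s)) (at s within closed_segment 0 t)"
    and "u 0 = p" "u t = q"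
  shows "local_flow V t p q"
  using assms unfolding local_flow_def by blast

text \<open>Neither hitting time can lie strictly between 0 and the other one, and both have the
  sign of t, so they coincide.\<close>

lemma first_hit_unique:
  assumes V: "C1_field V"
    and "first_hit S \<phi> V t w p q" "first_hit S \<phi> V t w p q'"
  shows "q = q'"
proof -
  obtain t0 where t0: "sgn t0 = sgn t" "local_flow V t0 p q"
    "\<And>t' q'. t' \<in> open_segment 0 t0 \<Longrightarrow> local_flow V t' p q' \<Longrightarrow> q' \<notin> cross_section S (\<phi> t w)"
    and q: "q \<in> cross_section S (\<phi> t w)"
    using assms(2) unfolding first_hit_def by blast
  obtain t1 where t1: "sgn t1 = sgn t" "local_flow V t1 p q'"
    "\<And>t' q'. t' \<in> open_segment 0 t1 \<Longrightarrow> local_flow V t' p q' \<Longrightarrow> q' \<notin> cross_section S (\<phi> t w)"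
    and q': "q' \<in> cross_section S (\<phi> t w)"
    using assms(3) unfolding first_hit_def by blast
  have "t0 \<notin> open_segment 0 t1" "t1 \<notin> open_segment 0 t0"
    using t0 t1 q q' by blast+
  then have "t0 = t1"
    using t0(1) t1(1) by (auto simp: open_segment_eq_real_ivl sgn_if split: if_splits)
  then show ?thesis using local_flow_unique[OF V] t0 t1 by blast
qed

text \<open>Along a partition finer than both thresholds, first hits determine each point of either
  curve from the preceding one. Hence the description by \<open>THE\<close> in \<open>cs_map\<close>
  has at most one candidate.\<close>

lemma cs_flow_unique:
  assumes V: "C1_field V"
    and "cs_flow S \<phi> V t w p q" "cs_flow S \<phi> V t w p q'"
  shows "q = q'"
proof -
  obtain c \<eta> where c: "c 0 = p" "c t = q" "\<eta> > 0"
    "\<And>s s'. s \<in> closed_segment 0 t \<Longrightarrow> s' \<in> closed_segment 0 t \<Longrightarrow> \<bar>s' - s\<bar> < \<eta> \<Longrightarrow>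
           first_hit S \<phi> V (s' - s) (\<phi> s w) (c s) (c s')"
    using assms(2) unfolding cs_flow_def by blast
  obtain c' \<eta>' where c': "c' 0 = p" "c' t = q'" "\<eta>' > 0"
    "\<And>s s'. s \<in> closed_segment 0 t \<Longrightarrow> s' \<in> closed_segment 0 t \<Longrightarrow> \<bar>s' - s\<bar> < \<eta>' \<Longrightarrow>
           first_hit S \<phi> V (s' - s) (\<phi> s w) (c' s) (c' s')"
    using assms(3) unfolding cs_flow_def by blast
  obtain n :: nat where n: "\<bar>t\<bar> / min \<eta> \<eta>' < real n" using reals_Archimedean2 by blast
  have n0: "0 < real n"
    using n c(3) c'(3) by (smt (verit) divide_nonneg_pos min_def)
  have step: "\<bar>t\<bar> / real n < min \<eta> \<eta>'"
  proof -
    have "\<bar>t\<bar> < real n * min \<eta> \<eta>'"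
      using n c(3) c'(3) pos_divide_less_eq[of "min \<eta> \<eta>'"] by simp
    then show ?thesis using n0 pos_divide_less_eq[of "real n"] by (simp only: mult.commute)
  qed
  have seg: "real k * t / real n \<in> closed_segment 0 t" if "k \<le> n" for k
    unfolding closed_segment_def
    using that n0 by (auto intro!: exI[of _ "real k / real n"])
  have "c (real k * t / real n) = c' (real k * t / real n)" if "k \<le> n" for k
    using that
  proof (induction k)
    case 0
    then show ?case using c c' by simp
  next
    case (Suc k)
    have "\<bar>real (Suc k) * t / real n - real k * t / real n\<bar> = \<bar>t\<bar> / real n"
      by (simp add: algebra_simps flip: diff_divide_distrib)
    then have *: "\<bar>real (Suc k) * t / real n - real k * t / real n\<bar> < \<eta>"
      "\<bar>real (Suc k) * t / real n - real k * t / real n\<bar> < \<eta>'" using step by auto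
    have s: "real k * t / real n \<in> closed_segment 0 t" "real (Suc k) * t / real n \<in> closed_segment 0 t"
      using seg[of k] seg[of "Suc k"] Suc by auto
    have "c (real k * t / real n) = c' (real k * t / real n)" using Suc by simp
    then show ?case
      using first_hit_unique[OF V c(4)[OF s *(1)]] c'(4)[OF s *(2)] by simp
  qed
  from this[of n] show ?thesis using n0 c c' by simp
qed

subsection \<open>Bounded orbits of perturbed hyperbolic sequences\<close>

text \<open>Banach iteration started at the zero family. The fibres \<open>X k\<close> vary and two
  families may be at infinite sup distance, so the contraction is stated through an arbitrary bound
  D; limits are taken index by index at a uniform geometric rate, whose sum gives 2 B.\<close>

lemma contraction_fixed_family:
  fixes F :: "('i \<Rightarrow> 'a::banach) \<Rightarrow> 'i \<Rightarrow> 'a"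
  assumes X0: "\<And>k. 0 \<in> X k" and cl: "\<And>k. closed (X k)"
    and F: "\<And>x k. (\<And>k. x k \<in> X k) \<Longrightarrow> F x k \<in> X k"
    and contr: "\<And>x y D k. (\<And>k. x k \<in> X k) \<Longrightarrow> (\<And>k. y k \<in> X k) \<Longrightarrow>
       (\<And>k. norm (x k - y k) \<le> D) \<Longrightarrow> norm (F x k - F y k) \<le> D / 2"
    and F0: "\<And>k. norm (F (\<lambda>_. 0) k) \<le> B"
  obtains x where "\<And>k. x k \<in> X k" "F x = x" "\<And>k. norm (x k) \<le> 2 * B"
proof -
  define x where "x n = (F ^^ n) (\<lambda>_. 0)" for n
  have x0: "x 0 = (\<lambda>_. 0)" and xS: "x (Suc n) = F (x n)" for n by (auto simp: x_def)
  have B: "0 \<le> B" using F0 norm_ge_zero order_trans by blast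
  have xX: "x n k \<in> X k" for n k
    by (induction n arbitrary: k) (auto simp: x0 xS intro: X0 F)
  have step: "norm (x (Suc n) k - x n k) \<le> B / 2 ^ n" for n k
  proof (induction n arbitrary: k)
    case (Suc n)
    show ?case using contr[OF xX xX Suc] by (simp add: xS mult.commute)
  qed (use F0 in \<open>simp add: x0 xS\<close>)
  have "norm (x (n + m) k - x n k) \<le> 2 * B / 2 ^ n - 2 * B / 2 ^ (n + m)" for n m k
  proof (induction m)
    case (Suc m)
    have "norm (x (n + Suc m) k - x n k) \<le> norm (x (Suc (n + m)) k - x (n + m) k) + norm (x (n + m) k - x n k)"
      using norm_triangle_ineq[of "x (Suc (n + m)) k - x (n + m) k" "x (n + m) k - x n k"] by simp
    also have "\<dots> \<le> B / 2 ^ (n + m) + (2 * B / 2 ^ n - 2 * B / 2 ^ (n + m))"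
      using step[of "n + m" k] Suc by (rule add_mono)
    also have "\<dots> = 2 * B / 2 ^ n - 2 * B / 2 ^ (n + Suc m)" by (simp add: field_simps)
    finally show ?case .
  qed simp
  moreover have "0 \<le> 2 * B / 2 ^ (n + m)" for n m using B by simp
  ultimately have tail: "norm (x (n + m) k - x n k) \<le> 2 * B / 2 ^ n" for n m k
    by (smt (verit))
  have lim0: "(\<lambda>n. C / 2 ^ n) \<longlonglongrightarrow> 0" for C :: real
    using tendsto_mult_right_zero[OF LIMSEQ_power_zero[of "1/2::real"], of C] by (simp add: power_divide)
  have "Cauchy (\<lambda>n. x n k)" for k
  proof (rule CauchyI')
    fix e :: real assume "0 < e"
    then obtain M where M: "2 * B / 2 ^ M < e / 2"
      using LIMSEQ_D[OF lim0[of "2 * B"], of "e / 2"] B by (auto simp: abs_of_nonneg)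
    have "dist (x m k) (x n k) < e" if "m \<ge> M" "n > m" for m n
    proof -
      have "dist (x m k) (x n k) \<le> norm (x (M + (m - M)) k - x M k) + norm (x (M + (n - M)) k - x M k)"
        using dist_triangle2[of "x m k" "x n k" "x M k"] that by (simp add: dist_norm)
      also have "\<dots> \<le> 2 * B / 2 ^ M + 2 * B / 2 ^ M" by (intro add_mono tail)
      finally show ?thesis using M by simp
    qed
    then show "\<exists>M. \<forall>m\<ge>M. \<forall>n>m. dist (x m k) (x n k) < e" by blast
  qed
  then have conv: "convergent (\<lambda>n. x n k)" for k by (rule Cauchy_convergent)
  define f where "f k = lim (\<lambda>n. x n k)" for k
  have f: "(\<lambda>n. x n k) \<longlonglongrightarrow> f k" for k
    using conv unfolding f_def convergent_LIMSEQ_iff .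
  have close: "norm (f k - x n k) \<le> 2 * B / 2 ^ n" for n k
  proof (rule Lim_norm_ubound[OF trivial_limit_sequentially])
    show "(\<lambda>m. x (m + n) k - x n k) \<longlonglongrightarrow> f k - x n k"
      by (rule tendsto_diff[OF LIMSEQ_ignore_initial_segment[OF f] tendsto_const])
    show "\<forall>\<^sub>F m in sequentially. norm (x (m + n) k - x n k) \<le> 2 * B / 2 ^ n"
    proof (intro always_eventually allI)
      show "norm (x (m + n) k - x n k) \<le> 2 * B / 2 ^ n" for m
        using tail[of n m k] unfolding add.commute[of n m] .
    qed
  qed
  have fX: "f k \<in> X k" for k
    using closed_sequentially[OF cl xX f] .
  show thesis
  proof (rule that[OF fX])
    show "F f = f"
    proof
      fix k
      have "norm (F f k - x (Suc n) k) \<le> 2 * B / 2 ^ n / 2" for n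
        using contr[OF fX xX close] by (simp add: xS)
      then have "norm (F f k - x (Suc n) k) \<le> B / 2 ^ n" for n by simp
      then have "(\<lambda>n. F f k - x (Suc n) k) \<longlonglongrightarrow> 0"
        by (intro tendsto_0_le[OF lim0[of B], where K = 1] always_eventually allI) (use B in simp)
      moreover have "(\<lambda>n. F f k - x (Suc n) k) \<longlonglongrightarrow> F f k - f k"
        by (rule tendsto_diff[OF tendsto_const LIMSEQ_Suc[OF f]])
      ultimately show "F f k = f k" using LIMSEQ_unique by fastforce
    qed
    show "norm (f k) \<le> 2 * B" for k using close[of k 0] by (simp add: x0)
  qed
qed

text \<open>A dichotomy for a difference equation with varying coefficients; \<open>L'\<close>
  inverts \<open>L\<close> only along the unstable spaces. The constant c bounds both projections of
  the splitting, and \<eta> is the size of admissible perturbations. The thresholds 1/8 are chosen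
  so that the errors below add up to a contraction by 1/2.\<close>

locale discrete_dichotomy =
  fixes Es Eu :: "int \<Rightarrow> 'a::euclidean_space set" and L L' :: "int \<Rightarrow> 'a \<Rightarrow> 'a"
    and \<theta> c \<eta> :: real
  assumes Es: "subspace (Es k)" and Eu: "subspace (Eu k)"
    and L: "linear (L k)" and L': "linear (L' k)"
    and L_Es: "x \<in> Es k \<Longrightarrow> L k x \<in> Es (k + 1)" and L_contr: "x \<in> Es k \<Longrightarrow> norm (L k x) \<le> \<theta> * norm x"
    and L_Eu: "x \<in> Eu k \<Longrightarrow> L k x \<in> Eu (k + 1)"
    and L'_Eu: "x \<in> Eu (k + 1) \<Longrightarrow> L' k x \<in> Eu k"
    and L'_contr: "x \<in> Eu (k + 1) \<Longrightarrow> norm (L' k x) \<le> \<theta> * norm x"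
    and L_L': "x \<in> Eu (k + 1) \<Longrightarrow> L k (L' k x) = x"
    and L'_L: "x \<in> Eu k \<Longrightarrow> L' k (L k x) = x"
    and angle: "x \<in> Es k \<Longrightarrow> y \<in> Eu k \<Longrightarrow> norm x \<le> c * norm (x + y) \<and> norm y \<le> c * norm (x + y)"
    and \<theta>: "0 \<le> \<theta>" "\<theta> \<le> 1" and c: "0 \<le> c" and \<eta>: "0 \<le> \<eta>"
    and c\<theta>: "c * \<theta> \<le> 1 / 8" and c\<eta>: "c * \<eta> \<le> 1 / 8"
begin

definition E where "E k = {x + y |x y. x \<in> Es k \<and> y \<in> Eu k}"

definition P where "P k z = (SOME x. x \<in> Es k \<and> z - x \<in> Eu k)"

lemma P: assumes "z \<in> E k" shows "P k z \<in> Es k" "z - P k z \<in> Eu k"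
proof -
  have "\<exists>x. x \<in> Es k \<and> z - x \<in> Eu k" using assms by (auto simp: E_def)
  then have "P k z \<in> Es k \<and> z - P k z \<in> Eu k" unfolding P_def by (rule someI_ex)
  then show "P k z \<in> Es k" "z - P k z \<in> Eu k" by auto
qed

lemma subspace_E: "subspace (E k)"
  unfolding E_def by (rule subspace_sums[OF Es Eu])

lemma P_lipschitz:
  assumes "z \<in> E k" "z' \<in> E k"
  shows "norm (P k z - P k z') \<le> c * norm (z - z')"
    "norm ((z - P k z) - (z' - P k z')) \<le> c * norm (z - z')"
  using angle[of "P k z - P k z'" k "(z - P k z) - (z' - P k z')"] P[OF assms(1)] P[OF assms(2)] Es Eu
  by (auto simp: subspace_diff)

text \<open>Uniqueness of the decomposition is hidden in \<open>angle\<close>: two decompositions of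
  one vector differ by a stable and an unstable vector whose sum is 0.\<close>

lemma P_sum: assumes "x \<in> Es k" "y \<in> Eu k" shows "P k (x + y) = x"
proof -
  have "x + y \<in> E k" using assms by (auto simp: E_def)
  then have "x - P k (x + y) \<in> Es k" "y - (x + y - P k (x + y)) \<in> Eu k"
    using subspace_diff[OF Es _ P(1)] subspace_diff[OF Eu _ P(2)] assms by blast+
  then have "norm (x - P k (x + y)) \<le> c * norm ((x - P k (x + y)) + (y - (x + y - P k (x + y))))"
    using angle by blast
  then show ?thesis by simp
qed

lemma P_0: "P k 0 = 0"
  using P_sum[of 0 k 0] Es Eu by (simp add: subspace_0)

lemma L_E: "x \<in> E k \<Longrightarrow> L k x \<in> E (k + 1)"
  unfolding E_def using L_Es L_Eu linear_add[OF L] by fastforce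

lemma P_norm:
  assumes "z \<in> E k"
  shows "norm (P k z) \<le> c * norm z" "norm (z - P k z) \<le> c * norm z"
  using P_lipschitz[OF assms subspace_0[OF subspace_E]] by (auto simp: P_0)

lemma P_L: assumes "x \<in> E k" shows "P (k + 1) (L k x) = L k (P k x)"
proof -
  have "L k x = L k (P k x) + L k (x - P k x)" by (simp flip: linear_add[OF L])
  then show ?thesis using P_sum[OF L_Es L_Eu] P[OF assms] by metis
qed

lemma P_diff: assumes "x \<in> E k" "y \<in> E k" shows "P k (x - y) = P k x - P k y"
proof -
  have "x - y = (P k x - P k y) + ((x - P k x) - (y - P k y))" by simp
  then show ?thesis using P_sum P[OF assms(1)] P[OF assms(2)] Es Eu by (metis subspace_diff)
qed

lemma \<theta>c\<eta>: "\<theta> * (c * \<eta>) \<le> 1 / 8"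
  using mult_mono[of \<theta> 1 "c * \<eta>" "1/8"] \<theta> c \<eta> c\<eta> by simp

text \<open>Discrete expansivity. The stable part at k is controlled through index k - 1 and the
  unstable part through index k + 1, each by a quarter of any bound D for the whole sequence. So
  every bound can be halved.\<close>

lemma bounded_almost_orbit_eq_0:
  assumes d: "\<And>k. d k \<in> E k" and bnd: "\<And>k. norm (d k) \<le> D"
    and err: "\<And>k. norm (d (k + 1) - L k (d k)) \<le> \<eta> * norm (d k)"
  shows "d k = 0"
proof -
  have half: "norm (d k) \<le> D / 2" if bnd: "\<And>k. norm (d k) \<le> D" for D k
  proof -
    have D0: "0 \<le> D" using bnd[of 0] norm_ge_zero order_trans by blast
    define e where "e k = d (k + 1) - L k (d k)" for k
    have eE: "e k \<in> E (k + 1)" for k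
      unfolding e_def using d L_E subspace_diff[OF subspace_E] by blast
    have e: "norm (e k) \<le> \<eta> * D" for k
      unfolding e_def using err[of k] mult_left_mono[OF bnd[of k] \<eta>] by linarith
    have Pe: "norm (P (k+1) (e k)) \<le> c * \<eta> * D" "norm (e k - P (k+1) (e k)) \<le> c * \<eta> * D" for k
      using P_norm[OF eE[of k]] mult_left_mono[OF e[of k] c] by (auto simp: mult.assoc)
    have cD: "norm (P k (d k)) \<le> c * D" "norm (d k - P k (d k)) \<le> c * D" for k
      using P_norm[OF d[of k]] mult_left_mono[OF bnd[of k] c] by (auto simp: mult.assoc)
    have s: "norm (P (k+1) (d (k+1))) \<le> D / 4" for k
    proof -
      have "P (k+1) (e k) = P (k+1) (d (k+1)) - L k (P k (d k))"
        unfolding e_def using P_diff[OF d L_E[OF d]] P_L[OF d] by simp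
      then have "norm (P (k+1) (d (k+1))) \<le> norm (L k (P k (d k))) + norm (P (k+1) (e k))"
        by (metis add.commute norm_triangle_sub)
      also have "norm (L k (P k (d k))) \<le> \<theta> * (c * D)"
        using L_contr[OF P(1)[OF d]] mult_left_mono[OF cD(1) \<theta>(1)] by (rule order_trans)
      also have "\<theta> * (c * D) = (c * \<theta>) * D" by simp
      also have "\<dots> \<le> 1 / 8 * D" using c\<theta> D0 by (rule mult_right_mono)
      also have "norm (P (k+1) (e k)) \<le> 1 / 8 * D"
        using Pe(1) mult_right_mono[OF c\<eta> D0] by (rule order_trans)
      finally show ?thesis by simp
    qed
    have u: "norm (d k - P k (d k)) \<le> D / 4" for k
    proof -
      \<comment> \<open>The unstable part at k is recovered from index k + 1 by \<open>L'\<close>.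
        Subtracting the unstable part of the error turns \<open>?y\<close> into an exact image under
        \<open>L k\<close>.\<close>
      let ?y = "d (k+1) - P (k+1) (d (k+1)) - (e k - P (k+1) (e k))"
      have "?y = L k (d k - P k (d k))"
        unfolding e_def using P_diff[OF d L_E[OF d]] P_L[OF d] by (simp add: linear_diff[OF L])
      then have "L' k ?y = d k - P k (d k)" using L'_L[OF P(2)[OF d]] by metis
      moreover have "?y \<in> Eu (k + 1)"
        by (intro subspace_diff[OF Eu] P d eE)
      ultimately have "norm (d k - P k (d k)) \<le> \<theta> * norm ?y" using L'_contr by metis
      also have "norm ?y \<le> c * D + c * \<eta> * D"
        using norm_triangle_ineq4 cD(2)[of "k+1"] Pe(2)[of k] by (smt (verit))
      also have "\<theta> * (c * D + c * \<eta> * D) = (c * \<theta> + \<theta> * (c * \<eta>)) * D" by (simp add: algebra_simps)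
      also have "\<dots> \<le> 1 / 4 * D" using c\<theta> \<theta>c\<eta> D0 by (intro mult_right_mono) auto
      finally show ?thesis using \<theta> by (simp add: mult_left_mono)
    qed
    have "d k = P k (d k) + (d k - P k (d k))" by simp
    then have "norm (d k) \<le> norm (P k (d k)) + norm (d k - P k (d k))" by (metis norm_triangle_ineq)
    then show ?thesis using s[of "k - 1"] u[of k] by simp
  qed
  have "norm (d k) \<le> D / 2 ^ n" for n k
  proof (induction n arbitrary: k)
    case (Suc n)
    show ?case using half[OF Suc] by (simp add: mult.commute)
  qed (use bnd in simp)
  moreover have "(\<lambda>n. D / 2 ^ n) \<longlonglongrightarrow> 0"
    using tendsto_mult_right_zero[OF LIMSEQ_power_zero[of "1/2::real"], of D] by (simp add: power_divide)
  ultimately have "norm (d k) \<le> 0"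
    by (meson LIMSEQ_le_const)
  then show ?thesis by simp
qed

text \<open>Lyapunov-Perron method: the recursion is rewritten as a fixed point equation in which
  each component is transported in the direction that contracts it.\<close>

lemma bounded_orbit_exists:
  assumes g: "\<And>k x. x \<in> E k \<Longrightarrow> g k x \<in> E (k + 1)"
    and g_lip: "\<And>k x y. x \<in> E k \<Longrightarrow> y \<in> E k \<Longrightarrow> norm (g k x - g k y) \<le> \<eta> * norm (x - y)"
    and g0: "\<And>k. norm (g k 0) \<le> \<beta>"
  obtains x where "\<And>k. x k \<in> E k" "\<And>k. x (k + 1) = L k (x k) + g k (x k)"
    "\<And>k. norm (x k) \<le> 4 * c * \<beta>"
proof -
  have \<beta>: "0 \<le> \<beta>" using g0[of 0] norm_ge_zero order_trans by blast
  \<comment> \<open>\<open>st\<close> pushes the stable component forward from k - 1.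
    \<open>un\<close> solves the recursion at k for the unstable component and pulls it back from k
    + 1.\<close>
  define st where "st x k = L (k - 1) (P (k - 1) (x (k - 1))) + P k (g (k - 1) (x (k - 1)))" for x k
  define y where "y x k = x (k + 1) - g k (x k)" for x :: "int \<Rightarrow> 'a" and k
  define un where "un x k = L' k (y x k - P (k + 1) (y x k))" for x k
  have st: "st x k \<in> Es k" and yE: "y x k \<in> E (k + 1)" and un: "un x k \<in> Eu k"
    if x: "\<And>k. x k \<in> E k" for x k
  proof -
    have "g (k - 1) (x (k - 1)) \<in> E k" using g[OF x[of "k - 1"]] by simp
    moreover have "L (k - 1) (P (k - 1) (x (k - 1))) \<in> Es k"
      using L_Es[OF P(1)[OF x[of "k - 1"]]] by simp
    ultimately show "st x k \<in> Es k" unfolding st_def using P subspace_add[OF Es] by blast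
    show "y x k \<in> E (k + 1)" unfolding y_def using g[OF x] x subspace_diff[OF subspace_E] by blast
    then show "un x k \<in> Eu k" unfolding un_def using L'_Eu P by blast
  qed
  have diff: "norm ((st x k + un x k) - (st x' k + un x' k)) \<le> D / 2"
    if x: "\<And>k. x k \<in> E k" and x': "\<And>k. x' k \<in> E k" and D: "\<And>k. norm (x k - x' k) \<le> D" for x x' D k
  proof -
    have D0: "0 \<le> D" using D[of 0] norm_ge_zero order_trans by blast
    have gd: "norm (g k (x k) - g k (x' k)) \<le> \<eta> * D" for k
      using g_lip[OF x x', of k] mult_left_mono[OF D[of k] \<eta>] by linarith
    have "L (k - 1) (P (k - 1) (x (k - 1))) - L (k - 1) (P (k - 1) (x' (k - 1))) =
        L (k - 1) (P (k - 1) (x (k - 1)) - P (k - 1) (x' (k - 1)))"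
      by (simp add: linear_diff[OF L])
    also have "norm \<dots> \<le> \<theta> * norm (P (k - 1) (x (k - 1)) - P (k - 1) (x' (k - 1)))"
      by (intro L_contr subspace_diff[OF Es] P x x')
    also have "\<dots> \<le> \<theta> * (c * D)"
    proof (rule mult_left_mono[OF _ \<theta>(1)])
      show "norm (P (k - 1) (x (k - 1)) - P (k - 1) (x' (k - 1))) \<le> c * D"
        using P_lipschitz(1)[OF x x'] mult_left_mono[OF D c] by (rule order_trans)
    qed
    also have "\<theta> * (c * D) = (c * \<theta>) * D" by simp
    also have "\<dots> \<le> 1 / 8 * D" using c\<theta> D0 by (rule mult_right_mono)
    finally have 1: "norm (L (k - 1) (P (k - 1) (x (k - 1))) - L (k - 1) (P (k - 1) (x' (k - 1)))) \<le> 1 / 8 * D" .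
    have "g (k - 1) (x (k - 1)) \<in> E k" "g (k - 1) (x' (k - 1)) \<in> E k"
      using g[OF x[of "k - 1"]] g[OF x'[of "k - 1"]] by simp_all
    then have "norm (P k (g (k - 1) (x (k - 1))) - P k (g (k - 1) (x' (k - 1)))) \<le> c * (\<eta> * D)"
      using P_lipschitz(1) mult_left_mono[OF gd c] order_trans by blast
    also have "c * (\<eta> * D) \<le> 1 / 8 * D" using mult_right_mono[OF c\<eta> D0] by (simp add: mult.assoc)
    finally have 2: "norm (P k (g (k - 1) (x (k - 1))) - P k (g (k - 1) (x' (k - 1)))) \<le> 1 / 8 * D" .
    have yd: "norm (y x k - y x' k) \<le> D + \<eta> * D"
    proof -
      have "y x k - y x' k = (x (k+1) - x' (k+1)) - (g k (x k) - g k (x' k))" by (simp add: y_def)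
      then show ?thesis using norm_triangle_ineq4 D[of "k+1"] gd[of k] by (smt (verit))
    qed
    have "un x k - un x' k = L' k ((y x k - P (k + 1) (y x k)) - (y x' k - P (k + 1) (y x' k)))"
      by (simp add: un_def linear_diff[OF L'])
    also have "norm \<dots> \<le> \<theta> * norm ((y x k - P (k + 1) (y x k)) - (y x' k - P (k + 1) (y x' k)))"
      by (intro L'_contr subspace_diff[OF Eu] P yE x x')
    also have "\<dots> \<le> \<theta> * (c * (D + \<eta> * D))"
    proof (rule mult_left_mono[OF _ \<theta>(1)])
      show "norm ((y x k - P (k + 1) (y x k)) - (y x' k - P (k + 1) (y x' k))) \<le> c * (D + \<eta> * D)"
        using P_lipschitz(2)[OF yE[OF x] yE[OF x']] mult_left_mono[OF yd c] by (rule order_trans)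
    qed
    also have "\<dots> = (c * \<theta> + \<theta> * (c * \<eta>)) * D" by (simp add: algebra_simps)
    also have "\<dots> \<le> 1 / 4 * D" using c\<theta> \<theta>c\<eta> D0 by (intro mult_right_mono) auto
    finally have 3: "norm (un x k - un x' k) \<le> 1 / 4 * D" .
    have "(st x k + un x k) - (st x' k + un x' k) =
       (L (k - 1) (P (k - 1) (x (k - 1))) - L (k - 1) (P (k - 1) (x' (k - 1)))) +
       (P k (g (k - 1) (x (k - 1))) - P k (g (k - 1) (x' (k - 1)))) + (un x k - un x' k)"
      by (simp add: st_def)
    also have "norm \<dots> \<le> 1 / 8 * D + 1 / 8 * D + 1 / 4 * D"
      using 1 2 3 by (intro norm_triangle_mono)
    finally show ?thesis by simp
  qed
  have zero: "norm (st (\<lambda>_. 0) k + un (\<lambda>_. 0) k) \<le> 2 * c * \<beta>" for k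
  proof -
    have E0: "\<And>k. 0 \<in> E k" using subspace_E subspace_0 by blast
    have gE: "g k 0 \<in> E (k + 1)" "g (k - 1) 0 \<in> E k" using g[OF E0, of k] g[OF E0, of "k - 1"] by simp_all
    have "norm (st (\<lambda>_. 0) k) \<le> c * \<beta>"
      using P_norm(1)[OF gE(2)] mult_left_mono[OF g0 c] unfolding st_def P_0 linear_0[OF L]
      by (simp add: order_trans)
    moreover have "norm (un (\<lambda>_. 0) k) \<le> c * \<beta>"
    proof -
      have y: "y (\<lambda>_. 0) k \<in> E (k + 1)" "norm (y (\<lambda>_. 0) k) \<le> \<beta>"
        using yE[of "\<lambda>_. 0"] E0 g0 by (auto simp: y_def)
      have "norm (un (\<lambda>_. 0) k) \<le> \<theta> * norm (y (\<lambda>_. 0) k - P (k + 1) (y (\<lambda>_. 0) k))"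
        unfolding un_def using L'_contr P(2) y(1) by blast
      also have "\<dots> \<le> 1 * (c * \<beta>)"
        using P_norm(2)[OF y(1)] mult_left_mono[OF y(2) c] \<theta> by (intro mult_mono) auto
      finally show ?thesis by simp
    qed
    ultimately show ?thesis
      using norm_triangle_ineq[of "st (\<lambda>_. 0) k" "un (\<lambda>_. 0) k"] by linarith
  qed
  obtain f where f: "\<And>k. f k \<in> E k" and fixed: "(\<lambda>k. st f k + un f k) = f"
    and fb: "\<And>k. norm (f k) \<le> 2 * (2 * c * \<beta>)"
  proof (rule contraction_fixed_family[of E "\<lambda>x k. st x k + un x k"])
    show "st x k + un x k \<in> E k" if "\<And>k. x k \<in> E k" for x k
      using st[OF that] un[OF that] by (auto simp: E_def)
    show "norm (st x k + un x k - (st y k + un y k)) \<le> D / 2"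
      if "\<And>k. x k \<in> E k" "\<And>k. y k \<in> E k" "\<And>k. norm (x k - y k) \<le> D" for x y D k
      using that by (rule diff)
    show "norm (st (\<lambda>_. 0) k + un (\<lambda>_. 0) k) \<le> 2 * c * \<beta>" for k by (rule zero)
  qed (use subspace_0[OF subspace_E] closed_subspace[OF subspace_E] that in auto)
  have fk: "f k = st f k + un f k" for k using fixed by metis
  \<comment> \<open>Because the splitting is unique, the two summands of the fixed point equation
    are the components of \<open>f k\<close>; the recursion is then read off component by
    component.\<close>
  have "P k (f k) = st f k" for k
    using P_sum[OF st[OF f, of k] un[OF f, of k]] fk[of k] by metis
  then have Pf: "P k (f k) = st f k" "f k - P k (f k) = un f k" for k
    using fk[of k] by (metis, metis add_diff_cancel_left')
  show thesis
  proof (rule that[of f])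
    fix k
    have "st f (k + 1) = L k (P k (f k)) + P (k + 1) (g k (f k))" by (simp add: st_def)
    then have 1: "P (k + 1) (f (k + 1)) = L k (P k (f k)) + P (k + 1) (g k (f k))"
      using Pf by simp
    have "L k (f k - P k (f k)) = y f k - P (k + 1) (y f k)"
      unfolding Pf(2) un_def using L_L'[OF P(2)[OF yE]] f by blast
    also have "P (k + 1) (y f k) = P (k + 1) (f (k + 1)) - P (k + 1) (g k (f k))"
      unfolding y_def using P_diff g f by blast
    finally have "L k (f k - P k (f k)) = f (k+1) - P (k + 1) (f (k + 1)) - (g k (f k) - P (k + 1) (g k (f k)))"
      by (simp add: y_def)
    then show "f (k + 1) = L k (f k) + g k (f k)"
      using 1 by (simp add: linear_diff[OF L])
  qed (use f fb in \<open>auto simp: mult.assoc\<close>)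
qed

end

subsection \<open>Differential equations in the transversals along orbits\<close>

lemma has_vector_derivative_shift:
  assumes "\<And>s. (x has_vector_derivative f s) (at s)"
  shows "((\<lambda>s. x (s + t)) has_vector_derivative f (s + t)) (at s)"
proof -
  have "((\<lambda>s. s + t) has_vector_derivative 1) (at s)"
    by (auto intro!: derivative_eq_intros simp: has_real_derivative_iff_has_vector_derivative[symmetric])
  then show ?thesis
    using vector_diff_chain_at[of "\<lambda>s. s + t" 1 s x "f (s + t)"] assms by (simp add: o_def)
qed

lemma has_vector_derivative_imp_continuous_on:
  "(\<And>s. (x has_vector_derivative f s) (at s)) \<Longrightarrow> continuous_on A x"
  by (meson continuous_at_imp_continuous_on has_vector_derivative_continuous)

text \<open>For \<open>a = 0\<close> this is the identity, since division by zero yields zero; so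
  \<open>linear_orth\<close> and \<open>norm_orth\<close> hold without a side condition.\<close>

definition orth :: "'a::real_inner \<Rightarrow> 'a \<Rightarrow> 'a" where
  "orth a x = x - ((a \<bullet> x) / (a \<bullet> a)) *\<^sub>R a"

lemma inner_orth: "a \<noteq> 0 \<Longrightarrow> a \<bullet> orth a x = 0"
  by (simp add: orth_def inner_diff_right)

lemma linear_orth: "linear (orth a)"
  by (rule linearI) (auto simp: orth_def inner_add_right add_divide_distrib algebra_simps)

lemma orth_self: "orth a a = 0"
  by (simp add: orth_def)

lemma norm_orth: "norm (orth a x) \<le> norm x"
proof (cases "a = 0")
  case False
  have "norm x ^ 2 = norm (orth a x) ^ 2 + norm (((a \<bullet> x) / (a \<bullet> a)) *\<^sub>R a) ^ 2"
    using norm_add_Pythagorean[of "orth a x" "((a \<bullet> x) / (a \<bullet> a)) *\<^sub>R a"] inner_orth[OF False, of x]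
    by (simp add: orthogonal_def inner_commute) (simp add: orth_def)
  then have "norm (orth a x) ^ 2 \<le> norm x ^ 2" by simp
  then show ?thesis by (rule power2_le_imp_le) simp
qed (simp add: orth_def)

text \<open>Explicit constants for (U1) to (U3). They take over the role that compactness of
  \<Lambda> would play.\<close>

locale uniform_flow =
  fixes S :: "'a::euclidean_space \<Rightarrow> 'a" and \<phi> :: "real \<Rightarrow> 'a \<Rightarrow> 'a" and \<Lambda> :: "'a set"
    and K m M :: real
  assumes S: "C1_field S" and flow: "is_flow_of S \<phi>"
    and \<Lambda>_closed: "closed \<Lambda>" and \<Lambda>_inv: "\<phi> t ` \<Lambda> = \<Lambda>"
    and K: "0 < K" "w \<in> \<Lambda> \<Longrightarrow> norm (vf_deriv S w) \<le> K"
    and m: "0 < m" "w \<in> \<Lambda> \<Longrightarrow> m \<le> norm (S w)"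
    and M: "0 < M" "w \<in> \<Lambda> \<Longrightarrow> norm (S w) \<le> M"
    and unif: "\<epsilon> > 0 \<Longrightarrow> \<exists>\<delta>>0. \<forall>w0\<in>\<Lambda>. \<forall>w. norm (w - w0) < \<delta> \<longrightarrow>
               norm (vf_deriv S w - vf_deriv S w0) < \<epsilon>"
begin

lemma S_nz: "w \<in> \<Lambda> \<Longrightarrow> S w \<noteq> 0" "w \<in> \<Lambda> \<Longrightarrow> S w \<bullet> S w > 0"
  using m(1) m(2)[of w] by auto

lemma \<phi>_0 [simp]: "\<phi> 0 w = w" and \<phi>_der: "((\<lambda>s. \<phi> s w) has_vector_derivative S (\<phi> t w)) (at t)"
  using flow unfolding is_flow_of_def by blast+

lemma \<phi>_in [simp]: "w \<in> \<Lambda> \<Longrightarrow> \<phi> t w \<in> \<Lambda>"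
  using \<Lambda>_inv by blast

lemma \<phi>_der': "((\<lambda>s. \<phi> s w) has_vector_derivative S (\<phi> t w)) (at t within A)"
  using \<phi>_der by (rule has_vector_derivative_at_within)

lemma local_flow_\<phi>: "local_flow S t w (\<phi> t w)"
  by (rule local_flowI[of t "\<lambda>s. \<phi> s w"]) (auto intro: \<phi>_der')

lemma \<phi>_add: "\<phi> (s + t) w = \<phi> s (\<phi> t w)"
proof (rule C1_ode_unique[OF S, of s "\<lambda>s. \<phi> (s + t) w" "\<lambda>s. \<phi> s (\<phi> t w)"])
  show "((\<lambda>s. \<phi> (s + t) w) has_vector_derivative S (\<phi> (r + t) w)) (at r within closed_segment 0 s)" for r
    by (rule has_vector_derivative_at_within[OF has_vector_derivative_shift[OF \<phi>_der]])
qed (auto intro: \<phi>_der')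

lemma \<phi>_continuous_time: "continuous_on A (\<lambda>s. \<phi> s w)"
  using \<phi>_der by (rule has_vector_derivative_imp_continuous_on)

text \<open>(U3) with \<epsilon> = 1 extends the bound K on \<Lambda> to K + 1 on balls of one
  common radius.\<close>

lemma local_lipschitz:
  "\<exists>\<delta>>0. \<forall>w\<in>\<Lambda>. \<forall>w'. norm (w' - w) < \<delta> \<longrightarrow> norm (S w' - S w) \<le> (K + 1) * norm (w' - w)"
proof -
  obtain \<delta> where \<delta>: "\<delta> > 0" and d: "\<And>w0 w. w0 \<in> \<Lambda> \<Longrightarrow> norm (w - w0) < \<delta> \<Longrightarrow>
      norm (vf_deriv S w - vf_deriv S w0) < 1"
    using unif[of 1] by auto
  show ?thesis
  proof (intro exI[of _ \<delta>] conjI ballI allI impI \<delta>)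
    fix w w' assume w: "w \<in> \<Lambda>" "norm (w' - w) < \<delta>"
    show "norm (S w' - S w) \<le> (K + 1) * norm (w' - w)"
    proof (rule differentiable_bound[OF convex_ball[of w \<delta>]])
      show "(S has_derivative blinfun_apply (vf_deriv S x)) (at x within ball w \<delta>)" for x
        using C1_field_has_derivative[OF S] has_derivative_at_withinI by blast
      show "onorm (blinfun_apply (vf_deriv S x)) \<le> K + 1" if "x \<in> ball w \<delta>" for x
      proof -
        have "norm (vf_deriv S x) \<le> norm (vf_deriv S w) + norm (vf_deriv S x - vf_deriv S w)"
          by (rule norm_triangle_sub)
        also have "\<dots> \<le> K + 1"
          using d[OF w(1), of x] K(2)[OF w(1)] that by (auto simp: dist_norm norm_minus_commute)
        finally show ?thesis by (simp flip: norm_blinfun.rep_eq)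
      qed
    qed (use w \<delta> in \<open>auto simp: dist_norm norm_minus_commute\<close>)
  qed
qed

text \<open>Around the orbit of a point of \<Lambda> there is a tube where S is compared with its
  values on the orbit by one Lipschitz constant. A sufficiently close orbit stays in this tube up to
  time t by \<open>gronwall_local\<close>.\<close>

lemma \<phi>_continuous: "continuous_on (UNIV \<times> \<Lambda>) (\<lambda>(t, w). \<phi> t w)"
proof -
  obtain \<delta> where \<delta>: "0 < \<delta>"
    "\<And>w w'. w \<in> \<Lambda> \<Longrightarrow> norm (w' - w) < \<delta> \<Longrightarrow> norm (S w' - S w) \<le> (K + 1) * norm (w' - w)"
    using local_lipschitz by auto
  have est: "norm (\<phi> t w' - \<phi> t w) \<le> 2 * norm (w' - w) * exp (2 * (K + 1) * \<bar>t\<bar>)"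
    if "w \<in> \<Lambda>" "2 * norm (w' - w) * exp (2 * (K + 1) * \<bar>t\<bar>) < \<delta>" for w w' t
    using gronwall_local[of "K + 1" "\<lambda>s. \<phi> s w' - \<phi> s w", OF _ has_vector_derivative_diff[OF \<phi>_der \<phi>_der], of \<delta> t]
      that K(1) \<delta>(2) by auto
  show ?thesis
    unfolding continuous_on_sequentially
  proof clarsimp
    fix t0 w0 and x :: "nat \<Rightarrow> real \<times> 'a"
    assume w0: "w0 \<in> \<Lambda>" and x: "\<forall>n. x n \<in> UNIV \<times> \<Lambda>" and lim: "x \<longlonglongrightarrow> (t0, w0)"
    define t where "t n = fst (x n)" for n
    define w where "w n = snd (x n)" for n
    have t: "t \<longlonglongrightarrow> t0" and w: "w \<longlonglongrightarrow> w0"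
      using tendsto_fst[OF lim] tendsto_snd[OF lim] by (simp_all add: t_def[abs_def] w_def[abs_def])
    define b where "b n = 2 * norm (w n - w0) * exp (2 * (K + 1) * \<bar>t n\<bar>)" for n
    have "b \<longlonglongrightarrow> 2 * norm (w0 - w0) * exp (2 * (K + 1) * \<bar>t0\<bar>)"
      unfolding b_def by (intro tendsto_intros t w)
    then have b0: "b \<longlonglongrightarrow> 0" by simp
    then have "\<forall>\<^sub>F n in sequentially. b n < \<delta>" using \<delta>(1) by (rule order_tendstoD)
    then have "\<forall>\<^sub>F n in sequentially. norm (\<phi> (t n) (w n) - \<phi> (t n) w0) \<le> norm (b n) * 1"
    proof eventually_elim
      case (elim n)
      then show ?case using est[OF w0, of "w n" "t n"] by (simp add: b_def)
    qed
    then have "(\<lambda>n. \<phi> (t n) (w n) - \<phi> (t n) w0) \<longlonglongrightarrow> 0"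
      by (rule tendsto_0_le[OF b0])
    moreover have "(\<lambda>n. \<phi> (t n) w0) \<longlonglongrightarrow> \<phi> t0 w0"
      using continuous_on_tendsto_compose[OF \<phi>_continuous_time[of UNIV w0] t] by simp
    ultimately have "(\<lambda>n. \<phi> (t n) (w n)) \<longlonglongrightarrow> \<phi> t0 w0"
      using tendsto_add by fastforce
    then show "((\<lambda>(t, w). \<phi> t w) \<circ> x) \<longlonglongrightarrow> \<phi> t0 w0"
      by (simp add: o_def t_def w_def case_prod_beta)
  qed
qed

section \<open>Equations over the flow of S and their dependence on data\<close>

lemma S_\<phi>_der:
  "((\<lambda>s. S (\<phi> s w)) has_vector_derivative vf_deriv S (\<phi> t w) (S (\<phi> t w))) (at t)"
proof -
  have "((\<lambda>s. S (\<phi> s w)) has_derivative (\<lambda>h. vf_deriv S (\<phi> t w) (h *\<^sub>R S (\<phi> t w)))) (at t)"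
    using has_derivative_compose[OF \<phi>_der[unfolded has_vector_derivative_def] C1_field_has_derivative[OF S]] .
  then show ?thesis by (simp add: has_vector_derivative_def blinfun.scaleR_right)
qed

text \<open>The condition on the inner product is what keeps solutions inside the transversals.\<close>

definition tangent_field :: "real \<Rightarrow> real \<Rightarrow> ('a \<Rightarrow> 'a \<Rightarrow> 'a) \<Rightarrow> bool" where
  "tangent_field L B G \<longleftrightarrow> 0 < L \<and> 0 \<le> B \<and> continuous_on (\<Lambda> \<times> UNIV) (\<lambda>(w, x). G w x) \<and>
     (\<forall>w\<in>\<Lambda>. \<forall>x y. norm (G w x - G w y) \<le> L * norm (x - y)) \<and>
     (\<forall>w\<in>\<Lambda>. norm (G w 0) \<le> B) \<and>
     (\<forall>w\<in>\<Lambda>. \<forall>x. S w \<bullet> G w x = - (vf_deriv S w (S w) \<bullet> x))"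

definition sol :: "('a \<Rightarrow> 'a \<Rightarrow> 'a) \<Rightarrow> 'a \<Rightarrow> 'a \<Rightarrow> real \<Rightarrow> 'a" where
  "sol G w p = (SOME x. x 0 = p \<and> (\<forall>s. (x has_vector_derivative G (\<phi> s w) (x s)) (at s)))"

context
  fixes L B G assumes G: "tangent_field L B G"
begin

lemma G_continuous_on:
  assumes "continuous_on A f" "continuous_on A g" "\<And>s. s \<in> A \<Longrightarrow> f s \<in> \<Lambda>"
  shows "continuous_on A (\<lambda>s. G (f s) (g s))"
proof -
  have "continuous_on A (\<lambda>s. (\<lambda>(w, x). G w x) (f s, g s))"
    by (rule continuous_on_compose2[of "\<Lambda> \<times> UNIV"]) (use G assms in \<open>auto simp: tangent_field_def intro: continuous_on_Pair\<close>)
  then show ?thesis by simp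
qed

lemma sol:
  assumes w: "w \<in> \<Lambda>"
  shows "sol G w p 0 = p" "(sol G w p has_vector_derivative G (\<phi> s w) (sol G w p s)) (at s)"
proof -
  have "continuous_on UNIV (\<lambda>(s, x). G (\<phi> s w) x)"
    unfolding case_prod_beta
    by (intro G_continuous_on continuous_on_compose2[OF \<phi>_continuous_time[of UNIV]] continuous_intros)
       (use w in auto)
  then obtain x where "x 0 = p" "\<And>s. (x has_vector_derivative G (\<phi> s w) (x s)) (at s)"
    using picard_lindeloef_global[of L B "\<lambda>s. G (\<phi> s w)" p] G w
    unfolding tangent_field_def by (metis \<phi>_in)
  then have "\<exists>x. x 0 = p \<and> (\<forall>s. (x has_vector_derivative G (\<phi> s w) (x s)) (at s))" by blast
  then have "sol G w p 0 = p \<and> (\<forall>s. (sol G w p has_vector_derivative G (\<phi> s w) (sol G w p s)) (at s))"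
    unfolding sol_def by (rule someI_ex)
  then show "sol G w p 0 = p" "(sol G w p has_vector_derivative G (\<phi> s w) (sol G w p s)) (at s)"
    by auto
qed

lemma sol_unique:
  assumes w: "w \<in> \<Lambda>" and x: "\<And>s. (x has_vector_derivative G (\<phi> s w) (x s)) (at s)"
  shows "x t = sol G w (x 0) t"
  using gronwall_UNIV[of L 0 "\<lambda>s. x s - sol G w (x 0) s", OF _ _ has_vector_derivative_diff[OF x sol(2)[OF w]], of t]
    G w sol(1)[OF w]
  by (auto simp: tangent_field_def)

lemma sol_bound:
  assumes w: "w \<in> \<Lambda>"
  shows "norm (sol G w p t) \<le> 2 * (norm p + B * \<bar>t\<bar>) * exp (2 * L * \<bar>t\<bar>)"
proof -
  have "norm (G (\<phi> s w) x) \<le> L * norm x + B" for s x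
  proof -
    have "norm (G (\<phi> s w) x) \<le> norm (G (\<phi> s w) 0) + norm (G (\<phi> s w) x - G (\<phi> s w) 0)"
      by (rule norm_triangle_sub)
    also have "\<dots> \<le> B + L * norm (x - 0)"
      using G \<phi>_in[OF w, of s] unfolding tangent_field_def by (intro add_mono) blast+
    finally show ?thesis by simp
  qed
  then show ?thesis
    using gronwall_UNIV[of L B "sol G w p" "\<lambda>s. G (\<phi> s w) (sol G w p s)" t] G sol[OF w]
    by (auto simp: tangent_field_def)
qed

lemma sol_add:
  assumes w: "w \<in> \<Lambda>"
  shows "sol G w p (s + t) = sol G (\<phi> t w) (sol G w p t) s"
  using sol_unique[of "\<phi> t w" "\<lambda>s. sol G w p (s + t)" s]
    has_vector_derivative_shift[OF sol(2)[OF w], of p t] w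
  by (simp add: \<phi>_add)

lemma sol_transversal:
  assumes w: "w \<in> \<Lambda>" and p: "p \<in> transversal S w"
  shows "sol G w p t \<in> transversal S (\<phi> t w)"
proof -
  define f where "f s = S (\<phi> s w) \<bullet> sol G w p s" for s
  have "(f has_vector_derivative 0) (at s)" for s
    unfolding f_def
    using bounded_bilinear.has_vector_derivative[OF bounded_bilinear_inner S_\<phi>_der[of w s] sol(2)[OF w, of p s]] G w
    by (simp add: tangent_field_def)
  then have "f t = f 0"
    using has_vector_derivative_zero_constant[of UNIV f] by (metis UNIV_I convex_UNIV)
  then show ?thesis using p sol(1)[OF w] by (simp add: f_def transversal_def)
qed

text \<open>G is merely continuous in the base point. Compactness of the time segment makes the
  change of G along the limit solution uniformly small, and Gronwall turns this into closeness of
  the solutions.\<close>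

lemma sol_tendsto:
  assumes w: "w \<in> \<Lambda>" "\<And>n. v n \<in> \<Lambda>" "v \<longlonglongrightarrow> w" and q: "q \<longlonglongrightarrow> p"
  shows "(\<lambda>n::nat. sol G (v n) (q n) t) \<longlonglongrightarrow> sol G w p t"
proof (rule tendstoI)
  fix e :: real assume e: "0 < e"
  \<comment> \<open>Solved backwards from the Gronwall bound 2 (e1 + e1 |t|) exp(2L|t|); the 4 in
    place of 2 leaves room for a strict inequality.\<close>
  define e1 where "e1 = e / (4 * (1 + \<bar>t\<bar>) * exp (2 * L * \<bar>t\<bar>))"
  have e1: "0 < e1" using e by (simp add: e1_def)
  have "continuous_on (\<Lambda> \<times> closed_segment 0 t) (\<lambda>(v, s). G (\<phi> s v) (sol G w p s))"
    unfolding case_prod_beta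
  proof (intro G_continuous_on)
    show "continuous_on (\<Lambda> \<times> closed_segment 0 t) (\<lambda>z. \<phi> (snd z) (fst z))"
    proof -
      have "continuous_on (\<Lambda> \<times> closed_segment 0 t) (\<lambda>z. (\<lambda>(t, w). \<phi> t w) (snd z, fst z))"
        by (rule continuous_on_compose2[OF \<phi>_continuous]) (auto intro!: continuous_intros)
      then show ?thesis by simp
    qed
    show "continuous_on (\<Lambda> \<times> closed_segment 0 t) (\<lambda>z. sol G w p (snd z))"
      by (rule continuous_on_compose2[OF has_vector_derivative_imp_continuous_on[OF sol(2)[OF w(1)], of UNIV]])
         (auto intro!: continuous_intros)
  qed auto
  then obtain X where X: "w \<in> X" "open X" "\<forall>v\<in>X \<inter> \<Lambda>. \<forall>s\<in>closed_segment 0 t.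
      dist ((\<lambda>(v, s). G (\<phi> s v) (sol G w p s)) (v, s)) ((\<lambda>(v, s). G (\<phi> s v) (sol G w p s)) (w, s)) \<le> e1"
    using w(1) e1 by (rule continuous_on_prod_compactE[OF _ compact_segment])
  have "\<forall>\<^sub>F n in sequentially. v n \<in> X" by (rule topological_tendstoD[OF w(3) X(2,1)])
  moreover have "\<forall>\<^sub>F n in sequentially. dist (q n) p < e1" using q e1 by (rule tendstoD)
  ultimately show "\<forall>\<^sub>F n in sequentially. dist (sol G (v n) (q n) t) (sol G w p t) < e"
  proof eventually_elim
    case (elim n)
    let ?x = "sol G (v n) (q n)" and ?y = "sol G w p"
    have "norm (?x t - ?y t) \<le> 2 * (norm (?x 0 - ?y 0) + e1 * \<bar>t\<bar>) * exp (2 * L * \<bar>t\<bar>)"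
    proof (rule gronwall_UNIV[where d' = "\<lambda>s. G (\<phi> s (v n)) (?x s) - G (\<phi> s w) (?y s)"])
      fix s assume s: "s \<in> closed_segment 0 t"
      have "norm (G (\<phi> s (v n)) (?x s) - G (\<phi> s w) (?y s)) \<le>
          norm (G (\<phi> s (v n)) (?x s) - G (\<phi> s (v n)) (?y s)) + norm (G (\<phi> s (v n)) (?y s) - G (\<phi> s w) (?y s))"
        using norm_triangle_ineq[of "G (\<phi> s (v n)) (?x s) - G (\<phi> s (v n)) (?y s)"
            "G (\<phi> s (v n)) (?y s) - G (\<phi> s w) (?y s)"] by simp
      also have "\<dots> \<le> L * norm (?x s - ?y s) + e1"
      proof (rule add_mono)
        show "norm (G (\<phi> s (v n)) (?y s) - G (\<phi> s w) (?y s)) \<le> e1"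
          using X(3) elim(1) w(2)[of n] s by (auto simp: dist_norm)
      qed (use G w in \<open>auto simp: tangent_field_def\<close>)
      finally show "norm (G (\<phi> s (v n)) (?x s) - G (\<phi> s w) (?y s)) \<le> L * norm (?x s - ?y s) + e1" .
    next
      show "((\<lambda>s. ?x s - ?y s) has_vector_derivative G (\<phi> s (v n)) (?x s) - G (\<phi> s w) (?y s)) (at s)" for s
        using sol(2) w by (intro has_vector_derivative_diff) auto
    qed (use G e1 in \<open>auto simp: tangent_field_def\<close>)
    also have "\<dots> < 4 * (1 + \<bar>t\<bar>) * e1 * exp (2 * L * \<bar>t\<bar>)"
    proof -
      have "norm (?x 0 - ?y 0) < e1" using elim(2) sol(1) w by (simp add: dist_norm)
      moreover have "0 \<le> e1 * \<bar>t\<bar>" using e1 by simp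
      ultimately have "2 * (norm (?x 0 - ?y 0) + e1 * \<bar>t\<bar>) < 4 * (e1 + e1 * \<bar>t\<bar>)"
        using e1 unfolding distrib_left by linarith
      then have "2 * (norm (?x 0 - ?y 0) + e1 * \<bar>t\<bar>) < 4 * (1 + \<bar>t\<bar>) * e1"
        by (simp add: algebra_simps)
      then show ?thesis by simp
    qed
    also have "\<dots> = e" by (simp add: e1_def)
    finally show ?case by (simp add: dist_norm)
  qed
qed

end

end

subsection \<open>The vector field of the cross-section flow\<close>

lemma abs_inner_div_le:
  fixes a y :: "'a::real_inner"
  assumes m: "0 < m" "m \<le> norm a" and C: "0 \<le> C" "norm y \<le> C"
  shows "\<bar>(a \<bullet> y) / (a \<bullet> a)\<bar> \<le> C / m"
proof -
  have a: "0 < norm a" using m by linarith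
  have "\<bar>(a \<bullet> y) / (a \<bullet> a)\<bar> = \<bar>a \<bullet> y\<bar> / (norm a * norm a)"
    by (simp add: abs_mult power2_norm_eq_inner[symmetric] power2_eq_square)
  also have "\<dots> \<le> (norm a * C) / (norm a * norm a)"
    using Cauchy_Schwarz_ineq2[of a y] mult_left_mono[OF C(2), of "norm a"] by (intro divide_right_mono) auto
  also have "\<dots> = C / norm a" using a by simp
  also have "\<dots> \<le> C / m" using m C a by (intro divide_left_mono) auto
  finally show ?thesis .
qed

text \<open>Meant for b = \<open>accel w\<close>, whose norm is at most K times that of a =
  \<open>S w\<close>: one factor cancels, and only the lower bound m enters.\<close>

lemma abs_inner_div_le':
  fixes a b y :: "'a::real_inner"
  assumes m: "0 < m" "m \<le> norm a" and b: "0 \<le> K" "norm b \<le> K * norm a" and C: "0 \<le> C" "norm y \<le> C"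
  shows "\<bar>(b \<bullet> y) / (a \<bullet> a)\<bar> \<le> K * C / m"
proof -
  have a: "0 < norm a" using m by linarith
  have "\<bar>(b \<bullet> y) / (a \<bullet> a)\<bar> = \<bar>b \<bullet> y\<bar> / (norm a * norm a)"
    by (simp add: abs_mult power2_norm_eq_inner[symmetric] power2_eq_square)
  also have "\<dots> \<le> ((K * norm a) * C) / (norm a * norm a)"
    using Cauchy_Schwarz_ineq2[of b y] mult_mono[OF b(2) C(2)] b by (intro divide_right_mono) auto
  also have "\<dots> = K * C / norm a" using a by simp
  also have "\<dots> \<le> K * C / m" using m C b a by (intro divide_left_mono) auto
  finally show ?thesis .
qed

definition near :: "('a::euclidean_space \<Rightarrow> 'a) \<Rightarrow> real \<Rightarrow> ('a \<Rightarrow> 'a) \<Rightarrow> bool" where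
  "near S \<rho> V \<longleftrightarrow> C1_field V \<and> (\<forall>w. norm (V w - S w) \<le> \<rho> \<and> norm (vf_deriv V w - vf_deriv S w) \<le> \<rho>)"

lemma near_self: "C1_field S \<Longrightarrow> 0 \<le> \<rho> \<Longrightarrow> near S \<rho> S"
  by (simp add: near_def)

lemma near_mono: "near S \<rho> V \<Longrightarrow> \<rho> \<le> \<rho>' \<Longrightarrow> near S \<rho>' V"
  unfolding near_def by (meson order_trans)

context uniform_flow
begin

abbreviation accel :: "'a \<Rightarrow> 'a" where "accel w \<equiv> vf_deriv S w (S w)"

text \<open>The derivative at x = 0 of \<open>speed S w x *\<^sub>R S (w + x) - S w\<close>. Its
  tangential second term compensates the turning of S along the orbit, so that the inner product of
  S and x is conserved.\<close>

definition lin :: "'a \<Rightarrow> 'a \<Rightarrow> 'a" where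
  "lin w x = orth (S w) (vf_deriv S w x) - ((accel w \<bullet> x) / (S w \<bullet> S w)) *\<^sub>R S w"

text \<open>The factor by which the time of \<open>V\<close> has to be rescaled so that its trajectory stays in the
  moving cross-section.\<close>

definition speed :: "('a \<Rightarrow> 'a) \<Rightarrow> 'a \<Rightarrow> 'a \<Rightarrow> real" where
  "speed V w x = (S w \<bullet> S w - accel w \<bullet> x) / (S w \<bullet> V (w + x))"

text \<open>\<open>lin\<close> already contains the whole tangential part of
  \<open>speed V w x *\<^sub>R V (w + x) - S w\<close>, so \<open>rem\<close> is orthogonal to
  \<open>S w\<close> for every x. This is why its argument can be truncated in \<open>fld\<close>
  without violating the inner product condition of \<open>tangent_field\<close>.\<close>

definition rem :: "('a \<Rightarrow> 'a) \<Rightarrow> 'a \<Rightarrow> 'a \<Rightarrow> 'a" where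
  "rem V w x = speed V w x *\<^sub>R orth (S w) (V (w + x)) - orth (S w) (vf_deriv S w x)"

lemma lin_rem:
  assumes w: "w \<in> \<Lambda>" and V: "S w \<bullet> V (w + x) \<noteq> 0"
  shows "lin w x + rem V w x = speed V w x *\<^sub>R V (w + x) - S w"
proof -
  have "speed V w x * ((S w \<bullet> V (w + x)) / (S w \<bullet> S w)) = 1 - (accel w \<bullet> x) / (S w \<bullet> S w)"
    using V S_nz[OF w] by (simp add: speed_def field_simps)
  then have "speed V w x *\<^sub>R orth (S w) (V (w + x)) =
      speed V w x *\<^sub>R V (w + x) - (1 - (accel w \<bullet> x) / (S w \<bullet> S w)) *\<^sub>R S w"
    by (simp add: orth_def scaleR_diff_right)
  then show ?thesis by (simp add: lin_def rem_def scaleR_diff_left)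
qed

lemma inner_lin: "w \<in> \<Lambda> \<Longrightarrow> S w \<bullet> lin w x = - (accel w \<bullet> x)"
  using S_nz[of w] by (simp add: lin_def inner_diff_right inner_orth)

lemma inner_rem: "w \<in> \<Lambda> \<Longrightarrow> S w \<bullet> rem V w x = 0"
  using S_nz[of w] by (simp add: rem_def inner_diff_right inner_orth)

lemma linear_lin: "linear (lin w)"
proof -
  have "linear (\<lambda>x. orth (S w) (vf_deriv S w x))"
    using linear_compose[OF bounded_linear.linear[OF blinfun.bounded_linear_right] linear_orth] by (simp add: o_def)
  moreover have "linear (\<lambda>x. ((accel w \<bullet> x) / (S w \<bullet> S w)) *\<^sub>R S w)"
    by (rule linearI) (auto simp: inner_add_right add_divide_distrib scaleR_add_left)
  ultimately show ?thesis unfolding lin_def[abs_def] by (rule linear_compose_sub)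
qed

lemma norm_deriv_le: assumes "w \<in> \<Lambda>" shows "norm (vf_deriv S w x) \<le> K * norm x"
  using norm_blinfun[of "vf_deriv S w" x] mult_right_mono[OF K(2)[OF assms], of "norm x"] by simp

lemma norm_lin: assumes w: "w \<in> \<Lambda>" shows "norm (lin w x) \<le> 2 * K * norm x"
proof -
  have "\<bar>(accel w \<bullet> x) / (S w \<bullet> S w)\<bar> \<le> K * norm x / norm (S w)"
    using norm_deriv_le[OF w] K(1) S_nz[OF w] by (intro abs_inner_div_le') auto
  then have "norm (((accel w \<bullet> x) / (S w \<bullet> S w)) *\<^sub>R S w) \<le> (K * norm x / norm (S w)) * norm (S w)"
    unfolding norm_scaleR by (rule mult_right_mono) simp
  then have "norm (((accel w \<bullet> x) / (S w \<bullet> S w)) *\<^sub>R S w) \<le> K * norm x"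
    using S_nz[OF w] by simp
  moreover have "norm (orth (S w) (vf_deriv S w x)) \<le> K * norm x"
    using norm_orth norm_deriv_le[OF w] by (rule order_trans)
  ultimately show ?thesis
    unfolding lin_def using norm_triangle_le_diff[of "orth (S w) (vf_deriv S w x)"] by simp
qed

text \<open>Mean value inequality on a ball: one \<eta> comes from the C1 distance of V and S, the
  other from (U3). The same \<rho> bounds the C1 distance and the radius of the ball.\<close>

lemma near_linearization_lipschitz:
  assumes "0 < \<eta>"
  shows "\<exists>\<rho>0>0. \<forall>\<rho> V w x y. \<rho> \<le> \<rho>0 \<longrightarrow> near S \<rho> V \<longrightarrow> w \<in> \<Lambda> \<longrightarrow> x \<in> cball 0 \<rho> \<longrightarrow> y \<in> cball 0 \<rho> \<longrightarrow>
    norm ((V (w + x) - vf_deriv S w x) - (V (w + y) - vf_deriv S w y)) \<le> 2 * \<eta> * norm (x - y)"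
proof -
  obtain \<delta> where \<delta>: "\<delta> > 0" and d: "\<And>w0 w. w0 \<in> \<Lambda> \<Longrightarrow> norm (w - w0) < \<delta> \<Longrightarrow>
      norm (vf_deriv S w - vf_deriv S w0) < \<eta>"
    using unif[OF assms] by auto
  show ?thesis
  proof (intro exI[of _ "min \<eta> (\<delta> / 2)"] conjI allI impI)
    fix \<rho> V w x y
    assume \<rho>: "\<rho> \<le> min \<eta> (\<delta> / 2)" and V: "near S \<rho> V" and w: "w \<in> \<Lambda>"
      and xy: "x \<in> cball (0::'a) \<rho>" "y \<in> cball (0::'a) \<rho>"
    have V': "C1_field V" using V by (simp add: near_def)
    show "norm ((V (w + x) - vf_deriv S w x) - (V (w + y) - vf_deriv S w y)) \<le> 2 * \<eta> * norm (x - y)"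
    proof (rule differentiable_bound[OF convex_cball _ _ xy, where f' = "\<lambda>z. blinfun_apply (vf_deriv V (w + z) - vf_deriv S w)"])
      fix z assume z: "z \<in> cball (0::'a) \<rho>"
      have "((\<lambda>z. w + z) has_derivative (\<lambda>h. h)) (at z)"
        by (auto intro!: derivative_eq_intros)
      from has_derivative_compose[OF this C1_field_has_derivative[OF V']]
      have "((\<lambda>z. V (w + z) - vf_deriv S w z) has_derivative (\<lambda>h. vf_deriv V (w + z) h - vf_deriv S w h)) (at z)"
        by (intro has_derivative_diff bounded_linear_imp_has_derivative blinfun.bounded_linear_right)
      then show "((\<lambda>z. V (w + z) - vf_deriv S w z) has_derivative blinfun_apply (vf_deriv V (w + z) - vf_deriv S w)) (at z within cball 0 \<rho>)"
        by (simp add: minus_blinfun.rep_eq[abs_def] has_derivative_at_withinI)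
      have "norm (vf_deriv V (w + z) - vf_deriv S w) \<le>
          norm (vf_deriv V (w + z) - vf_deriv S (w + z)) + norm (vf_deriv S (w + z) - vf_deriv S w)"
        using norm_triangle_ineq[of "vf_deriv V (w + z) - vf_deriv S (w + z)" "vf_deriv S (w + z) - vf_deriv S w"] by simp
      also have "\<dots> \<le> \<eta> + \<eta>"
      proof (rule add_mono)
        show "norm (vf_deriv V (w + z) - vf_deriv S (w + z)) \<le> \<eta>"
          using V \<rho> unfolding near_def by (meson min.boundedE order_trans)
        show "norm (vf_deriv S (w + z) - vf_deriv S w) \<le> \<eta>"
          using d[OF w, of "w + z"] z \<rho> \<delta> by auto
      qed
      finally show "onorm (blinfun_apply (vf_deriv V (w + z) - vf_deriv S w)) \<le> 2 * \<eta>"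
        by (simp flip: norm_blinfun.rep_eq)
    qed
  qed (use assms \<delta> in auto)
qed

text \<open>The properties of V on the tube of radius \<rho> around \<Lambda> from which its
  solutions are constructed. A separate, smaller bound \<delta> for V - S on \<Lambda> is imposed
  once \<eta> and \<rho> are fixed.\<close>

definition good :: "real \<Rightarrow> real \<Rightarrow> ('a \<Rightarrow> 'a) \<Rightarrow> bool" where
  "good \<eta> \<rho> V \<longleftrightarrow> C1_field V \<and> (\<forall>w\<in>\<Lambda>. \<forall>x\<in>cball 0 \<rho>. S w \<bullet> V (w + x) > 0 \<and> \<bar>speed V w x - 1\<bar> \<le> \<eta> \<and>
     norm (V (w + x) - S w) \<le> \<eta> \<and> (\<forall>y\<in>cball 0 \<rho>. norm (rem V w x - rem V w y) \<le> \<eta> * norm (x - y)))"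

text \<open>\<open>speed\<close> and \<open>rem\<close> are built from V - S w on the tube, which is
  small, has Lipschitz constant K + 2, and differs from \<open>vf_deriv S w\<close> by a map with
  small Lipschitz constant. Each Lipschitz estimate for \<open>rem\<close> therefore carries one
  small factor.\<close>

lemma near_good:
  assumes \<eta>: "0 < \<eta>"
  shows "\<exists>\<rho>>0. (\<forall>V. near S \<rho> V \<longrightarrow> good \<eta> \<rho> V) \<and>
     (\<forall>w\<in>\<Lambda>. \<forall>x\<in>cball 0 \<rho>. norm (S (w + x) - S w - vf_deriv S w x) \<le> \<eta> * norm x)"
proof -
  \<comment> \<open>Sum of the coefficients in the final estimate for \<open>rem\<close>: 2, then 4
    (K + 2) / m, then (6 K + 8) / m.\<close>
  define c where "c = 2 + (10 * K + 16) / m"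
  have c: "2 \<le> c" "4 / m \<le> c" using K(1) m(1) by (auto simp: c_def field_simps)
  define \<eta>0 where "\<eta>0 = min 1 (min (m / 4) (\<eta> / c))"
  have \<eta>0: "0 < \<eta>0" "\<eta>0 \<le> 1" "\<eta>0 \<le> m / 4" "\<eta>0 \<le> \<eta> / c"
    using \<eta> c m(1) by (simp add: \<eta>0_def, simp_all only: \<eta>0_def min.cobounded1 min.coboundedI2)
  then have \<eta>0: "0 < \<eta>0" "\<eta>0 \<le> 1" "\<eta>0 / m \<le> 1 / 4" "c * \<eta>0 \<le> \<eta>"
    using c m(1) by (auto simp: field_simps)
  have \<eta>0': "2 * \<eta>0 \<le> \<eta>" "4 * \<eta>0 / m \<le> \<eta>"
  proof -
    have "2 * \<eta>0 \<le> c * \<eta>0" using c(1) \<eta>0(1) by (intro mult_right_mono) auto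
    then show "2 * \<eta>0 \<le> \<eta>" using \<eta>0(4) by (rule order_trans)
    have "4 / m * \<eta>0 \<le> c * \<eta>0" using c(2) \<eta>0(1) by (intro mult_right_mono) auto
    then show "4 * \<eta>0 / m \<le> \<eta>" using \<eta>0(4) by simp
  qed
  obtain \<rho>0 where \<rho>0: "0 < \<rho>0" and lip0: "\<And>\<rho> V w x y. \<rho> \<le> \<rho>0 \<Longrightarrow> near S \<rho> V \<Longrightarrow> w \<in> \<Lambda> \<Longrightarrow> x \<in> cball 0 \<rho> \<Longrightarrow> y \<in> cball 0 \<rho> \<Longrightarrow>
    norm ((V (w + x) - vf_deriv S w x) - (V (w + y) - vf_deriv S w y)) \<le> 2 * \<eta>0 * norm (x - y)"
    using near_linearization_lipschitz[OF \<eta>0(1)] by blast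
  \<comment> \<open>The bound \<rho> + (K + 2) \<rho> on \<open>norm (v x)\<close> has to be at most
    \<open>\<eta>0\<close>.\<close>
  define \<rho> where "\<rho> = min \<rho>0 (\<eta>0 / (K + 3))"
  have \<rho>: "0 < \<rho>" "\<rho> \<le> \<rho>0" "\<rho> \<le> \<eta>0 / (K + 3)"
    using \<rho>0 \<eta>0(1) K(1) by (auto simp: \<rho>_def)
  then have \<rho>: "0 < \<rho>" "\<rho> \<le> \<rho>0" "\<rho> * (K + 3) \<le> \<eta>0"
    using K(1) by (auto simp: pos_le_divide_eq)
  have \<rho>K: "K * \<rho> \<le> \<eta>0" using \<rho> K(1) by (simp add: algebra_simps)
  have est: "good \<eta> \<rho> V" if V: "near S \<rho> V" for V
    unfolding good_def
  proof (intro conjI ballI)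
    show "C1_field V" using V by (simp add: near_def)
    fix w assume w: "w \<in> \<Lambda>"
    let ?a = "S w" and ?B = "blinfun_apply (vf_deriv S w)"
    have a0: "?a \<bullet> ?a > 0" using S_nz[OF w] by simp
    define v where "v x = V (w + x) - ?a" for x
    \<comment> \<open>In these terms \<open>speed V w x\<close> is (1 - \<beta> x) / (1 + \<alpha>
      x): \<alpha> is the relative change of the velocity along S w, and \<beta> comes from the
      turning of the section.\<close>
    define \<alpha> where "\<alpha> x = (?a \<bullet> v x) / (?a \<bullet> ?a)" for x
    define \<beta> where "\<beta> x = (accel w \<bullet> x) / (?a \<bullet> ?a)" for x
    have lip: "norm ((v x - ?B x) - (v y - ?B y)) \<le> 2 * \<eta>0 * norm (x - y)"
      if "x \<in> cball 0 \<rho>" "y \<in> cball 0 \<rho>" for x y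
      using lip0[OF \<rho>(2) V w that] by (simp add: v_def algebra_simps)
    have v_lip: "norm (v x - v y) \<le> (K + 2) * norm (x - y)"
      if "x \<in> cball 0 \<rho>" "y \<in> cball 0 \<rho>" for x y
    proof -
      have "v x - v y = ((v x - ?B x) - (v y - ?B y)) + ?B (x - y)"
        by (simp add: blinfun.diff_right)
      then have "norm (v x - v y) \<le> norm ((v x - ?B x) - (v y - ?B y)) + norm (?B (x - y))"
        by (metis norm_triangle_ineq)
      also have "\<dots> \<le> 2 * 1 * norm (x - y) + K * norm (x - y)"
      proof (rule add_mono[OF order_trans[OF lip[OF that]] norm_deriv_le[OF w]])
        show "2 * \<eta>0 * norm (x - y) \<le> 2 * 1 * norm (x - y)"
          using \<eta>0(2) by (intro mult_right_mono) auto
      qed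
      finally show ?thesis by (simp add: algebra_simps)
    qed
    have v_le: "norm (v x) \<le> \<eta>0" if x: "x \<in> cball 0 \<rho>" for x
    proof -
      have "norm (v x) \<le> norm (v 0) + norm (v x - v 0)" by (rule norm_triangle_sub)
      also have "\<dots> \<le> \<rho> + (K + 2) * norm (x - 0)"
        using V v_lip[OF x, of 0] \<rho> by (intro add_mono) (auto simp: near_def v_def)
      also have "\<dots> \<le> \<rho> + (K + 2) * \<rho>"
        using x K(1) by (intro add_left_mono mult_left_mono) auto
      finally show ?thesis using \<rho>(3) by (simp add: algebra_simps)
    qed
    have \<alpha>: "\<bar>\<alpha> x\<bar> \<le> 1 / 4" "\<bar>\<alpha> x\<bar> \<le> \<eta>0 / m" if "x \<in> cball 0 \<rho>" for x
    proof -
      show "\<bar>\<alpha> x\<bar> \<le> \<eta>0 / m"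
        unfolding \<alpha>_def by (rule abs_inner_div_le[OF m(1) m(2)[OF w] _ v_le[OF that]]) (use \<eta>0 in simp)
      then show "\<bar>\<alpha> x\<bar> \<le> 1 / 4" using \<eta>0(3) by (rule order_trans)
    qed
    have \<beta>: "\<bar>\<beta> x\<bar> \<le> \<eta>0 / m" if x: "x \<in> cball 0 \<rho>" for x
    proof -
      have "\<bar>\<beta> x\<bar> \<le> K * \<rho> / m"
        unfolding \<beta>_def using x \<rho>(1) K(1) m w norm_deriv_le[OF w] by (intro abs_inner_div_le') auto
      also have "\<dots> \<le> \<eta>0 / m" using \<rho>K m(1) by (intro divide_right_mono) auto
      finally show ?thesis .
    qed
    have aV: "?a \<bullet> V (w + x) = (?a \<bullet> ?a) * (1 + \<alpha> x)" for x
      using a0 by (simp add: \<alpha>_def v_def inner_diff_right field_simps)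
    have sp: "speed V w x * (1 + \<alpha> x) = 1 - \<beta> x" if "x \<in> cball 0 \<rho>" for x
    proof -
      have "1 + \<alpha> x > 0" using \<alpha>(1)[OF that] by linarith
      then have "?a \<bullet> V (w + x) \<noteq> 0" using a0 aV[of x] by simp
      then have "speed V w x * (?a \<bullet> V (w + x)) = ?a \<bullet> ?a - accel w \<bullet> x"
        by (simp add: speed_def)
      then have "(?a \<bullet> ?a) * (speed V w x * (1 + \<alpha> x)) = (?a \<bullet> ?a) * (1 - \<beta> x)"
        using a0 by (simp add: aV \<beta>_def algebra_simps)
      then show ?thesis using a0 by (metis mult_left_cancel less_irrefl)
    qed
    have sp1: "\<bar>speed V w x - 1\<bar> \<le> 4 * \<eta>0 / m" if x: "x \<in> cball 0 \<rho>" for x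
    proof -
      have "(speed V w x - 1) * (1 + \<alpha> x) = - (\<alpha> x + \<beta> x)"
        using sp[OF x] by (simp add: algebra_simps)
      then have "\<bar>speed V w x - 1\<bar> * \<bar>1 + \<alpha> x\<bar> \<le> 2 * \<eta>0 / m"
        using \<alpha>(2)[OF x] \<beta>[OF x] by (simp flip: abs_mult)
      moreover have "\<bar>speed V w x - 1\<bar> * (1 / 2) \<le> \<bar>speed V w x - 1\<bar> * \<bar>1 + \<alpha> x\<bar>"
        using \<alpha>(1)[OF x] by (intro mult_left_mono) auto
      ultimately show ?thesis by simp
    qed
    have sp2: "\<bar>speed V w x\<bar> \<le> 2" if "x \<in> cball 0 \<rho>" for x
    proof -
      have "4 * \<eta>0 / m = 4 * (\<eta>0 / m)" by simp
      then show ?thesis using sp1[OF that] \<eta>0(3) by linarith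
    qed
    fix x assume x: "x \<in> cball (0::'a) \<rho>"
    show "?a \<bullet> V (w + x) > 0"
      unfolding aV using \<alpha>(1)[OF x] a0 by (intro mult_pos_pos) auto
    show "\<bar>speed V w x - 1\<bar> \<le> \<eta>" using sp1[OF x] \<eta>0' by linarith
    show "norm (V (w + x) - ?a) \<le> \<eta>" using v_le[OF x] \<eta>0' \<eta>0 by (simp add: v_def)
    fix y assume y: "y \<in> cball (0::'a) \<rho>"
    have da: "\<bar>\<alpha> x - \<alpha> y\<bar> \<le> (K + 2) * norm (x - y) / m"
      using abs_inner_div_le[OF m(1) m(2)[OF w] _ v_lip[OF x y]] K(1)
      by (simp add: \<alpha>_def inner_diff_right diff_divide_distrib)
    have db: "\<bar>\<beta> x - \<beta> y\<bar> \<le> K * norm (x - y) / m"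
      using abs_inner_div_le'[OF m(1) m(2)[OF w] _ norm_deriv_le[OF w, of "S w"], of "norm (x - y)" "x - y"] K(1)
      by (simp add: \<beta>_def inner_diff_right diff_divide_distrib)
    \<comment> \<open>Difference of the product identity \<open>sp\<close> at x and at y; it avoids
      a Lipschitz estimate for a quotient.\<close>
    have e: "(speed V w x - speed V w y) * (1 + \<alpha> x) = (\<beta> y - \<beta> x) + speed V w y * (\<alpha> y - \<alpha> x)"
      using sp[OF x] sp[OF y] by (simp add: algebra_simps)
    have f: "\<bar>speed V w y * (\<alpha> y - \<alpha> x)\<bar> \<le> 2 * \<bar>\<alpha> x - \<alpha> y\<bar>"
      using sp2[OF y] unfolding abs_mult by (simp add: abs_minus_commute mult_right_mono)
    have "\<bar>speed V w x - speed V w y\<bar> * \<bar>1 + \<alpha> x\<bar> \<le> \<bar>\<beta> x - \<beta> y\<bar> + 2 * \<bar>\<alpha> x - \<alpha> y\<bar>"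
      unfolding abs_mult[symmetric] e using f by linarith
    also have "\<dots> \<le> K * norm (x - y) / m + 2 * ((K + 2) * norm (x - y) / m)"
      by (intro add_mono mult_left_mono da db) simp
    also have "\<dots> = (3 * K + 4) * norm (x - y) / m"
      by (simp add: add_divide_distrib[symmetric] algebra_simps)
    finally have "\<bar>speed V w x - speed V w y\<bar> * \<bar>1 + \<alpha> x\<bar> \<le> (3 * K + 4) * norm (x - y) / m" .
    moreover have "\<bar>speed V w x - speed V w y\<bar> * (1 / 2) \<le> \<bar>speed V w x - speed V w y\<bar> * \<bar>1 + \<alpha> x\<bar>"
      using \<alpha>(1)[OF x] by (intro mult_left_mono) auto
    moreover have "a \<le> 2 * c" if "b \<le> c" "a * (1 / 2) \<le> b" for a b c :: real using that by linarith
    ultimately have "\<bar>speed V w x - speed V w y\<bar> \<le> 2 * ((3 * K + 4) * norm (x - y) / m)" by blast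
    also have "\<dots> = (6 * K + 8) * norm (x - y) / m" by (simp add: algebra_simps)
    finally have spl: "\<bar>speed V w x - speed V w y\<bar> \<le> (6 * K + 8) * norm (x - y) / m" .
    have orthV: "orth ?a (V (w + z)) = orth ?a (v z)" for z
      by (simp add: v_def linear_diff[OF linear_orth] orth_self)
    \<comment> \<open>The three small factors are, in order, the Lipschitz constant of the nonlinear
      part, \<open>speed\<close> minus 1, and the size of v. Passing from V to v inside
      \<open>orth\<close> costs nothing because \<open>orth\<close> annihilates
      \<open>S w\<close>.\<close>
    have "rem V w x - rem V w y = orth ?a ((v x - ?B x) - (v y - ?B y)) +
        (speed V w x - 1) *\<^sub>R orth ?a (v x - v y) + (speed V w x - speed V w y) *\<^sub>R orth ?a (v y)"
      unfolding rem_def orthV linear_diff[OF linear_orth] by (simp add: algebra_simps)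
    also have "norm \<dots> \<le> 2 * \<eta>0 * norm (x - y) + 4 * \<eta>0 / m * ((K + 2) * norm (x - y)) +
        ((6 * K + 8) * norm (x - y) / m) * \<eta>0"
    proof (intro norm_triangle_mono)
      show "norm (orth ?a ((v x - ?B x) - (v y - ?B y))) \<le> 2 * \<eta>0 * norm (x - y)"
        using norm_orth lip[OF x y] by (rule order_trans)
      have "norm (orth ?a (v x - v y)) \<le> (K + 2) * norm (x - y)"
        using norm_orth v_lip[OF x y] by (rule order_trans)
      then show "norm ((speed V w x - 1) *\<^sub>R orth ?a (v x - v y)) \<le> 4 * \<eta>0 / m * ((K + 2) * norm (x - y))"
        using sp1[OF x] \<eta>0(1) m(1) unfolding norm_scaleR by (intro mult_mono) auto
      have "norm (orth ?a (v y)) \<le> \<eta>0"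
        using norm_orth v_le[OF y] by (rule order_trans)
      then show "norm ((speed V w x - speed V w y) *\<^sub>R orth ?a (v y)) \<le> ((6 * K + 8) * norm (x - y) / m) * \<eta>0"
        using spl m(1) K(1) unfolding norm_scaleR by (intro mult_mono) auto
    qed
    also have "\<dots> = (c * \<eta>0) * norm (x - y)"
      using m(1) by (simp add: c_def field_simps)
    also have "\<dots> \<le> \<eta> * norm (x - y)" using \<eta>0(4) by (rule mult_right_mono) simp
    finally show "norm (rem V w x - rem V w y) \<le> \<eta> * norm (x - y)" .
  qed
  have "norm (S (w + x) - S w - vf_deriv S w x) \<le> \<eta> * norm x" if w: "w \<in> \<Lambda>" and x: "x \<in> cball 0 \<rho>" for w x
  proof -
    have "norm (S (w + x) - S w - vf_deriv S w x) \<le> 2 * \<eta>0 * norm x"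
      using lip0[OF \<rho>(2) near_self[OF S] w x, of 0] \<rho>(1) by (simp add: algebra_simps)
    also have "\<dots> \<le> \<eta> * norm x" using \<eta>0' by (intro mult_right_mono) auto
    finally show ?thesis .
  qed
  then show ?thesis using est \<rho>(1) by blast
qed

text \<open>The forcing term at x = 0: it vanishes for V = S, and the factor 2 is a bound for
  \<open>speed\<close>.\<close>

lemma rem_0:
  assumes "good \<eta> \<rho> V" "w \<in> \<Lambda>" "0 \<le> \<rho>" "\<eta> \<le> 1"
  shows "norm (rem V w 0) \<le> 2 * norm (V w - S w)"
proof -
  have "orth (S w) (V w) = orth (S w) (V w - S w)"
    by (simp add: linear_diff[OF linear_orth] orth_self)
  then have "rem V w 0 = speed V w 0 *\<^sub>R orth (S w) (V w - S w)"
    by (simp add: rem_def blinfun.zero_right linear_0[OF linear_orth])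
  moreover have "\<bar>speed V w 0 - 1\<bar> \<le> \<eta>" using assms by (auto simp: good_def)
  then have "\<bar>speed V w 0\<bar> \<le> 2" using assms(4) by linarith
  ultimately show ?thesis
    using norm_orth[of "S w" "V w - S w"] by (simp add: mult_mono)
qed

end

subsection \<open>Cross-section flows as solutions of differential equations\<close>

text \<open>The lower bound 1/2 makes \<tau> onto and its inverse 2-Lipschitz, hence continuous, as
  the inverse function rule demands. Both are defined on the whole line, so no completeness of the
  rescaled field is presupposed.\<close>

lemma time_change:
  fixes g :: "real \<Rightarrow> real"
  assumes g: "continuous_on UNIV g" "\<And>s. 1 / 2 \<le> g s"
  shows "\<exists>\<tau> \<theta>. \<tau> 0 = 0 \<and> strict_mono \<tau> \<and> (\<forall>s. (\<tau> has_real_derivative g s) (at s)) \<and>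
     (\<forall>s. \<theta> (\<tau> s) = s) \<and> (\<forall>t. \<tau> (\<theta> t) = t) \<and> (\<forall>s. (\<theta> has_real_derivative inverse (g s)) (at (\<tau> s)))"
proof -
  obtain \<tau> where \<tau>0: "\<tau> 0 = 0" and \<tau>': "\<And>s. (\<tau> has_vector_derivative g s) (at s)"
    using antiderivative_exists[OF g(1)] by blast
  have \<tau>: "(\<tau> has_real_derivative g s) (at s)" for s
    using \<tau>' by (simp add: has_real_derivative_iff_has_vector_derivative)
  have grow: "(b - a) / 2 \<le> \<tau> b - \<tau> a" if "a \<le> b" for a b
  proof -
    have "((\<lambda>s. \<tau> s - s / 2) has_real_derivative g s - 1 / 2) (at s)" for s
      by (auto intro!: derivative_eq_intros \<tau>)
    then have "\<tau> a - a / 2 \<le> \<tau> b - b / 2"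
      using that g(2) by (intro DERIV_nonneg_imp_nondecreasing[OF that]) (metis diff_ge_0_iff_ge)
    then show ?thesis by (simp add: diff_divide_distrib)
  qed
  have mono: "strict_mono \<tau>"
    using grow by (intro strict_monoI) (smt (verit) divide_pos_pos)
  have "\<exists>s. \<tau> s = t" for t
  proof -
    have "\<tau> (- 2 * \<bar>t\<bar>) \<le> t" "t \<le> \<tau> (2 * \<bar>t\<bar>)"
      using grow[of "- 2 * \<bar>t\<bar>" 0] grow[of 0 "2 * \<bar>t\<bar>"] \<tau>0 by auto
    moreover have "continuous_on {- 2 * \<bar>t\<bar>..2 * \<bar>t\<bar>} \<tau>"
      using \<tau>' by (rule has_vector_derivative_imp_continuous_on)
    ultimately show ?thesis using IVT'[of \<tau> "- 2 * \<bar>t\<bar>" t "2 * \<bar>t\<bar>"] by auto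
  qed
  then obtain \<theta> where \<tau>\<theta>: "\<And>t. \<tau> (\<theta> t) = t" using choice[of "\<lambda>t s. \<tau> s = t"] by blast
  have \<theta>\<tau>: "\<theta> (\<tau> s) = s" for s
    using \<tau>\<theta>[of "\<tau> s"] strict_mono_eq[OF mono] by blast
  have "dist (\<theta> a) (\<theta> b) \<le> 2 * dist a b" for a b
    using grow[of "\<theta> a" "\<theta> b"] grow[of "\<theta> b" "\<theta> a"] \<tau>\<theta>
    by (cases "\<theta> a \<le> \<theta> b") (auto simp: dist_real_def)
  then have "2-lipschitz_on UNIV \<theta>" by (intro lipschitz_onI) auto
  then have "continuous_on UNIV \<theta>" by (rule lipschitz_on_continuous_on)
  then have cont: "isCont \<theta> t" for t by (simp add: continuous_on_eq_continuous_at)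
  have "(\<theta> has_real_derivative inverse (g s)) (at (\<tau> s))" for s
  proof (rule DERIV_inverse_function[where f = \<tau> and a = "\<tau> s - 1" and b = "\<tau> s + 1"])
    show "(\<tau> has_real_derivative g s) (at (\<theta> (\<tau> s)))" using \<tau> \<theta>\<tau> by simp
    show "g s \<noteq> 0" using g(2)[of s] by auto
  qed (use \<tau>\<theta> cont in auto)
  then show ?thesis using \<tau>0 mono \<tau> \<theta>\<tau> \<tau>\<theta> by blast
qed

context uniform_flow
begin

text \<open>Only the remainder is truncated. \<open>closest_point\<close> to a ball is nonexpansive,
  so the remainder keeps its small Lipschitz constant on the whole space while the linear part stays
  exact.\<close>

definition fld :: "real \<Rightarrow> ('a \<Rightarrow> 'a) \<Rightarrow> 'a \<Rightarrow> 'a \<Rightarrow> 'a" where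
  "fld \<rho> V w x = lin w x + rem V w (closest_point (cball 0 \<rho>) x)"

lemma continuous_on_S [continuous_intros]: "continuous_on A f \<Longrightarrow> continuous_on A (\<lambda>s. S (f s))"
  by (rule continuous_on_compose2[OF C1_field_continuous[OF S, of UNIV]]) auto

lemma continuous_on_deriv [continuous_intros]:
  "continuous_on A f \<Longrightarrow> continuous_on A (\<lambda>s. vf_deriv S (f s))"
  by (rule continuous_on_compose2[OF C1_field_continuous_deriv[OF S, of UNIV]]) auto

lemma continuous_on_apply [continuous_intros]:
  "continuous_on A f \<Longrightarrow> continuous_on A g \<Longrightarrow> continuous_on A (\<lambda>s. blinfun_apply (f s) (g s))"
  by (rule bounded_bilinear.continuous_on[OF bounded_bilinear_blinfun_apply])

lemma continuous_on_lin:
  assumes "continuous_on A f" "continuous_on A g" "f ` A \<subseteq> \<Lambda>"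
  shows "continuous_on A (\<lambda>s. lin (f s) (g s))"
  unfolding lin_def orth_def
  by (intro continuous_intros assms) (use S_nz assms(3) in force)+

lemma tangent_field_lin: "tangent_field (2 * K) 0 lin"
  unfolding tangent_field_def
proof (intro conjI ballI allI)
  show "continuous_on (\<Lambda> \<times> UNIV) (\<lambda>(w, x). lin w x)"
    unfolding case_prod_beta by (intro continuous_on_lin continuous_intros) auto
  show "norm (lin w x - lin w y) \<le> 2 * K * norm (x - y)" if "w \<in> \<Lambda>" for w x y
    using norm_lin[OF that, of "x - y"] by (simp add: linear_diff[OF linear_lin])
qed (use K inner_lin in \<open>auto simp: linear_0[OF linear_lin]\<close>)

context
  fixes \<eta> \<rho> :: real and V :: "'a \<Rightarrow> 'a"
  assumes \<eta>: "0 < \<eta>" "\<eta> \<le> 1 / 2" and \<rho>: "0 < \<rho>" and V: "good \<eta> \<rho> V"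
begin

abbreviation trunc :: "'a \<Rightarrow> 'a" where "trunc \<equiv> closest_point (cball 0 \<rho>)"

lemma V_C1: "C1_field V" using V by (simp add: good_def)

lemma trunc_in: "trunc x \<in> cball 0 \<rho>"
  using \<rho> by (intro closest_point_in_set) auto

lemma trunc_lipschitz: "norm (trunc x - trunc y) \<le> norm (x - y)"
  using closest_point_lipschitz[of "cball (0::'a) \<rho>" x y] \<rho> by (auto simp: dist_norm)

lemma continuous_on_trunc: "continuous_on A f \<Longrightarrow> continuous_on A (\<lambda>s. trunc (f s))"
  by (rule continuous_on_compose2[OF continuous_on_closest_point[of "cball 0 \<rho>" UNIV]]) (use \<rho> in auto)

lemma good_V:
  assumes "w \<in> \<Lambda>" "x \<in> cball 0 \<rho>"
  shows "S w \<bullet> V (w + x) > 0" "\<bar>speed V w x - 1\<bar> \<le> \<eta>" "1 / 2 \<le> speed V w x" "norm (V (w + x) - S w) \<le> \<eta>"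
    "y \<in> cball 0 \<rho> \<Longrightarrow> norm (rem V w x - rem V w y) \<le> \<eta> * norm (x - y)"
proof -
  show *: "S w \<bullet> V (w + x) > 0" "\<bar>speed V w x - 1\<bar> \<le> \<eta>" "norm (V (w + x) - S w) \<le> \<eta>"
    "y \<in> cball 0 \<rho> \<Longrightarrow> norm (rem V w x - rem V w y) \<le> \<eta> * norm (x - y)"
    using V assms unfolding good_def by blast+
  show "1 / 2 \<le> speed V w x" using *(2) \<eta>(2) by linarith
qed

lemma continuous_on_speed:
  assumes f: "continuous_on A f" "f ` A \<subseteq> \<Lambda>" and g: "continuous_on A g"
  shows "continuous_on A (\<lambda>s. speed V (f s) (trunc (g s)))"
proof -
  have t: "continuous_on A (\<lambda>s. trunc (g s))" by (rule continuous_on_trunc[OF g])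
  have c: "continuous_on A (\<lambda>s. V (f s + trunc (g s)))"
    by (rule continuous_on_compose2[OF C1_field_continuous[OF V_C1, of UNIV]])
       (auto intro!: continuous_on_add f t)
  have "S (f s) \<bullet> V (f s + trunc (g s)) \<noteq> 0" if "s \<in> A" for s
    using good_V(1)[OF _ trunc_in, of "f s" "g s"] f(2) that by force
  then show ?thesis
    unfolding speed_def by (intro continuous_intros f t c ballI) auto
qed

lemma tangent_field_fld:
  assumes near: "\<And>w. w \<in> \<Lambda> \<Longrightarrow> norm (V w - S w) \<le> \<delta>" and \<delta>: "0 \<le> \<delta>"
  shows "tangent_field (2 * K + \<eta>) (2 * \<delta>) (fld \<rho> V)"
  unfolding tangent_field_def
proof (intro conjI ballI allI)
  have "continuous_on (\<Lambda> \<times> UNIV) (\<lambda>z. V (fst z + trunc (snd z)))"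
    by (rule continuous_on_compose2[OF C1_field_continuous[OF V_C1, of UNIV]])
       (auto intro!: continuous_intros continuous_on_trunc)
  then have "continuous_on (\<Lambda> \<times> UNIV) (\<lambda>z. rem V (fst z) (trunc (snd z)))"
    unfolding rem_def orth_def
    by (intro continuous_intros continuous_on_speed continuous_on_trunc ballI) (use S_nz in auto)
  then show "continuous_on (\<Lambda> \<times> UNIV) (\<lambda>(w, x). fld \<rho> V w x)"
    unfolding fld_def case_prod_beta
    by (intro continuous_on_add continuous_on_lin continuous_intros) auto
  fix w assume w: "w \<in> \<Lambda>"
  show "norm (fld \<rho> V w x - fld \<rho> V w y) \<le> (2 * K + \<eta>) * norm (x - y)" for x y
  proof -
    have "norm (rem V w (trunc x) - rem V w (trunc y)) \<le> \<eta> * norm (trunc x - trunc y)"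
      using good_V(5)[OF w] trunc_in by blast
    also have "\<dots> \<le> \<eta> * norm (x - y)" using trunc_lipschitz \<eta> by (intro mult_left_mono) auto
    finally have "norm (lin w (x - y) + (rem V w (trunc x) - rem V w (trunc y))) \<le> 2 * K * norm (x - y) + \<eta> * norm (x - y)"
      using norm_lin[OF w] by (intro norm_triangle_mono)
    then show ?thesis by (simp add: fld_def linear_diff[OF linear_lin] algebra_simps)
  qed
  have "trunc 0 = 0" using \<rho> by (intro closest_point_self) auto
  then have "norm (fld \<rho> V w 0) = norm (rem V w 0)" by (simp add: fld_def linear_0[OF linear_lin])
  also have "\<dots> \<le> 2 * norm (V w - S w)" using rem_0[OF V w] \<rho> \<eta> by simp
  also have "\<dots> \<le> 2 * \<delta>" using near[OF w] by simp
  finally show "norm (fld \<rho> V w 0) \<le> 2 * \<delta>" .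
  show "S w \<bullet> fld \<rho> V w x = - (accel w \<bullet> x)" for x
    using w by (simp add: fld_def inner_add_right inner_lin inner_rem)
qed (use K \<eta> \<delta> in auto)

lemma fld_eq:
  assumes "w \<in> \<Lambda>" "x \<in> cball 0 \<rho>"
  shows "fld \<rho> V w x = speed V w x *\<^sub>R V (w + x) - S w"
  using lin_rem[OF assms(1), of V x] good_V(1)[OF assms] closest_point_self[OF assms(2)] by (simp add: fld_def)

text \<open>The point of \<open>\<Sigma>\<close> over \<open>\<phi> s w\<close> on the trajectory, as long as the truncation is not active.\<close>

abbreviation traj :: "'a \<Rightarrow> 'a \<Rightarrow> real \<Rightarrow> 'a" where
  "traj w p s \<equiv> \<phi> s w + sol (fld \<rho> V) w p s"

lemma tangent_fld: "\<exists>B. tangent_field (2 * K + \<eta>) (2 * B) (fld \<rho> V)"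
proof (intro exI tangent_field_fld)
  show "norm (V w - S w) \<le> \<eta>" if "w \<in> \<Lambda>" for w
    using good_V(4)[OF that, of 0] \<rho> by simp
qed (use \<eta> in simp)

lemma sol_fld:
  assumes "w \<in> \<Lambda>"
  shows "sol (fld \<rho> V) w p 0 = p"
    "(sol (fld \<rho> V) w p has_vector_derivative fld \<rho> V (\<phi> s w) (sol (fld \<rho> V) w p s)) (at s)"
    "p \<in> transversal S w \<Longrightarrow> sol (fld \<rho> V) w p s \<in> transversal S (\<phi> s w)"
  using tangent_fld sol[OF _ assms] sol_transversal[OF _ assms] by metis+

lemma sol_fld_continuous: "w \<in> \<Lambda> \<Longrightarrow> continuous_on A (sol (fld \<rho> V) w p)"
  using sol_fld(2) by (rule has_vector_derivative_imp_continuous_on)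

lemma traj_der:
  assumes w: "w \<in> \<Lambda>" and x: "norm (sol (fld \<rho> V) w p s) \<le> \<rho>"
  shows "(traj w p has_vector_derivative
     speed V (\<phi> s w) (sol (fld \<rho> V) w p s) *\<^sub>R V (traj w p s)) (at s)"
  using has_vector_derivative_add[OF \<phi>_der[of w s] sol_fld(2)[OF w, of p s]]
    fld_eq[OF \<phi>_in[OF w], of "sol (fld \<rho> V) w p s" s] x by simp

text \<open>\<open>traj\<close> follows V at a variable speed, and the time change removes that
  speed. The truncated speed is used because its lower bound holds for all s; the equation for V is
  claimed only where the truncation is inactive.\<close>

lemma traj_reparam:
  assumes w: "w \<in> \<Lambda>"
  shows "\<exists>\<tau> \<theta>. \<tau> 0 = 0 \<and> strict_mono \<tau> \<and>
    (\<forall>s. (\<tau> has_real_derivative speed V (\<phi> s w) (trunc (sol (fld \<rho> V) w p s))) (at s)) \<and>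
    (\<forall>s. (\<theta> has_real_derivative inverse (speed V (\<phi> s w) (trunc (sol (fld \<rho> V) w p s)))) (at (\<tau> s))) \<and>
    (\<forall>s. \<theta> (\<tau> s) = s) \<and> (\<forall>t. \<tau> (\<theta> t) = t) \<and>
    (\<forall>s. norm (sol (fld \<rho> V) w p s) \<le> \<rho> \<longrightarrow> ((\<lambda>t. traj w p (\<theta> t)) has_vector_derivative V (traj w p s)) (at (\<tau> s)))"
proof -
  let ?x = "sol (fld \<rho> V) w p"
  let ?g = "\<lambda>s. speed V (\<phi> s w) (trunc (?x s))"
  have "continuous_on UNIV ?g"
    by (intro continuous_on_speed \<phi>_continuous_time sol_fld_continuous) (use w in auto)
  moreover have "1 / 2 \<le> ?g s" for s
    by (rule good_V(3)[OF \<phi>_in[OF w] trunc_in])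
  ultimately obtain \<tau> \<theta> where *: "\<tau> 0 = 0" "strict_mono \<tau>" "\<forall>s. (\<tau> has_real_derivative ?g s) (at s)"
    "\<forall>s. \<theta> (\<tau> s) = s" "\<forall>t. \<tau> (\<theta> t) = t" "\<forall>s. (\<theta> has_real_derivative inverse (?g s)) (at (\<tau> s))"
    using time_change[of ?g] by auto
  have "((\<lambda>t. traj w p (\<theta> t)) has_vector_derivative V (traj w p s)) (at (\<tau> s))"
    if x: "norm (?x s) \<le> \<rho>" for s
  proof -
    have tr: "trunc (?x s) = ?x s" using x by (intro closest_point_self) simp
    have nz: "speed V (\<phi> s w) (?x s) \<noteq> 0" using good_V(3)[OF \<phi>_in[OF w, of s], of "?x s"] x by force
    have "(\<theta> has_vector_derivative inverse (?g s)) (at (\<tau> s))"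
      using *(6) by (simp add: has_real_derivative_iff_has_vector_derivative)
    moreover have "(traj w p has_vector_derivative speed V (\<phi> s w) (?x s) *\<^sub>R V (traj w p s)) (at (\<theta> (\<tau> s)))"
      using traj_der[OF w x] *(4) by simp
    ultimately have "(traj w p \<circ> \<theta> has_vector_derivative inverse (?g s) *\<^sub>R (speed V (\<phi> s w) (?x s) *\<^sub>R V (traj w p s))) (at (\<tau> s))"
      by (rule vector_diff_chain_at)
    then show ?thesis using nz by (simp add: tr o_def)
  qed
  then show ?thesis using * by blast
qed

lemma S_\<phi>_lipschitz:
  assumes w: "w \<in> \<Lambda>"
  shows "norm (S (\<phi> s w) - S (\<phi> t w)) \<le> K * M * \<bar>s - t\<bar>"
proof -
  have "norm (S (\<phi> s w) - S (\<phi> t w)) \<le> K * M * norm (s - t)"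
  proof (rule differentiable_bound[of UNIV "\<lambda>s. S (\<phi> s w)" "\<lambda>s h. h *\<^sub>R accel (\<phi> s w)"])
    show "((\<lambda>s. S (\<phi> s w)) has_derivative (\<lambda>h. h *\<^sub>R accel (\<phi> r w))) (at r within UNIV)" for r
      using S_\<phi>_der[of w r] by (simp add: has_vector_derivative_def)
    fix r
    have "norm (accel (\<phi> r w)) \<le> K * M"
      using norm_deriv_le[OF \<phi>_in[OF w], of r "S (\<phi> r w)"] mult_left_mono[OF M(2)[OF \<phi>_in[OF w], of r], of K] K(1)
      by (simp add: order_trans)
    then have "norm (h *\<^sub>R accel (\<phi> r w)) \<le> K * M * norm h" for h :: real
      using mult_left_mono[of "norm (accel (\<phi> r w))" "K * M" "\<bar>h\<bar>"] by (simp add: mult.commute)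
    then show "onorm (\<lambda>h. h *\<^sub>R accel (\<phi> r w)) \<le> K * M"
      by (intro onorm_bound) (use K(1) M(1) in auto)
  qed auto
  then show ?thesis by simp
qed

text \<open>Over a short base time the normal of the target section hardly turns. The coordinate of
  the trajectory along this fixed normal is then strictly increasing, so the target section is met
  only at the end.\<close>

lemma traj_first_hit:
  assumes \<eta>m: "\<eta> \<le> m / 4" and w: "w \<in> \<Lambda>" and p: "p \<in> transversal S w"
    and J: "closed_segment s s' \<subseteq> J" and x: "\<And>r. r \<in> J \<Longrightarrow> norm (sol (fld \<rho> V) w p r) \<le> \<rho>"
    and close: "K * M * \<bar>s' - s\<bar> < m / 4"
  shows "first_hit S \<phi> V (s' - s) (\<phi> s w) (traj w p s) (traj w p s')"
proof -
  let ?x = "sol (fld \<rho> V) w p" and ?c = "traj w p"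
  obtain \<tau> \<theta> where \<tau>: "strict_mono \<tau>" "\<And>s. \<theta> (\<tau> s) = s" "\<And>t. \<tau> (\<theta> t) = t"
    and u: "\<And>s. norm (?x s) \<le> \<rho> \<Longrightarrow> ((\<lambda>t. ?c (\<theta> t)) has_vector_derivative V (?c s)) (at (\<tau> s))"
    using traj_reparam[OF w, of p] by blast
  have \<tau>_le: "\<tau> a \<le> \<tau> b \<longleftrightarrow> a \<le> b" "\<tau> a < \<tau> b \<longleftrightarrow> a < b" for a b
    using \<tau>(1) by (auto simp: strict_mono_less_eq strict_mono_less)
  have \<theta>_seg: "\<theta> (r + \<tau> s) \<in> closed_segment s s'" if "r \<in> closed_segment 0 (\<tau> s' - \<tau> s)" for r
  proof -
    have "\<tau> (\<theta> (r + \<tau> s)) = r + \<tau> s" by (rule \<tau>(3))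
    then show ?thesis
      using that \<tau>_le[of s "\<theta> (r + \<tau> s)"] \<tau>_le[of "\<theta> (r + \<tau> s)" s'] \<tau>_le[of s' "\<theta> (r + \<tau> s)"]
        \<tau>_le[of "\<theta> (r + \<tau> s)" s] \<tau>_le[of s s']
      by (auto simp: closed_segment_eq_real_ivl split: if_splits)
  qed
  have flow_seg: "local_flow V r (?c s) (?c (\<theta> (r + \<tau> s)))" if r: "r \<in> closed_segment 0 (\<tau> s' - \<tau> s)" for r
  proof (rule local_flowI[where u = "\<lambda>r. ?c (\<theta> (r + \<tau> s))"])
    fix q assume "q \<in> closed_segment 0 r"
    then have "\<theta> (q + \<tau> s) \<in> closed_segment s s'"
      using closed_segment_0_subset[OF r] \<theta>_seg by blast
    then have "norm (?x (\<theta> (q + \<tau> s))) \<le> \<rho>" using J x by blast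
    then have "((\<lambda>t. ?c (\<theta> t)) has_vector_derivative V (?c (\<theta> (q + \<tau> s)))) (at (q + \<tau> s))"
      using u[of "\<theta> (q + \<tau> s)"] \<tau>(3) by simp
    moreover have "((\<lambda>q. q + \<tau> s) has_vector_derivative 1) (at q)"
      by (auto intro!: derivative_eq_intros simp: has_real_derivative_iff_has_vector_derivative[symmetric])
    ultimately have "((\<lambda>r. ?c (\<theta> (r + \<tau> s))) has_vector_derivative V (?c (\<theta> (q + \<tau> s)))) (at q)"
      using vector_diff_chain_at[of "\<lambda>q. q + \<tau> s" 1 q "\<lambda>t. ?c (\<theta> t)"] by (simp add: o_def)
    then show "((\<lambda>r. ?c (\<theta> (r + \<tau> s))) has_vector_derivative V (?c (\<theta> (q + \<tau> s)))) (at q within closed_segment 0 r)"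
      by (rule has_vector_derivative_at_within)
  qed (use \<tau>(2) in auto)
  have x_in: "?x r \<in> transversal S (\<phi> r w)" for r by (rule sol_fld(3)[OF w p])
  have c_in: "?c r \<in> cross_section S (\<phi> r w)" for r
    using x_in[of r] by (simp add: cross_section_def transversal_def)
  let ?a = "S (\<phi> s' w)"
  \<comment> \<open>V on the trajectory is within m/4 of S at the base point, which is within m/4 of
    \<open>?a\<close>; the total is less than \<open>norm ?a\<close>, so the inner product cannot
    vanish or change sign.\<close>
  have pos: "?a \<bullet> V (?c r) > 0" if r: "r \<in> closed_segment s s'" for r
  proof -
    have "\<bar>r - s'\<bar> \<le> \<bar>s' - s\<bar>" using r by (auto simp: closed_segment_eq_real_ivl split: if_splits)
    then have "K * M * \<bar>r - s'\<bar> \<le> K * M * \<bar>s' - s\<bar>" using K(1) M(1) by (intro mult_left_mono) auto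
    then have "norm (S (\<phi> r w) - ?a) < m / 4"
      using S_\<phi>_lipschitz[OF w, of r s'] close by linarith
    moreover have "norm (V (?c r) - S (\<phi> r w)) \<le> m / 4"
      using good_V(4)[OF \<phi>_in[OF w, of r], of "?x r"] x[of r] r J \<eta>m by force
    ultimately have d: "norm (V (?c r) - ?a) < m"
      using norm_triangle_ineq[of "V (?c r) - S (\<phi> r w)" "S (\<phi> r w) - ?a"] m(1) by simp
    have am: "m \<le> norm ?a" using m(2) w by simp
    have "- (?a \<bullet> (V (?c r) - ?a)) \<le> norm ?a * norm (V (?c r) - ?a)"
      using Cauchy_Schwarz_ineq2[of ?a "V (?c r) - ?a"] by linarith
    also have "\<dots> < norm ?a * norm ?a" using d am m(1) by (intro mult_strict_left_mono) auto
    also have "\<dots> = ?a \<bullet> ?a" by (simp add: power2_norm_eq_inner[symmetric] power2_eq_square)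
    finally show ?thesis by (simp add: inner_diff_right)
  qed
  have der: "\<exists>y. ((\<lambda>r. ?a \<bullet> ?c r) has_real_derivative y) (at r) \<and> 0 < y" if r: "r \<in> closed_segment s s'" for r
  proof (intro exI conjI)
    have xr: "norm (?x r) \<le> \<rho>" using r J x by blast
    show "((\<lambda>r. ?a \<bullet> ?c r) has_real_derivative ?a \<bullet> (speed V (\<phi> r w) (?x r) *\<^sub>R V (?c r))) (at r)"
      unfolding has_real_derivative_iff_has_vector_derivative
      using bounded_linear.has_vector_derivative[OF bounded_linear_inner_right traj_der[OF w xr]] .
    have "1 / 2 \<le> speed V (\<phi> r w) (?x r)" using good_V(3)[OF \<phi>_in[OF w]] xr by simp
    then show "0 < ?a \<bullet> (speed V (\<phi> r w) (?x r) *\<^sub>R V (?c r))" using pos[OF r] by simp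
  qed
  have no_hit: "?c r \<notin> cross_section S (\<phi> s' w)" if r: "r \<in> closed_segment s s'" "r \<noteq> s'" for r
  proof -
    have "?a \<bullet> ?c r \<noteq> ?a \<bullet> ?c s'"
    proof (cases "r < s'")
      case True
      have "?a \<bullet> ?c r < ?a \<bullet> ?c s'"
        by (rule DERIV_pos_imp_increasing[OF True])
           (use der r True in \<open>auto simp: closed_segment_eq_real_ivl split: if_splits\<close>)
      then show ?thesis by simp
    next
      case False
      then have "s' < r" using r by simp
      then have "?a \<bullet> ?c s' < ?a \<bullet> ?c r"
        by (rule DERIV_pos_imp_increasing)
           (use der r \<open>s' < r\<close> in \<open>auto simp: closed_segment_eq_real_ivl split: if_splits\<close>)
      then show ?thesis by simp
    qed
    then show ?thesis using c_in[of s'] by (auto simp: cross_section_def inner_diff_right)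
  qed
  show ?thesis
    unfolding first_hit_def
  \<comment> \<open>The hitting time is measured in the time of V, hence the difference of
    \<tau>-values.\<close>
  proof (intro conjI exI[of _ "\<tau> s' - \<tau> s"] ballI allI impI)
    show "?c s \<in> cross_section S (\<phi> s w)" by (rule c_in)
    have shift: "\<phi> (s' - s) (\<phi> s w) = \<phi> s' w" by (simp flip: \<phi>_add)
    show "?c s' \<in> cross_section S (\<phi> (s' - s) (\<phi> s w))" unfolding shift by (rule c_in)
    show "sgn (\<tau> s' - \<tau> s) = sgn (s' - s)"
      using \<tau>_le[of s s'] \<tau>_le[of s' s] by (auto simp: sgn_if)
    show "local_flow V (\<tau> s' - \<tau> s) (?c s) (?c s')"
      using flow_seg[of "\<tau> s' - \<tau> s"] \<tau>(2) by simp
    fix t' q' assume t': "t' \<in> open_segment 0 (\<tau> s' - \<tau> s)" and q': "local_flow V t' (?c s) q'"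
    have t'c: "t' \<in> closed_segment 0 (\<tau> s' - \<tau> s)" "t' \<noteq> \<tau> s' - \<tau> s"
      using t' by (auto simp: open_segment_def)
    have "q' = ?c (\<theta> (t' + \<tau> s))" using local_flow_unique[OF V_C1 q' flow_seg[OF t'c(1)]] .
    moreover have "\<theta> (t' + \<tau> s) \<noteq> s'" using t'c(2) \<tau>(3)[of "t' + \<tau> s"] by auto
    ultimately show "q' \<notin> cross_section S (\<phi> (s' - s) (\<phi> s w))"
      unfolding shift using no_hit \<theta>_seg[OF t'c(1)] by simp
  qed
qed

lemma traj_cs_flow:
  assumes \<eta>m: "\<eta> \<le> m / 4" and w: "w \<in> \<Lambda>" and p: "p \<in> transversal S w"
    and x: "\<And>r. r \<in> closed_segment 0 t \<Longrightarrow> norm (sol (fld \<rho> V) w p r) \<le> \<rho>"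
  shows "cs_flow S \<phi> V t w (w + p) (traj w p t)"
  unfolding cs_flow_def
\<comment> \<open>S changes along an orbit at rate at most K M, so base times closer than m / (4 K
  M) satisfy the closeness condition of \<open>traj_first_hit\<close>.\<close>
proof (intro exI[of _ "traj w p"] conjI exI[of _ "m / (4 * (K * M))"] ballI impI)
  show "traj w p 0 = w + p" using sol_fld(1)[OF w] by simp
  show "continuous_on (closed_segment 0 t) (traj w p)"
    by (intro continuous_on_add \<phi>_continuous_time sol_fld_continuous w)
  have KM: "0 < K * M" using K(1) M(1) by simp
  then show "0 < m / (4 * (K * M))" using m(1) by simp
  fix s s' assume s: "s \<in> closed_segment 0 t" "s' \<in> closed_segment 0 t" and "\<bar>s' - s\<bar> < m / (4 * (K * M))"
  then have "K * M * \<bar>s' - s\<bar> < m / 4" using KM by (simp add: pos_less_divide_eq mult_ac)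
  moreover have "closed_segment s s' \<subseteq> closed_segment 0 t"
    using s by (simp add: closed_segment_subset)
  ultimately show "first_hit S \<phi> V (s' - s) (\<phi> s w) (traj w p s) (traj w p s')"
    by (intro traj_first_hit[OF \<eta>m w p _ x]) auto
qed simp

end

end

subsection \<open>The transversal linear flow\<close>

text \<open>Within a subspace a derivative is determined only along the subspace; testing at small
  multiples of y stays inside it.\<close>

lemma has_derivative_within_subspace_unique:
  fixes f :: "'a::real_normed_vector \<Rightarrow> 'b::real_normed_vector"
  assumes f: "(f has_derivative f1) (at 0 within T)" "(f has_derivative f2) (at 0 within T)"
    and T: "subspace T" and y: "y \<in> T"
  shows "f1 y = f2 y"
proof (cases "y = 0")
  case True
  then show ?thesis
    using f[THEN has_derivative_linear] by (simp add: linear_0)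
next
  case False
  have lin: "linear f1" "linear f2" using f[THEN has_derivative_linear] .
  have "norm (f1 y - f2 y) \<le> 0 + e" if e: "0 < e" for e
  proof -
    define e' where "e' = e / (2 * norm y)"
    have e': "0 < e'" using e False by (simp add: e'_def)
    obtain d1 where d1: "d1 > 0" "\<And>z. z \<in> T \<Longrightarrow> norm z < d1 \<Longrightarrow> norm (f z - f 0 - f1 z) \<le> e' * norm z"
      using f(1) e' unfolding has_derivative_within_alt by fastforce
    obtain d2 where d2: "d2 > 0" "\<And>z. z \<in> T \<Longrightarrow> norm z < d2 \<Longrightarrow> norm (f z - f 0 - f2 z) \<le> e' * norm z"
      using f(2) e' unfolding has_derivative_within_alt by fastforce
    define c where "c = min d1 d2 / (2 * norm y)"
    have c: "0 < c" "norm (c *\<^sub>R y) < d1" "norm (c *\<^sub>R y) < d2"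
      using d1(1) d2(1) False by (auto simp: c_def)
    have cT: "c *\<^sub>R y \<in> T" using T y by (rule subspace_scale)
    have "c *\<^sub>R (f1 y - f2 y) = (f (c *\<^sub>R y) - f 0 - f2 (c *\<^sub>R y)) - (f (c *\<^sub>R y) - f 0 - f1 (c *\<^sub>R y))"
      by (simp add: linear_scale[OF lin(1)] linear_scale[OF lin(2)] scaleR_diff_right)
    also have "norm \<dots> \<le> e' * norm (c *\<^sub>R y) + e' * norm (c *\<^sub>R y)"
      by (intro norm_triangle_le_diff add_mono d1(2) d2(2) c cT)
    finally have "c * norm (f1 y - f2 y) \<le> c * (2 * e' * norm y)"
      using c(1) unfolding norm_scaleR by (simp add: mult_ac)
    then have "norm (f1 y - f2 y) \<le> 2 * e' * norm y" using c(1) by simp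
    then show ?thesis using False by (simp add: e'_def)
  qed
  then have "norm (f1 y - f2 y) \<le> 0" by (rule field_le_epsilon)
  then show ?thesis by simp
qed

section \<open>The linear equation in the transversals and its identification with the derivative of
  first hits\<close>

lemma closed_segment_0_abs_le: "s \<in> closed_segment 0 t \<Longrightarrow> \<bar>s\<bar> \<le> \<bar>t::real\<bar>"
  by (auto simp: closed_segment_eq_real_ivl split: if_splits)

lemma subspace_transversal: "subspace (transversal S w)"
  unfolding transversal_def by (rule subspace_hyperplane)

context uniform_flow
begin

definition tlin :: "real \<Rightarrow> 'a \<Rightarrow> 'a \<Rightarrow> 'a" where "tlin t w x = sol lin w x t"

lemma tlin_0: "w \<in> \<Lambda> \<Longrightarrow> tlin 0 w x = x"
  using sol(1)[OF tangent_field_lin] by (simp add: tlin_def)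

lemma tlin_add: "w \<in> \<Lambda> \<Longrightarrow> tlin (s + t) w x = tlin s (\<phi> t w) (tlin t w x)"
  using sol_add[OF tangent_field_lin] by (simp add: tlin_def)

lemma tlin_transversal: "w \<in> \<Lambda> \<Longrightarrow> x \<in> transversal S w \<Longrightarrow> tlin t w x \<in> transversal S (\<phi> t w)"
  using sol_transversal[OF tangent_field_lin] by (simp add: tlin_def)

lemma tlin_bound: "w \<in> \<Lambda> \<Longrightarrow> norm (tlin t w x) \<le> 2 * exp (4 * K * \<bar>t\<bar>) * norm x"
  using sol_bound[OF tangent_field_lin, of w x t] by (simp add: tlin_def mult_ac)

lemma linear_tlin:
  assumes w: "w \<in> \<Lambda>"
  shows "linear (tlin t w)"
proof (rule linearI)
  note der = sol(2)[OF tangent_field_lin w] and sol0 = sol(1)[OF tangent_field_lin w]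
  fix x y :: 'a and r :: real
  have "((\<lambda>s. sol lin w x s + sol lin w y s) has_vector_derivative lin (\<phi> s w) (sol lin w x s + sol lin w y s)) (at s)" for s
    using has_vector_derivative_add[OF der der] by (simp add: linear_add[OF linear_lin])
  from sol_unique[OF tangent_field_lin w this]
  show "tlin t w (x + y) = tlin t w x + tlin t w y" by (simp add: tlin_def sol0)
  have "((\<lambda>s. r *\<^sub>R sol lin w x s) has_vector_derivative lin (\<phi> s w) (r *\<^sub>R sol lin w x s)) (at s)" for s
    using bounded_linear.has_vector_derivative[OF bounded_linear_scaleR_right der] by (simp add: linear_scale[OF linear_lin])
  from sol_unique[OF tangent_field_lin w this]
  show "tlin t w (r *\<^sub>R x) = r *\<^sub>R tlin t w x" by (simp add: tlin_def sol0)
qed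

text \<open>Product of two Gronwall bounds: the growth of an approximate solution, and the growth of
  its deviation from the linear one.\<close>

definition apx :: "real \<Rightarrow> real" where
  "apx t = 4 * \<bar>t\<bar> * exp (2 * (2 * K + 1) * \<bar>t\<bar>) * exp (4 * K * \<bar>t\<bar>)"

text \<open>The error is relative to \<open>e\<close> itself, so the deviation is proportional to
  \<open>norm (e 0)\<close>. This one estimate yields differentiability at 0, the Lipschitz constant
  of the sampled perturbation, and the sampled form of uniqueness.\<close>

lemma tlin_approx:
  assumes w: "w \<in> \<Lambda>" and \<eta>: "0 \<le> \<eta>" "\<eta> \<le> 1"
    and e: "\<And>s. (e has_vector_derivative e' s) (at s)"
    and err: "\<And>s. s \<in> closed_segment 0 t \<Longrightarrow> norm (e' s - lin (\<phi> s w) (e s)) \<le> \<eta> * norm (e s)"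
  shows "norm (e t - tlin t w (e 0)) \<le> \<eta> * apx t * norm (e 0)"
proof -
  let ?E = "exp (2 * (2 * K + 1) * \<bar>t\<bar>)"
  have e_le: "norm (e s) \<le> 2 * norm (e 0) * ?E" if s: "s \<in> closed_segment 0 t" for s
  proof -
    have "norm (e s) \<le> 2 * (norm (e 0) + 0 * \<bar>s\<bar>) * exp (2 * (2 * K + 1) * \<bar>s\<bar>)"
    proof (rule gronwall_UNIV[OF _ _ e])
      fix r assume "r \<in> closed_segment 0 s"
      then have r: "r \<in> closed_segment 0 t" using closed_segment_0_subset[OF s] by blast
      have "norm (e' r) \<le> norm (lin (\<phi> r w) (e r)) + norm (e' r - lin (\<phi> r w) (e r))"
        by (rule norm_triangle_sub)
      also have "\<dots> \<le> 2 * K * norm (e r) + 1 * norm (e r)"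
        using norm_lin[OF \<phi>_in[OF w]] order_trans[OF err[OF r] mult_right_mono[OF \<eta>(2)]]
        by (intro add_mono) auto
      finally show "norm (e' r) \<le> (2 * K + 1) * norm (e r) + 0" by (simp add: algebra_simps)
    qed (use K in auto)
    also have "\<dots> \<le> 2 * norm (e 0) * ?E"
      using closed_segment_0_abs_le[OF s] K(1) by (simp add: mult_left_mono)
    finally show ?thesis .
  qed
  have "norm (e t - tlin t w (e 0)) \<le> 2 * (norm (e 0 - tlin 0 w (e 0)) + \<eta> * (2 * norm (e 0) * ?E) * \<bar>t\<bar>) * exp (2 * (2 * K) * \<bar>t\<bar>)"
  proof (rule gronwall_UNIV[where d = "\<lambda>s. e s - tlin s w (e 0)"])
    show "((\<lambda>s. e s - tlin s w (e 0)) has_vector_derivative e' s - lin (\<phi> s w) (tlin s w (e 0))) (at s)" for s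
      unfolding tlin_def by (intro has_vector_derivative_diff e sol(2)[OF tangent_field_lin w])
    fix s assume s: "s \<in> closed_segment 0 t"
    have "e' s - lin (\<phi> s w) (tlin s w (e 0)) = lin (\<phi> s w) (e s - tlin s w (e 0)) + (e' s - lin (\<phi> s w) (e s))"
      by (simp add: linear_diff[OF linear_lin])
    also have "norm \<dots> \<le> 2 * K * norm (e s - tlin s w (e 0)) + \<eta> * (2 * norm (e 0) * ?E)"
      using norm_lin[OF \<phi>_in[OF w]] order_trans[OF err[OF s] mult_left_mono[OF e_le[OF s] \<eta>(1)]]
      by (intro norm_triangle_mono) auto
    finally show "norm (e' s - lin (\<phi> s w) (tlin s w (e 0))) \<le> 2 * K * norm (e s - tlin s w (e 0)) + \<eta> * (2 * norm (e 0) * ?E)" .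
  qed (use K \<eta> in auto)
  then show ?thesis by (simp add: apx_def tlin_0[OF w] mult_ac)
qed

text \<open>For small p the map \<open>cs_map\<close> is given by the solution of the truncated
  equation with V = S. There the remainder has no value at 0 and arbitrarily small relative size
  near 0, so the derivative is that of the linear equation.\<close>

lemma transversal_flow_eq_tlin:
  assumes w: "w \<in> \<Lambda>" and y: "y \<in> transversal S w"
  shows "transversal_flow S \<phi> t w y = tlin t w y"
proof -
  define \<eta>1 where "\<eta>1 = min (1 / 2) (m / 4)"
  have \<eta>1: "0 < \<eta>1" "\<eta>1 \<le> 1 / 2" "\<eta>1 \<le> m / 4" using m(1) by (auto simp: \<eta>1_def min_def)
  obtain \<rho>1 where \<rho>1: "0 < \<rho>1" "good \<eta>1 \<rho>1 S"
    using near_good[OF \<eta>1(1)] near_self[OF S] by (metis less_imp_le)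
  let ?X = "sol (fld \<rho>1 S) w"
  define E where "E = 2 * exp (2 * (2 * K + \<eta>1) * \<bar>t\<bar>)"
  have E: "0 < E" by (simp add: E_def)
  have tf: "tangent_field (2 * K + \<eta>1) (2 * 0) (fld \<rho>1 S)"
    by (rule tangent_field_fld[OF \<eta>1(1,2) \<rho>1]) auto
  have X_le: "norm (?X p s) \<le> E * norm p" if s: "s \<in> closed_segment 0 t" for p s
  proof -
    have "norm (?X p s) \<le> 2 * norm p * exp (2 * (2 * K + \<eta>1) * \<bar>s\<bar>)"
      using sol_bound[OF tf w, of p s] by simp
    also have "\<dots> \<le> 2 * norm p * exp (2 * (2 * K + \<eta>1) * \<bar>t\<bar>)"
      using closed_segment_0_abs_le[OF s] K(1) \<eta>1 by (intro mult_left_mono) auto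
    finally show ?thesis by (simp add: E_def mult_ac)
  qed
  have cs: "cs_map S \<phi> S t w p = ?X p t" if p: "p \<in> transversal S w" "E * norm p \<le> \<rho>1" for p
  proof -
    have "cs_flow S \<phi> S t w (w + p) (\<phi> t w + ?X p t)"
      using X_le p(2) order_trans by (intro traj_cs_flow[OF \<eta>1(1,2) \<rho>1 \<eta>1(3) w p(1)]) blast
    then have "(THE q. cs_flow S \<phi> S t w (w + p) q) = \<phi> t w + ?X p t"
      using cs_flow_unique[OF S] by (intro the_equality) auto
    then show ?thesis by (simp add: cs_map_def)
  qed
  have X0: "?X 0 t = 0" using X_le[of t 0] by simp
  have cs0: "cs_map S \<phi> S t w 0 = 0"
    using cs[OF subspace_0[OF subspace_transversal]] \<rho>1 X0 by simp
  have der: "(cs_map S \<phi> S t w has_derivative tlin t w) (at 0 within transversal S w)"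
    unfolding has_derivative_within_alt
  proof (intro conjI allI impI)
    show "bounded_linear (tlin t w)" using linear_tlin[OF w] linear_conv_bounded_linear by blast
    fix e :: real assume e: "0 < e"
    have apx0: "0 \<le> apx t" by (simp add: apx_def)
    \<comment> \<open>A second, finer tube. The solution is still that of the field truncated at
      \<open>\<rho>1\<close>, but close to 0 its remainder has relative size \<open>\<eta>2\<close>,
      which makes the deviation at most e.\<close>
    define \<eta>2 where "\<eta>2 = min (1 / 2) (e / (apx t + 1))"
    have \<eta>2: "0 < \<eta>2" "\<eta>2 \<le> 1 / 2" "\<eta>2 \<le> e / (apx t + 1)"
    proof -
      show "0 < \<eta>2" using e apx0 by (simp add: \<eta>2_def)
      show "\<eta>2 \<le> 1 / 2" "\<eta>2 \<le> e / (apx t + 1)" unfolding \<eta>2_def by (rule min.cobounded1 min.cobounded2)+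
    qed
    have "\<eta>2 * apx t \<le> e / (apx t + 1) * (apx t + 1)"
      using \<eta>2 apx0 e by (intro mult_mono) auto
    then have \<eta>2e: "\<eta>2 * apx t \<le> e" using apx0 by simp
    obtain \<rho>2 where \<rho>2: "0 < \<rho>2" "good \<eta>2 \<rho>2 S"
      using near_good[OF \<eta>2(1)] near_self[OF S] by (metis less_imp_le)
    have rem_le: "norm (rem S v x) \<le> \<eta>2 * norm x" if "v \<in> \<Lambda>" "norm x \<le> \<rho>2" for v x
    proof -
      have "rem S v 0 = 0" using rem_0[OF \<rho>2(2) that(1)] \<rho>2 \<eta>2 by simp
      moreover have "norm (rem S v x - rem S v 0) \<le> \<eta>2 * norm (x - 0)"
        using that \<rho>2(1) by (intro good_V(5)[OF \<eta>2(1,2) \<rho>2 that(1)]) auto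
      ultimately show ?thesis by simp
    qed
    show "\<exists>d>0. \<forall>p\<in>transversal S w. norm (p - 0) < d \<longrightarrow>
      norm (cs_map S \<phi> S t w p - cs_map S \<phi> S t w 0 - tlin t w (p - 0)) \<le> e * norm (p - 0)"
    proof (intro exI conjI ballI impI)
      show "0 < min \<rho>1 \<rho>2 / E" using \<rho>1 \<rho>2 E by simp
      fix p assume p: "p \<in> transversal S w" and "norm (p - 0) < min \<rho>1 \<rho>2 / E"
      then have Ep: "E * norm p \<le> \<rho>1" "E * norm p \<le> \<rho>2"
        using E by (simp_all add: pos_less_divide_eq mult.commute)
      have "norm (?X p t - tlin t w (?X p 0)) \<le> \<eta>2 * apx t * norm (?X p 0)"
      proof (rule tlin_approx[OF w])
        show "(?X p has_vector_derivative fld \<rho>1 S (\<phi> s w) (?X p s)) (at s)" for s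
          by (rule sol(2)[OF tf w])
        fix s assume s: "s \<in> closed_segment 0 t"
        have Xs: "norm (?X p s) \<le> \<rho>1" "norm (?X p s) \<le> \<rho>2"
          using X_le[OF s, of p] Ep by linarith+
        then have "closest_point (cball 0 \<rho>1) (?X p s) = ?X p s"
          by (intro closest_point_self) simp
        then show "norm (fld \<rho>1 S (\<phi> s w) (?X p s) - lin (\<phi> s w) (?X p s)) \<le> \<eta>2 * norm (?X p s)"
          using rem_le[OF \<phi>_in[OF w] Xs(2)] by (simp add: fld_def)
      qed (use \<eta>2 in auto)
      also have "\<dots> \<le> e * norm (?X p 0)" using \<eta>2e by (rule mult_right_mono) simp
      finally show "norm (cs_map S \<phi> S t w p - cs_map S \<phi> S t w 0 - tlin t w (p - 0)) \<le> e * norm (p - 0)"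
        using cs[OF p Ep(1)] cs0 by (simp add: sol(1)[OF tf w])
    qed
  qed
  \<comment> \<open>\<open>frechet_derivative\<close> selects some derivative within the hyperplane;
    on the hyperplane itself it must agree with the one just found.\<close>
  then have "(cs_map S \<phi> S t w has_derivative transversal_flow S \<phi> t w) (at 0 within transversal S w)"
    unfolding transversal_flow_def using frechet_derivative_works differentiableI by blast
  then show ?thesis
    using der subspace_transversal y by (rule has_derivative_within_subspace_unique)
qed

end

text \<open>Hyperbolicity in terms of \<open>tlin\<close>, with the unstable estimate in its
  backward, contracting form, as both halves of the fixed point argument need contractions.\<close>

locale hyperbolic_flow = uniform_flow +
  fixes C \<mu> :: real and Ts Tu :: "'a \<Rightarrow> 'a set"
  assumes C: "1 \<le> C" and \<mu>: "\<mu> < 0"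
    and splitting: "w \<in> \<Lambda> \<Longrightarrow> direct_sum (transversal S w) (Ts w) (Tu w)"
    and tlin_Ts: "w \<in> \<Lambda> \<Longrightarrow> x \<in> Ts w \<Longrightarrow> tlin t w x \<in> Ts (\<phi> t w)"
    and tlin_Tu: "w \<in> \<Lambda> \<Longrightarrow> x \<in> Tu w \<Longrightarrow> tlin t w x \<in> Tu (\<phi> t w)"
    and Ts_contr: "w \<in> \<Lambda> \<Longrightarrow> x \<in> Ts w \<Longrightarrow> 0 < t \<Longrightarrow> norm (tlin t w x) \<le> C * exp (\<mu> * t) * norm x"
    and Tu_contr: "w \<in> \<Lambda> \<Longrightarrow> x \<in> Tu w \<Longrightarrow> 0 < t \<Longrightarrow> norm (tlin (- t) w x) \<le> C * exp (\<mu> * t) * norm x"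

lemma (in uniform_flow) hyperbolic_flowI:
  assumes "hyperbolic_set S \<phi> \<Lambda>"
  shows "\<exists>C \<mu> Ts Tu. hyperbolic_flow S \<phi> \<Lambda> K m M C \<mu> Ts Tu"
proof -
  obtain C \<mu> Ts Tu where C: "C \<ge> 1" "\<mu> < 0"
    and split: "\<forall>w\<in>\<Lambda>. direct_sum (transversal S w) (Ts w) (Tu w)"
    and inv: "\<forall>w\<in>\<Lambda>. \<forall>t. transversal_flow S \<phi> t w ` Ts w = Ts (\<phi> t w) \<and>
                    transversal_flow S \<phi> t w ` Tu w = Tu (\<phi> t w)"
    and est: "\<forall>w\<in>\<Lambda>. \<forall>t0. \<forall>t>0.
           (\<forall>x\<in>Ts w. norm (transversal_flow S \<phi> (t0 + t) w x)
                       \<le> C * exp (\<mu> * t) * norm (transversal_flow S \<phi> t0 w x)) \<and>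
           (\<forall>x\<in>Tu w. norm (transversal_flow S \<phi> (t0 + t) w x)
                       \<ge> inverse C * exp (- \<mu> * t) * norm (transversal_flow S \<phi> t0 w x))"
    using assms unfolding hyperbolic_set_def by (elim conjE exE) rule
  have inv: "\<And>w t. w \<in> \<Lambda> \<Longrightarrow> transversal_flow S \<phi> t w ` Ts w = Ts (\<phi> t w)"
      "\<And>w t. w \<in> \<Lambda> \<Longrightarrow> transversal_flow S \<phi> t w ` Tu w = Tu (\<phi> t w)"
    using inv by blast+
  have est: "\<And>w t0 t x. w \<in> \<Lambda> \<Longrightarrow> t > 0 \<Longrightarrow> x \<in> Ts w \<Longrightarrow>
        norm (transversal_flow S \<phi> (t0 + t) w x) \<le> C * exp (\<mu> * t) * norm (transversal_flow S \<phi> t0 w x)"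
      "\<And>w t0 t x. w \<in> \<Lambda> \<Longrightarrow> t > 0 \<Longrightarrow> x \<in> Tu w \<Longrightarrow>
        norm (transversal_flow S \<phi> (t0 + t) w x) \<ge> inverse C * exp (- \<mu> * t) * norm (transversal_flow S \<phi> t0 w x)"
    using est by blast+
  \<comment> \<open>\<open>transversal_flow\<close> is meaningful only on transversal vectors, so
    membership must be settled before it is replaced by \<open>tlin\<close>.\<close>
  have sub: "x \<in> transversal S w" if "w \<in> \<Lambda>" "x \<in> Ts w \<or> x \<in> Tu w" for w x
  proof -
    have "0 \<in> Ts w" "0 \<in> Tu w" "{x + y |x y. x \<in> Ts w \<and> y \<in> Tu w} = transversal S w"
      using bspec[OF split that(1)] by (auto simp: direct_sum_def subspace_0)
    then show ?thesis using that(2) by (metis (mono_tags, lifting) add.left_neutral add.right_neutral mem_Collect_eq)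
  qed
  have "hyperbolic_flow S \<phi> \<Lambda> K m M C \<mu> Ts Tu"
  proof (unfold_locales, goal_cases)
    case (4 w x t)
    then show ?case using inv(1)[OF 4(1), of t] transversal_flow_eq_tlin[OF 4(1) sub] by (metis imageI)
  next
    case (5 w x t)
    then show ?case using inv(2)[OF 5(1), of t] transversal_flow_eq_tlin[OF 5(1) sub] by (metis imageI)
  next
    case (6 w x t)
    then show ?case
      using est(1)[of w t x 0] transversal_flow_eq_tlin[OF 6(1) sub] tlin_0 by simp
  next
    case (7 w x t)
    \<comment> \<open>Taking \<open>t0 = - t\<close> in the expansion estimate makes its left side
      the vector at time 0, which turns expansion into backward contraction.\<close>
    then have "inverse C * exp (- \<mu> * t) * norm (tlin (- t) w x) \<le> norm x"
      using est(2)[of w t x "- t"] transversal_flow_eq_tlin[OF 7(1) sub] tlin_0 by simp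
    then have "(C * exp (\<mu> * t)) * (inverse C * exp (- \<mu> * t) * norm (tlin (- t) w x)) \<le> (C * exp (\<mu> * t)) * norm x"
      using C by (intro mult_left_mono) auto
    moreover have "(C * exp (\<mu> * t)) * (inverse C * exp (- \<mu> * t) * norm (tlin (- t) w x)) = norm (tlin (- t) w x)"
      using C by (simp add: exp_minus field_simps)
    ultimately show ?case by (simp only:)
  qed (use C split in auto)
  then show ?thesis by blast
qed

subsection \<open>Bounded solutions along hyperbolic orbits\<close>

context hyperbolic_flow
begin

lemma contraction_time:
  assumes "0 < \<epsilon>"
  shows "\<exists>t>0. C * exp (\<mu> * t) \<le> \<epsilon>"
proof (intro exI conjI)
  let ?t = "max 1 (ln (\<epsilon> / C) / \<mu>)"
  show "0 < ?t" by simp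
  have "\<mu> * ?t \<le> \<mu> * (ln (\<epsilon> / C) / \<mu>)"
    using \<mu> by (intro mult_left_mono_neg) auto
  also have "\<dots> = ln (\<epsilon> / C)" using \<mu> by simp
  finally have "exp (\<mu> * ?t) \<le> exp (ln (\<epsilon> / C))" by simp
  also have "\<dots> = \<epsilon> / C" using assms C by simp
  finally show "C * exp (\<mu> * ?t) \<le> \<epsilon>" using C by (simp add: pos_le_divide_eq mult.commute)
qed

lemma tlin_inverse: "w \<in> \<Lambda> \<Longrightarrow> tlin (- t) (\<phi> t w) (tlin t w x) = x"
  using tlin_add[of w "- t" t x] tlin_0 by simp

lemma subspace_T: "w \<in> \<Lambda> \<Longrightarrow> subspace (Ts w)" "w \<in> \<Lambda> \<Longrightarrow> subspace (Tu w)"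
  using splitting by (auto simp: direct_sum_def)

text \<open>The uniform angle comes from the dynamics. If z = x + y is small, the images of x and y
  after time t nearly cancel; but the image of x has at most half the size of x, and that of y at
  least twice the size of y.\<close>

lemma splitting_angle:
  "\<exists>c\<ge>1. \<forall>w\<in>\<Lambda>. \<forall>x\<in>Ts w. \<forall>y\<in>Tu w. norm x \<le> c * norm (x + y) \<and> norm y \<le> c * norm (x + y)"
proof -
  obtain t where t: "0 < t" "C * exp (\<mu> * t) \<le> 1 / 2" using contraction_time[of "1/2"] by auto
  define E where "E = 2 * exp (4 * K * \<bar>t\<bar>)"
  have E: "0 < E" by (simp add: E_def)
  have "norm x \<le> (E + 2) * norm (x + y) \<and> norm y \<le> (E + 2) * norm (x + y)"
    if w: "w \<in> \<Lambda>" and x: "x \<in> Ts w" and y: "y \<in> Tu w" for w x y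
  proof -
    let ?z = "x + y" and ?\<theta> = "C * exp (\<mu> * t)"
    have "norm y = norm (tlin (- t) (\<phi> t w) (tlin t w y))" using tlin_inverse[OF w] by simp
    also have "\<dots> \<le> ?\<theta> * norm (tlin t w y)"
      using Tu_contr[OF \<phi>_in[OF w] tlin_Tu[OF w y] t(1)] .
    also have "\<dots> \<le> 1 / 2 * norm (tlin t w y)" using t(2) by (rule mult_right_mono) simp
    also have "norm (tlin t w y) \<le> norm (tlin t w ?z) + norm (tlin t w x)"
      using norm_triangle_ineq4[of "tlin t w ?z" "tlin t w x"] by (simp add: linear_add[OF linear_tlin[OF w]])
    also have "\<dots> \<le> E * norm ?z + 1 / 2 * norm x"
    proof (rule add_mono)
      show "norm (tlin t w ?z) \<le> E * norm ?z" using tlin_bound[OF w] by (simp add: E_def)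
      show "norm (tlin t w x) \<le> 1 / 2 * norm x"
        using Ts_contr[OF w x t(1)] mult_right_mono[OF t(2), of "norm x"] by simp
    qed
    finally have 1: "norm y \<le> 1 / 2 * (E * norm ?z + 1 / 2 * norm x)" by simp
    have 2: "norm x \<le> norm ?z + norm y" using norm_triangle_ineq4[of ?z y] by simp
    have "0 \<le> E * norm ?z" using E by simp
    moreover from 1 have "4 * norm y \<le> 2 * (E * norm ?z) + norm x" by (simp add: field_simps)
    ultimately show ?thesis
      using 2 norm_ge_zero[of y] norm_ge_zero[of ?z] unfolding distrib_right by (intro conjI; linarith)
  qed
  then show ?thesis using E by (intro exI[of _ "E + 2"]) auto
qed

section \<open>Sampling at multiples of T and the return to continuous time\<close>

abbreviation pt :: "real \<Rightarrow> 'a \<Rightarrow> int \<Rightarrow> 'a" where "pt T w k \<equiv> \<phi> (real_of_int k * T) w"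

lemma pt_Suc: "pt T w (k + 1) = \<phi> T (pt T w k)"
  by (simp add: distrib_right add.commute flip: \<phi>_add)

lemma pt_back: "\<phi> (- T) (pt T w (k + 1)) = pt T w k"
  by (simp add: distrib_right flip: \<phi>_add)

text \<open>Here \<eta> is a relative error in continuous time, and \<open>\<eta> * apx T\<close> is
  what \<open>tlin_approx\<close> makes of it over one sampling step. All three constants are fixed
  before V is chosen.\<close>

definition dichotomy :: "real \<Rightarrow> real \<Rightarrow> real \<Rightarrow> bool" where
  "dichotomy T c \<eta> \<longleftrightarrow> 0 < T \<and> 0 < c \<and> 0 < \<eta> \<and> \<eta> \<le> 1 \<and>
    (\<forall>w\<in>\<Lambda>. discrete_dichotomy (\<lambda>k. Ts (pt T w k)) (\<lambda>k. Tu (pt T w k))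
       (\<lambda>k. tlin T (pt T w k)) (\<lambda>k. tlin (- T) (pt T w (k + 1))) (C * exp (\<mu> * T)) c (\<eta> * apx T))"

lemma dichotomy_exists: "\<exists>T c \<eta>. dichotomy T c \<eta>"
proof -
  obtain c where c: "c \<ge> 1"
    and angle: "\<forall>w\<in>\<Lambda>. \<forall>x\<in>Ts w. \<forall>y\<in>Tu w. norm x \<le> c * norm (x + y) \<and> norm y \<le> c * norm (x + y)"
    using splitting_angle by blast
  \<comment> \<open>The angle constant c was obtained with a contraction time of its own, so T may
    be chosen depending on c.\<close>
  obtain T where T: "0 < T" "C * exp (\<mu> * T) \<le> 1 / (8 * c)"
    using contraction_time[of "1 / (8 * c)"] c by auto
  have apx: "0 \<le> apx T" by (simp add: apx_def)
  \<comment> \<open>Makes \<open>c * (\<eta> * apx T)\<close> at most 1/8; the added 1 also ensures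
    \<eta> at most 1.\<close>
  define \<eta> where "\<eta> = 1 / (8 * c * (apx T + 1))"
  have \<eta>: "0 < \<eta>" using c apx by (simp add: \<eta>_def)
  have "1 * 1 \<le> (8 * c) * (apx T + 1)" using c apx by (intro mult_mono) auto
  then have \<eta>1: "\<eta> \<le> 1" using c apx by (simp add: \<eta>_def)
  have "c * (\<eta> * apx T) \<le> c * (\<eta> * (apx T + 1))" using c \<eta> by (intro mult_left_mono) auto
  also have "\<dots> = 1 / 8" using c apx by (simp add: \<eta>_def)
  finally have c\<eta>: "c * (\<eta> * apx T) \<le> 1 / 8" .
  have c\<theta>: "c * (C * exp (\<mu> * T)) \<le> 1 / 8"
    using mult_left_mono[OF T(2), of c] c by simp
  have "1 / (8 * c) \<le> 1 / 1" using c by (intro divide_left_mono) auto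
  then have \<theta>1: "C * exp (\<mu> * T) \<le> 1" using T(2) by simp
  have "discrete_dichotomy (\<lambda>k. Ts (pt T w k)) (\<lambda>k. Tu (pt T w k))
       (\<lambda>k. tlin T (pt T w k)) (\<lambda>k. tlin (- T) (pt T w (k + 1))) (C * exp (\<mu> * T)) c (\<eta> * apx T)"
    if w: "w \<in> \<Lambda>" for w
  proof (rule discrete_dichotomy.intro)
    fix k x
    note in\<Lambda> = \<phi>_in[OF w]
    show "subspace (Ts (pt T w k))" "subspace (Tu (pt T w k))"
      using subspace_T in\<Lambda> by blast+
    show "linear (tlin T (pt T w k))" "linear (tlin (- T) (pt T w (k + 1)))"
      using linear_tlin in\<Lambda> by blast+
    show "tlin T (pt T w k) x \<in> Ts (pt T w (k + 1))" "norm (tlin T (pt T w k) x) \<le> C * exp (\<mu> * T) * norm x"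
      if "x \<in> Ts (pt T w k)"
      unfolding pt_Suc using tlin_Ts[OF in\<Lambda> that] Ts_contr[OF in\<Lambda> that T(1)] by blast+
    show "tlin T (pt T w k) x \<in> Tu (pt T w (k + 1))" "tlin (- T) (pt T w (k + 1)) (tlin T (pt T w k) x) = x"
      if "x \<in> Tu (pt T w k)"
      unfolding pt_Suc using tlin_Tu[OF in\<Lambda> that] tlin_inverse[OF in\<Lambda>] by blast+
    show "tlin (- T) (pt T w (k + 1)) x \<in> Tu (pt T w k)"
      "norm (tlin (- T) (pt T w (k + 1)) x) \<le> C * exp (\<mu> * T) * norm x"
      "tlin T (pt T w k) (tlin (- T) (pt T w (k + 1)) x) = x"
      if "x \<in> Tu (pt T w (k + 1))"
      using tlin_Tu[OF in\<Lambda> that, of "- T"] Tu_contr[OF in\<Lambda> that T(1)]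
        tlin_inverse[OF in\<Lambda>[of "real_of_int (k + 1) * T"], of "- T" x]
      unfolding pt_back by (simp_all only: minus_minus)
    show "norm x \<le> c * norm (x + y) \<and> norm y \<le> c * norm (x + y)"
      if "x \<in> Ts (pt T w k)" "y \<in> Tu (pt T w k)" for y
      using angle in\<Lambda> that by blast
  qed (use C c \<eta> apx c\<eta> c\<theta> \<theta>1 in auto)
  then have "dichotomy T c \<eta>" using T(1) c \<eta> \<eta>1 by (simp add: dichotomy_def)
  then show ?thesis by blast
qed

context
  fixes T c \<eta>0 assumes dich: "dichotomy T c \<eta>0"
begin

lemma T: "0 < T" and c: "0 < c" and \<eta>0: "0 < \<eta>0" "\<eta>0 \<le> 1"
  using dich by (auto simp: dichotomy_def)

lemma discrete: "w \<in> \<Lambda> \<Longrightarrow> discrete_dichotomy (\<lambda>k. Ts (pt T w k)) (\<lambda>k. Tu (pt T w k))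
       (\<lambda>k. tlin T (pt T w k)) (\<lambda>k. tlin (- T) (pt T w (k + 1))) (C * exp (\<mu> * T)) c (\<eta>0 * apx T)"
  using dich by (auto simp: dichotomy_def)

lemma discrete_E:
  "w \<in> \<Lambda> \<Longrightarrow> discrete_dichotomy.E (\<lambda>k. Ts (pt T w k)) (\<lambda>k. Tu (pt T w k)) k = transversal S (pt T w k)"
  using splitting[OF \<phi>_in] discrete_dichotomy.E_def[OF discrete] by (simp add: direct_sum_def)

text \<open>Expansivity in continuous time. It is applied to the difference of two solutions over
  one orbit, which gives uniqueness, and to the projected difference of two orbits, which gives
  injectivity.\<close>

lemma bounded_almost_solution_eq_0:
  assumes w: "w \<in> \<Lambda>" and e: "\<And>s. (e has_vector_derivative e' s) (at s)"
    and tr: "\<And>s. e s \<in> transversal S (\<phi> s w)" and bnd: "\<And>s. norm (e s) \<le> D"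
    and err: "\<And>s. norm (e' s - lin (\<phi> s w) (e s)) \<le> \<eta>0 * norm (e s)"
  shows "e 0 = 0"
proof -
  interpret dd: discrete_dichotomy "\<lambda>k. Ts (pt T w k)" "\<lambda>k. Tu (pt T w k)"
    "\<lambda>k. tlin T (pt T w k)" "\<lambda>k. tlin (- T) (pt T w (k + 1))" "C * exp (\<mu> * T)" c "\<eta>0 * apx T"
    by (rule discrete[OF w])
  define d where "d k = e (real_of_int k * T)" for k
  have "d 0 = 0"
  proof (rule dd.bounded_almost_orbit_eq_0)
    fix k
    show "d k \<in> dd.E k" using tr by (simp add: discrete_E[OF w] d_def)
    show "norm (d k) \<le> D" by (simp add: d_def bnd)
    have "norm ((\<lambda>s. e (s + real_of_int k * T)) T - tlin T (pt T w k) ((\<lambda>s. e (s + real_of_int k * T)) 0))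
        \<le> \<eta>0 * apx T * norm ((\<lambda>s. e (s + real_of_int k * T)) 0)"
    proof (rule tlin_approx[OF \<phi>_in[OF w]])
      show "((\<lambda>s. e (s + real_of_int k * T)) has_vector_derivative e' (s + real_of_int k * T)) (at s)" for s
        by (rule has_vector_derivative_shift[OF e])
      show "norm (e' (s + real_of_int k * T) - lin (\<phi> s (pt T w k)) (e (s + real_of_int k * T)))
         \<le> \<eta>0 * norm (e (s + real_of_int k * T))" for s
        using err[of "s + real_of_int k * T"] by (simp add: \<phi>_add)
    qed (use \<eta>0 in auto)
    then show "norm (d (k + 1) - tlin T (pt T w k) (d k)) \<le> \<eta>0 * apx T * norm (d k)"
      by (simp add: d_def distrib_right add.commute)
  qed
  then show ?thesis by (simp add: d_def)
qed

text \<open>Amplitude of the bounded response to forcing of size \<delta>: the sampled orbit is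
  bounded by 4 c times the displacement of 0 after time T, and the outer factor accounts for the
  growth between two samples.\<close>

definition bd :: real where
  "bd = 2 * (4 * c * (4 * T * exp (2 * (2 * K + 1) * T)) + 2 * T) * exp (2 * (2 * K + 1) * T)"

lemma bd_nonneg: "0 \<le> bd"
  using T c by (simp add: bd_def)

lemma bounded_solution_exists:
  assumes \<eta>: "0 < \<eta>" "\<eta> \<le> 1 / 2" "\<eta> \<le> \<eta>0" and \<rho>: "0 < \<rho>" and V: "good \<eta> \<rho> V"
    and near: "\<And>w. w \<in> \<Lambda> \<Longrightarrow> norm (V w - S w) \<le> \<delta>" and \<delta>: "0 \<le> \<delta>" and w: "w \<in> \<Lambda>"
  shows "\<exists>p\<in>transversal S w. \<forall>s. norm (sol (fld \<rho> V) w p s) \<le> bd * \<delta>"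
proof -
  interpret dd: discrete_dichotomy "\<lambda>k. Ts (pt T w k)" "\<lambda>k. Tu (pt T w k)"
    "\<lambda>k. tlin T (pt T w k)" "\<lambda>k. tlin (- T) (pt T w (k + 1))" "C * exp (\<mu> * T)" c "\<eta>0 * apx T"
    by (rule discrete[OF w])
  have tf: "tangent_field (2 * K + \<eta>) (2 * \<delta>) (fld \<rho> V)"
    by (rule tangent_field_fld[OF \<eta>(1,2) \<rho> V near \<delta>])
  let ?X = "sol (fld \<rho> V)"
  let ?e = "exp (2 * (2 * K + 1) * T)"
  have X_le: "norm (?X v p r) \<le> 2 * (norm p + 2 * \<delta> * T) * ?e" if v: "v \<in> \<Lambda>" and r: "0 \<le> r" "r \<le> T" for v p r
  proof -
    have "norm (?X v p r) \<le> 2 * (norm p + 2 * \<delta> * \<bar>r\<bar>) * exp (2 * (2 * K + \<eta>) * \<bar>r\<bar>)"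
      by (rule sol_bound[OF tf v])
    also have "\<dots> \<le> 2 * (norm p + 2 * \<delta> * T) * ?e"
    proof (rule mult_mono)
      show "2 * (norm p + 2 * \<delta> * \<bar>r\<bar>) \<le> 2 * (norm p + 2 * \<delta> * T)"
        using \<delta> r by (intro mult_left_mono add_left_mono) auto
      have "2 * (2 * K + \<eta>) * \<bar>r\<bar> \<le> 2 * (2 * K + 1) * T"
        using r K(1) \<eta> by (intro mult_mono) auto
      then show "exp (2 * (2 * K + \<eta>) * \<bar>r\<bar>) \<le> ?e" by simp
    qed (use \<delta> T in auto)
    finally show ?thesis .
  qed
  \<comment> \<open>The nonlinear part of the time-T map. Its Lipschitz constant comes from
    \<open>tlin_approx\<close> for the difference of two solutions, its value at 0 from the forcing
    alone.\<close>
  define g where "g k x = ?X (pt T w k) x T - tlin T (pt T w k) x" for k x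
  note in\<Lambda> = \<phi>_in[OF w]
  obtain x where x: "\<And>k. x k \<in> dd.E k" "\<And>k. x (k + 1) = tlin T (pt T w k) (x k) + g k (x k)"
    and x_le: "\<And>k. norm (x k) \<le> 4 * c * (4 * \<delta> * T * ?e)"
  proof (rule dd.bounded_orbit_exists)
    show "g k x \<in> dd.E (k + 1)" if "x \<in> dd.E k" for k x
    proof -
      have "x \<in> transversal S (pt T w k)" using that by (simp add: discrete_E[OF w])
      then have "?X (pt T w k) x T \<in> transversal S (\<phi> T (pt T w k))" "tlin T (pt T w k) x \<in> transversal S (\<phi> T (pt T w k))"
        using sol_transversal[OF tf in\<Lambda>] tlin_transversal[OF in\<Lambda>] by blast+
      then show ?thesis
        unfolding g_def discrete_E[OF w] pt_Suc by (rule subspace_diff[OF subspace_transversal])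
    qed
    show "norm (g k x - g k y) \<le> \<eta>0 * apx T * norm (x - y)" for k x y
    proof -
      let ?v = "pt T w k"
      have "norm ((?X ?v x T - ?X ?v y T) - tlin T ?v (?X ?v x 0 - ?X ?v y 0)) \<le> \<eta>0 * apx T * norm (?X ?v x 0 - ?X ?v y 0)"
      proof (rule tlin_approx[OF in\<Lambda>])
        show "((\<lambda>s. ?X ?v x s - ?X ?v y s) has_vector_derivative
            fld \<rho> V (\<phi> s ?v) (?X ?v x s) - fld \<rho> V (\<phi> s ?v) (?X ?v y s)) (at s)" for s
          by (intro has_vector_derivative_diff sol(2)[OF tf in\<Lambda>])
        fix s
        let ?t = "closest_point (cball 0 \<rho>)"
        have "norm (rem V (\<phi> s ?v) (?t (?X ?v x s)) - rem V (\<phi> s ?v) (?t (?X ?v y s))) \<le>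
            \<eta> * norm (?t (?X ?v x s) - ?t (?X ?v y s))"
          using good_V(5)[OF \<eta>(1,2) \<rho> V \<phi>_in[OF in\<Lambda>]] trunc_in[OF \<eta>(1,2) \<rho> V] by blast
        also have "\<dots> \<le> \<eta>0 * norm (?X ?v x s - ?X ?v y s)"
          using trunc_lipschitz[OF \<eta>(1,2) \<rho> V] \<eta> by (intro mult_mono) auto
        finally show "norm (fld \<rho> V (\<phi> s ?v) (?X ?v x s) - fld \<rho> V (\<phi> s ?v) (?X ?v y s) -
            lin (\<phi> s ?v) (?X ?v x s - ?X ?v y s)) \<le> \<eta>0 * norm (?X ?v x s - ?X ?v y s)"
          by (simp add: fld_def linear_diff[OF linear_lin])
      qed (use \<eta>0 in auto)
      then show ?thesis
        by (simp add: g_def sol(1)[OF tf in\<Lambda>] linear_diff[OF linear_tlin[OF in\<Lambda>]] algebra_simps)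
    qed
    show "norm (g k 0) \<le> 4 * \<delta> * T * ?e" for k
      using X_le[OF in\<Lambda>[of "real_of_int k * T"], of T 0] T linear_0[OF linear_tlin[OF in\<Lambda>]] by (simp add: g_def)
    fix y assume "\<And>k. y k \<in> dd.E k" "\<And>k. y (k + 1) = tlin T (pt T w k) (y k) + g k (y k)"
      "\<And>k. norm (y k) \<le> 4 * c * (4 * \<delta> * T * ?e)"
    then show thesis by (rule that)
  qed
  let ?Y = "?X w (x 0)"
  have step: "x (k + 1) = ?X (pt T w k) (x k) T" for k using x(2) by (simp add: g_def)
  have Y: "?Y (real_of_int k * T) = x k" for k
  proof (induction k rule: int_induct[where k = 0])
    case base
    then show ?case by (simp add: sol(1)[OF tf w])
  next
    case (step1 k)
    have "?Y (real_of_int (k + 1) * T) = ?Y (T + real_of_int k * T)" by (simp add: algebra_simps)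
    also have "\<dots> = ?X (pt T w k) (x k) T" using sol_add[OF tf w] step1 by simp
    finally show ?case using step by simp
  next
    case (step2 k)
    \<comment> \<open>Backward step: \<open>x k\<close> arises from \<open>x (k - 1)\<close> by
      running for time T, so running for time - T leads back to it.\<close>
    have k: "x k = ?X (pt T w (k - 1)) (x (k - 1)) T" "pt T w k = \<phi> T (pt T w (k - 1))"
      using step[of "k - 1"] pt_Suc[of "k - 1" T w] by simp_all
    have "?Y (real_of_int (k - 1) * T) = ?Y (- T + real_of_int k * T)" by (simp add: algebra_simps)
    also have "\<dots> = ?X (pt T w k) (x k) (- T)"
      using sol_add[OF tf w, of "x 0" "- T" "real_of_int k * T"] unfolding step2(2) .
    also have "\<dots> = ?X (pt T w (k - 1)) (x (k - 1)) (- T + T)"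
      unfolding k by (rule sol_add[OF tf in\<Lambda>, symmetric])
    finally show ?case by (simp add: sol(1)[OF tf in\<Lambda>])
  qed
  have "norm (?Y s) \<le> bd * \<delta>" for s
  proof -
    \<comment> \<open>The last sample before s; the remaining time lies between 0 and T, where
      \<open>X_le\<close> applies.\<close>
    define k where "k = \<lfloor>s / T\<rfloor>"
    define r where "r = s - real_of_int k * T"
    have "real_of_int k \<le> s / T" "s / T < real_of_int k + 1" by (auto simp: k_def)
    then have r: "0 \<le> r" "r \<le> T" using T by (auto simp: r_def pos_le_divide_eq pos_divide_less_eq algebra_simps)
    have "?Y s = ?Y (r + real_of_int k * T)" by (simp add: r_def)
    also have "\<dots> = ?X (pt T w k) (x k) r" using sol_add[OF tf w] Y by simp
    also have "norm \<dots> \<le> 2 * (norm (x k) + 2 * \<delta> * T) * ?e" by (rule X_le[OF in\<Lambda> r])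
    also have "\<dots> \<le> 2 * (4 * c * (4 * \<delta> * T * ?e) + 2 * \<delta> * T) * ?e"
      using x_le by (intro mult_right_mono mult_left_mono add_right_mono) auto
    also have "\<dots> = bd * \<delta>" by (simp add: bd_def algebra_simps)
    finally show ?thesis .
  qed
  moreover have "x 0 \<in> transversal S w" using x(1)[of 0] by (simp add: discrete_E[OF w])
  ultimately show ?thesis by blast
qed

end

end

subsection \<open>The shadowing homeomorphism\<close>

context hyperbolic_flow
begin

text \<open>Origin of the constraints: \<open>\<eta> \<le> m / 4\<close> serves the first hits; the
  factor 10 + 8 K arises in the injectivity estimate; \<open>2 * r \<le> \<rho>\<close> because two
  displacements of size r are subtracted there; \<open>(K + 1) * r \<le> m / 2\<close> makes the
  tangential part of that difference at most half of it; and
  \<open>bd T c * \<delta> \<le> r\<close> keeps the bounded solution where the truncation is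
  inactive.\<close>

context
  fixes T c \<eta>0 \<eta> \<rho> r \<delta> :: real and V :: "'a \<Rightarrow> 'a"
  assumes dich: "dichotomy T c \<eta>0"
    and \<eta>: "0 < \<eta>" "\<eta> \<le> 1 / 2" and \<eta>m: "\<eta> \<le> m / 4" and \<eta>\<eta>0: "(10 + 8 * K) * \<eta> \<le> \<eta>0"
    and \<rho>: "0 < \<rho>" and V: "good \<eta> \<rho> V"
    and S_lin: "\<And>w x. w \<in> \<Lambda> \<Longrightarrow> norm x \<le> \<rho> \<Longrightarrow> norm (S (w + x) - S w - vf_deriv S w x) \<le> \<eta> * norm x"
    and r: "0 < r" "2 * r \<le> \<rho>" "(K + 1) * r \<le> m / 2"
    and near: "\<And>w. w \<in> \<Lambda> \<Longrightarrow> norm (V w - S w) \<le> \<delta>" and \<delta>: "0 \<le> \<delta>" "bd T c * \<delta> \<le> r"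
begin

abbreviation X :: "'a \<Rightarrow> 'a \<Rightarrow> real \<Rightarrow> 'a" where "X \<equiv> sol (fld \<rho> V)"

lemma tf: "tangent_field (2 * K + \<eta>) (2 * \<delta>) (fld \<rho> V)"
  by (rule tangent_field_fld[OF \<eta> \<rho> V near \<delta>(1)])

lemma V_C1': "C1_field V" using V by (simp add: good_def)

lemma \<eta>_le: "\<eta> \<le> \<eta>0"
proof -
  have "1 * \<eta> \<le> (10 + 8 * K) * \<eta>" using \<eta>(1) K(1) by (intro mult_right_mono) auto
  then show ?thesis using \<eta>\<eta>0 by simp
qed

definition xi :: "'a \<Rightarrow> 'a" where
  "xi w = (SOME p. p \<in> transversal S w \<and> (\<forall>s. norm (X w p s) \<le> r))"

lemma xi:
  assumes w: "w \<in> \<Lambda>"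
  shows "xi w \<in> transversal S w" "norm (X w (xi w) s) \<le> r" "norm (xi w) \<le> r"
proof -
  obtain p where p: "p \<in> transversal S w" "\<And>s. norm (X w p s) \<le> bd T c * \<delta>"
    using bounded_solution_exists[OF dich \<eta> \<eta>_le \<rho> V near \<delta>(1) w] by auto
  then have "p \<in> transversal S w \<and> (\<forall>s. norm (X w p s) \<le> r)"
    using order_trans[OF p(2) \<delta>(2)] by auto
  then have *: "xi w \<in> transversal S w \<and> (\<forall>s. norm (X w (xi w) s) \<le> r)"
    unfolding xi_def by (rule someI)
  then show "xi w \<in> transversal S w" "norm (X w (xi w) s) \<le> r" by blast+
  show "norm (xi w) \<le> r" using *[THEN conjunct2, THEN spec, of 0] by (simp add: sol(1)[OF tf w])
qed

text \<open>Truncation is nonexpansive, so the difference of any two solutions is an almost-solution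
  of the linear equation. Hence any finite bound D suffices, however large.\<close>

lemma xi_unique:
  assumes w: "w \<in> \<Lambda>" and p: "p \<in> transversal S w" "\<And>s. norm (X w p s) \<le> D"
  shows "p = xi w"
proof -
  let ?t = "closest_point (cball 0 \<rho>)"
  have "(\<lambda>s. X w p s - X w (xi w) s) 0 = 0"
  proof (rule bounded_almost_solution_eq_0[OF dich w])
    show "((\<lambda>s. X w p s - X w (xi w) s) has_vector_derivative
        fld \<rho> V (\<phi> s w) (X w p s) - fld \<rho> V (\<phi> s w) (X w (xi w) s)) (at s)" for s
      by (intro has_vector_derivative_diff sol(2)[OF tf w])
    show "X w p s - X w (xi w) s \<in> transversal S (\<phi> s w)" for s
      using sol_transversal[OF tf w] p(1) xi(1)[OF w] by (intro subspace_diff[OF subspace_transversal])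
    show "norm (X w p s - X w (xi w) s) \<le> D + r" for s
      using p(2) xi(2)[OF w] by (intro norm_triangle_le_diff add_mono)
    fix s
    have "norm (rem V (\<phi> s w) (?t (X w p s)) - rem V (\<phi> s w) (?t (X w (xi w) s))) \<le>
        \<eta> * norm (?t (X w p s) - ?t (X w (xi w) s))"
      using good_V(5)[OF \<eta> \<rho> V \<phi>_in[OF w]] trunc_in[OF \<eta> \<rho> V] by blast
    also have "\<dots> \<le> \<eta>0 * norm (X w p s - X w (xi w) s)"
      using trunc_lipschitz[OF \<eta> \<rho> V] \<eta> \<eta>_le by (intro mult_mono) auto
    finally show "norm (fld \<rho> V (\<phi> s w) (X w p s) - fld \<rho> V (\<phi> s w) (X w (xi w) s) -
        lin (\<phi> s w) (X w p s - X w (xi w) s)) \<le> \<eta>0 * norm (X w p s - X w (xi w) s)"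
      by (simp add: fld_def linear_diff[OF linear_lin])
  qed
  then show ?thesis by (simp add: sol(1)[OF tf w])
qed

text \<open>The time shift of a bounded solution is a bounded solution over the shifted base point;
  uniqueness gives equivariance.\<close>

lemma xi_\<phi>: assumes w: "w \<in> \<Lambda>" shows "xi (\<phi> t w) = X w (xi w) t"
proof (rule xi_unique[symmetric])
  show "\<phi> t w \<in> \<Lambda>" using w by simp
  show "X w (xi w) t \<in> transversal S (\<phi> t w)" by (rule sol_transversal[OF tf w xi(1)[OF w]])
  show "norm (X (\<phi> t w) (X w (xi w) t) s) \<le> r" for s
    using sol_add[OF tf w, of "xi w" s t] xi(2)[OF w, of "s + t"] by simp
qed

section \<open>The map \<open>H\<close>, its orbits and its topology\<close>

definition H :: "'a \<Rightarrow> 'a" where "H w = w + xi w"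

lemma H_\<phi>: "w \<in> \<Lambda> \<Longrightarrow> H (\<phi> t w) = \<phi> t w + X w (xi w) t"
  by (simp add: H_def xi_\<phi>)

lemma X_le_\<rho>: "w \<in> \<Lambda> \<Longrightarrow> norm (X w (xi w) s) \<le> \<rho>"
  using xi(2)[of w s] r by simp

lemma H_dist: "w \<in> \<Lambda> \<Longrightarrow> norm (H w - w) \<le> r"
  using xi(3) by (simp add: H_def)

lemma H_cross_section: "w \<in> \<Lambda> \<Longrightarrow> H w \<in> cross_section S w"
  using xi(1) by (simp add: H_def cross_section_def transversal_def)

lemma H_cs_flow: assumes w: "w \<in> \<Lambda>" shows "cs_flow S \<phi> V t w (H w) (H (\<phi> t w))"
  using traj_cs_flow[OF \<eta> \<rho> V \<eta>m w xi(1)[OF w] X_le_\<rho>[OF w]] by (simp add: H_\<phi>[OF w] H_def[of w])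

text \<open>\<tau> converts base time into the time of V, and \<theta> converts back. Since \<theta>
  is defined for all t, the orbit of V through \<open>H w\<close> is complete although V need not
  be.\<close>

lemma H_orbit:
  assumes w: "w \<in> \<Lambda>"
  shows "\<exists>\<tau> \<theta>. \<tau> 0 = 0 \<and> (\<forall>s. \<theta> (\<tau> s) = s) \<and> (\<forall>t. \<tau> (\<theta> t) = t) \<and>
    (\<forall>s. (\<tau> has_real_derivative speed V (\<phi> s w) (xi (\<phi> s w))) (at s)) \<and>
    (\<forall>s. (\<theta> has_real_derivative inverse (speed V (\<phi> s w) (xi (\<phi> s w)))) (at (\<tau> s))) \<and>
    (\<forall>t. ((\<lambda>t. H (\<phi> (\<theta> t) w)) has_vector_derivative V (H (\<phi> (\<theta> t) w))) (at t))"
proof -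
  have tr: "closest_point (cball 0 \<rho>) (X w (xi w) s) = xi (\<phi> s w)" for s
    using X_le_\<rho>[OF w] by (simp add: closest_point_self xi_\<phi>[OF w])
  obtain \<tau> \<theta> where *: "\<tau> 0 = 0"
    "\<forall>s. (\<tau> has_real_derivative speed V (\<phi> s w) (xi (\<phi> s w))) (at s)"
    "\<forall>s. (\<theta> has_real_derivative inverse (speed V (\<phi> s w) (xi (\<phi> s w)))) (at (\<tau> s))"
    "\<forall>s. \<theta> (\<tau> s) = s" "\<forall>t. \<tau> (\<theta> t) = t"
    "\<forall>s. norm (X w (xi w) s) \<le> \<rho> \<longrightarrow> ((\<lambda>t. H (\<phi> (\<theta> t) w)) has_vector_derivative V (H (\<phi> s w))) (at (\<tau> s))"
    using traj_reparam[OF \<eta> \<rho> V w, of "xi w"] unfolding tr H_\<phi>[OF w] by blast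
  have "((\<lambda>t. H (\<phi> (\<theta> t) w)) has_vector_derivative V (H (\<phi> (\<theta> t) w))) (at t)" for t
    using *(6)[rule_format, OF X_le_\<rho>[OF w], of "\<theta> t"] *(5) by simp
  then show ?thesis using * by blast
qed

text \<open>The curve from \<open>H_orbit\<close> is the orbit of V for all times, by uniqueness.
  The second inclusion shows that the image of \<Lambda> contains whole orbits of V.\<close>

lemma H_orbit_eq:
  assumes w: "w \<in> \<Lambda>"
  shows "H ` orbit S w \<subseteq> orbit V (H w)" "orbit V (H w) \<subseteq> H ` \<Lambda>"
proof -
  obtain \<tau> \<theta> where \<tau>: "\<tau> 0 = (0::real)" "\<And>s. \<theta> (\<tau> s) = s"
    and u: "\<And>t. ((\<lambda>t. H (\<phi> (\<theta> t) w)) has_vector_derivative V (H (\<phi> (\<theta> t) w))) (at t)"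
    using H_orbit[OF w] by blast
  have \<theta>0: "\<theta> 0 = 0" using \<tau>(2)[of 0] \<tau>(1) by simp
  have lf: "local_flow V t (H w) (H (\<phi> (\<theta> t) w))" for t
    by (rule local_flowI[where u = "\<lambda>t. H (\<phi> (\<theta> t) w)"])
       (use \<theta>0 has_vector_derivative_at_within[OF u] in auto)
  show "H ` orbit S w \<subseteq> orbit V (H w)"
  proof clarify
    fix q assume "q \<in> orbit S w"
    then obtain t where "local_flow S t w q" by (auto simp: orbit_def)
    then have "q = \<phi> t w" using local_flow_unique[OF S] local_flow_\<phi> by blast
    then show "H q \<in> orbit V (H w)" using lf[of "\<tau> t"] \<tau>(2) by (auto simp: orbit_def)
  qed
  show "orbit V (H w) \<subseteq> H ` \<Lambda>"
  proof
    fix q assume "q \<in> orbit V (H w)"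
    then obtain t where "local_flow V t (H w) q" by (auto simp: orbit_def)
    then have "q = H (\<phi> (\<theta> t) w)" using local_flow_unique[OF V_C1'] lf by blast
    then show "q \<in> H ` \<Lambda>" using w by simp
  qed
qed

text \<open>Closed graph with compact target: a limit of solutions bounded by r is again bounded by
  r, and uniqueness identifies its initial value. So uniqueness alone yields continuity.\<close>

lemma continuous_xi: "continuous_on \<Lambda> xi"
proof (rule continuous_from_closed_graph[where T = "cball 0 r"])
  show "compact (cball (0::'a) r)" by simp
  show "xi \<in> \<Lambda> \<rightarrow> cball 0 r" using xi(3) by auto
  show "closed ((\<lambda>w. (w, xi w)) ` \<Lambda>)"
    unfolding closed_sequential_limits
  proof (intro allI impI, elim conjE)
    fix z l assume z: "\<forall>n. z n \<in> (\<lambda>w. (w, xi w)) ` \<Lambda>" and lim: "z \<longlonglongrightarrow> l"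
    define v where "v n = fst (z n)" for n
    have v: "v n \<in> \<Lambda>" "snd (z n) = xi (v n)" for n using z[rule_format, of n] by (auto simp: v_def)
    define w where "w = fst l"
    define q where "q = snd l"
    have vw: "v \<longlonglongrightarrow> w" using tendsto_fst[OF lim] by (simp add: v_def[abs_def] w_def)
    have vq: "(\<lambda>n. xi (v n)) \<longlonglongrightarrow> q" using tendsto_snd[OF lim] by (simp add: v(2) q_def)
    have w: "w \<in> \<Lambda>" using closed_sequentially[OF \<Lambda>_closed v(1) vw] .
    have "(\<lambda>n. S (v n) \<bullet> xi (v n)) \<longlonglongrightarrow> S w \<bullet> q"
      using continuous_on_tendsto_compose[OF C1_field_continuous[OF S, of UNIV] vw]
      by (intro tendsto_inner vq) auto
    moreover have "S (v n) \<bullet> xi (v n) = 0" for n using xi(1)[OF v(1)] by (simp add: transversal_def)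
    ultimately have q: "q \<in> transversal S w" by (simp add: transversal_def LIMSEQ_const_iff)
    have "norm (X w q s) \<le> r" for s
    proof (rule Lim_norm_ubound[OF trivial_limit_sequentially])
      show "(\<lambda>n. X (v n) (xi (v n)) s) \<longlonglongrightarrow> X w q s" by (rule sol_tendsto[OF tf w v(1) vw vq])
      show "\<forall>\<^sub>F n in sequentially. norm (X (v n) (xi (v n)) s) \<le> r" using xi(2)[OF v(1)] by simp
    qed
    then have "q = xi w" by (rule xi_unique[OF w q])
    then have "l = (w, xi w)" by (simp add: w_def q_def prod_eq_iff)
    then show "l \<in> (\<lambda>w. (w, xi w)) ` \<Lambda>" using w by blast
  qed
qed

lemma continuous_H: "continuous_on \<Lambda> H"
  unfolding H_def by (intro continuous_intros continuous_xi)

text \<open>H moves points by at most r, so the displacements along a convergent sequence of images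
  have a convergent subsequence, and with them the preimages converge. Arbitrary closed U are
  treated because closedness of the map is what makes the inverse continuous.\<close>

lemma closed_H_image:
  assumes U: "U \<subseteq> \<Lambda>" "closed U"
  shows "closed (H ` U)"
  unfolding closed_sequential_limits
proof (intro allI impI, elim conjE)
  fix z q assume z: "\<forall>n. z n \<in> H ` U" and lim: "z \<longlonglongrightarrow> q"
  obtain w where w: "\<And>n. w n \<in> U" "\<And>n. z n = H (w n)"
    using choice[of "\<lambda>n w. w \<in> U \<and> z n = H w"] z by blast
  have "\<forall>n. xi (w n) \<in> cball 0 r" using xi(3) w(1) U(1) by auto
  then obtain x k where k: "strict_mono (k :: nat \<Rightarrow> nat)" "((\<lambda>n. xi (w n)) \<circ> k) \<longlonglongrightarrow> x"
    using compact_cball[of 0 r, unfolded compact_def, rule_format, of "\<lambda>n. xi (w n)"] by blast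
  have zk: "(z \<circ> k) \<longlonglongrightarrow> q" using lim k(1) by (rule LIMSEQ_subseq_LIMSEQ)
  have "(\<lambda>n. (z \<circ> k) n - ((\<lambda>n. xi (w n)) \<circ> k) n) \<longlonglongrightarrow> q - x" by (intro tendsto_diff zk k(2))
  then have wk: "(\<lambda>n. w (k n)) \<longlonglongrightarrow> q - x" by (simp add: w(2) H_def)
  have qx: "q - x \<in> U" using closed_sequentially[OF U(2) w(1) wk] .
  have "(\<lambda>n. H (w (k n))) \<longlonglongrightarrow> H (q - x)"
    using continuous_on_tendsto_compose[OF continuous_H wk] qx w(1) U(1) by (auto simp: eventually_sequentially)
  moreover have "(\<lambda>n. H (w (k n))) \<longlonglongrightarrow> q" using zk by (simp add: o_def w(2))
  ultimately have "q = H (q - x)" using LIMSEQ_unique by blast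
  then show "q \<in> H ` U" using qx by blast
qed

text \<open>If \<open>H w = H w'\<close>, then the two orbits are shadowed by the same orbit of \<open>V\<close>.  The component of
  their difference transversal to the flow dominates the difference, as both points \<open>w\<close> and \<open>w'\<close>
  see \<open>H w\<close> in their cross-sections, and it is a bounded almost-solution of the linear equation.\<close>

lemma inj_on_H: "inj_on H \<Lambda>"
proof (rule inj_onI)
  fix w w' assume w: "w \<in> \<Lambda>" and w': "w' \<in> \<Lambda>" and eq: "H w = H w'"
  let ?g = "\<lambda>v. speed V v (xi v)"
  obtain \<tau> \<theta> where \<tau>: "\<tau> 0 = (0::real)" "\<And>s. \<theta> (\<tau> s) = s"
    "\<And>s. (\<tau> has_real_derivative ?g (\<phi> s w)) (at s)"
    and u: "\<And>t. ((\<lambda>t. H (\<phi> (\<theta> t) w)) has_vector_derivative V (H (\<phi> (\<theta> t) w))) (at t)"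
    using H_orbit[OF w] by blast
  obtain \<tau>' \<theta>' where \<tau>': "\<tau>' 0 = (0::real)" "\<And>s. \<theta>' (\<tau>' s) = s" "\<And>t. \<tau>' (\<theta>' t) = t"
    "\<And>s. (\<theta>' has_real_derivative inverse (?g (\<phi> s w'))) (at (\<tau>' s))"
    and u': "\<And>t. ((\<lambda>t. H (\<phi> (\<theta>' t) w')) has_vector_derivative V (H (\<phi> (\<theta>' t) w'))) (at t)"
    using H_orbit[OF w'] by blast
  have \<theta>0: "\<theta> 0 = 0" "\<theta>' 0 = 0" using \<tau>(2)[of 0] \<tau>'(2)[of 0] \<tau>(1) \<tau>'(1) by auto
  have same: "H (\<phi> (\<theta> t) w) = H (\<phi> (\<theta>' t) w')" for t
    by (rule C1_ode_unique[OF V_C1', of t "\<lambda>t. H (\<phi> (\<theta> t) w)" "\<lambda>t. H (\<phi> (\<theta>' t) w')"])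
       (use \<theta>0 eq has_vector_derivative_at_within[OF u] has_vector_derivative_at_within[OF u'] in auto)
  \<comment> \<open>Matches base times along the two orbits: \<open>\<phi> s w\<close> and
    \<open>\<phi> (\<sigma> s) w'\<close> have the same image under H.\<close>
  define \<sigma> where "\<sigma> s = \<theta>' (\<tau> s)" for s
  define \<sigma>' where "\<sigma>' s = ?g (\<phi> s w) * inverse (?g (\<phi> (\<sigma> s) w'))" for s
  have \<sigma>_der: "(\<sigma> has_real_derivative \<sigma>' s) (at s)" for s
  proof -
    have "(\<theta>' has_real_derivative inverse (?g (\<phi> (\<sigma> s) w'))) (at (\<tau> s))"
      using \<tau>'(4)[of "\<sigma> s"] \<tau>'(3) by (simp add: \<sigma>_def)
    from DERIV_chain2[OF this \<tau>(3)] show ?thesis unfolding \<sigma>_def[abs_def] \<sigma>'_def by (simp add: mult.commute)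
  qed
  have g_bound: "\<bar>?g v - 1\<bar> \<le> \<eta>" "1 / 2 \<le> ?g v" if "v \<in> \<Lambda>" for v
    using good_V(2,3)[OF \<eta> \<rho> V that, of "xi v"] xi(3)[OF that] r by auto
  have \<sigma>'_le: "\<bar>\<sigma>' s - 1\<bar> \<le> 4 * \<eta>" for s
  proof -
    let ?a = "?g (\<phi> s w)" and ?b = "?g (\<phi> (\<sigma> s) w')"
    have ab: "\<bar>?a - 1\<bar> \<le> \<eta>" "\<bar>?b - 1\<bar> \<le> \<eta>" "1 / 2 \<le> ?b" using g_bound w w' by auto
    have "\<sigma>' s - 1 = (?a - ?b) / ?b" using ab(3) by (simp add: \<sigma>'_def field_simps)
    then have "\<bar>\<sigma>' s - 1\<bar> = \<bar>?a - ?b\<bar> / ?b" using ab(3) by (simp add: abs_divide)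
    also have "\<dots> \<le> (2 * \<eta>) / (1 / 2)" using ab \<eta>(1) by (intro frac_le) auto
    finally show ?thesis by simp
  qed
  let ?w = "\<lambda>s. \<phi> s w" and ?w' = "\<lambda>s. \<phi> (\<sigma> s) w'"
  define z where "z s = ?w' s - ?w s" for s
  define z' where "z' s = \<sigma>' s *\<^sub>R S (?w' s) - S (?w s)" for s
  have z_der: "(z has_vector_derivative z' s) (at s)" for s
  proof -
    have "(\<sigma> has_vector_derivative \<sigma>' s) (at s)"
      using \<sigma>_der by (simp add: has_real_derivative_iff_has_vector_derivative)
    from vector_diff_chain_at[OF this \<phi>_der]
    have "((\<lambda>s. ?w' s) has_vector_derivative \<sigma>' s *\<^sub>R S (?w' s)) (at s)" by (simp add: o_def)
    from has_vector_derivative_diff[OF this \<phi>_der] show ?thesis unfolding z_def[abs_def] z'_def .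
  qed
  have z_xi: "z s = xi (?w s) - xi (?w' s)" for s
  proof -
    have "H (?w s) = H (?w' s)" using same[of "\<tau> s"] \<tau>(2) by (simp add: \<sigma>_def)
    then show ?thesis by (simp add: H_def z_def algebra_simps)
  qed
  have z_le: "norm (z s) \<le> 2 * r" for s
    unfolding z_xi using xi(3)[OF \<phi>_in[OF w]] xi(3)[OF \<phi>_in[OF w']]
    by (intro norm_triangle_le_diff) (metis add_mono mult_2)
  define R where "R s = S (?w' s) - S (?w s) - vf_deriv S (?w s) (z s)" for s
  have R_le: "norm (R s) \<le> \<eta> * norm (z s)" for s
    using S_lin[OF \<phi>_in[OF w], of "z s" s] z_le[of s] r(2) by (simp add: R_def z_def)
  have dS: "norm (S (?w' s) - S (?w s)) \<le> (K + 1) * norm (z s)" for s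
  proof -
    have "S (?w' s) - S (?w s) = vf_deriv S (?w s) (z s) + R s" by (simp add: R_def)
    also have "norm \<dots> \<le> K * norm (z s) + \<eta> * norm (z s)"
      by (intro norm_triangle_mono norm_deriv_le \<phi>_in w R_le)
    also have "\<dots> \<le> K * norm (z s) + 1 * norm (z s)"
      using \<eta> by (intro add_left_mono mult_right_mono) auto
    finally show ?thesis by (simp add: algebra_simps)
  qed
  define \<kappa> where "\<kappa> s = (S (?w s) \<bullet> z s) / (S (?w s) \<bullet> S (?w s))" for s
  define e where "e s = orth (S (?w s)) (z s)" for s
  have e_eq: "e s = z s - \<kappa> s *\<^sub>R S (?w s)" for s by (simp add: e_def orth_def \<kappa>_def)
  have Snz: "S (?w s) \<noteq> 0" for s using S_nz w by simp
  have e_tr: "S (?w s) \<bullet> e s = 0" for s using inner_orth[OF Snz] by (simp add: e_def)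
  have z_e: "norm (z s) \<le> 2 * norm (e s)" for s
  proof -
    let ?a = "S (?w s)"
    \<comment> \<open>Each displacement is orthogonal to S at its own base point. Only the
      difference of the two normals survives, and it is itself bounded by a multiple of
      \<open>norm (z s)\<close>.\<close>
    have "?a \<bullet> z s = (S (?w' s) - ?a) \<bullet> xi (?w' s)"
      using xi(1)[OF \<phi>_in[OF w], of s] xi(1)[OF \<phi>_in[OF w'], of "\<sigma> s"]
      by (simp add: z_xi transversal_def inner_diff_left inner_diff_right)
    then have "\<bar>?a \<bullet> z s\<bar> \<le> norm (S (?w' s) - ?a) * norm (xi (?w' s))"
      using Cauchy_Schwarz_ineq2 by metis
    also have "\<dots> \<le> ((K + 1) * norm (z s)) * r"
      using dS xi(3)[OF \<phi>_in[OF w']] K(1) by (intro mult_mono) auto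
    also have "\<dots> \<le> m / 2 * norm (z s)"
      using mult_right_mono[OF r(3), of "norm (z s)"] by (simp add: mult_ac)
    finally have az: "\<bar>?a \<bullet> z s\<bar> \<le> m / 2 * norm (z s)" .
    have "norm (\<kappa> s *\<^sub>R ?a) = \<bar>?a \<bullet> z s\<bar> / norm ?a"
      using Snz[of s] by (simp add: \<kappa>_def abs_mult power2_norm_eq_inner[symmetric] power2_eq_square)
    also have "\<dots> \<le> (m / 2 * norm (z s)) / m"
      using az m(1) m(2)[OF \<phi>_in[OF w], of s] by (intro frac_le) auto
    also have "\<dots> = norm (z s) / 2" using m(1) by simp
    finally have "norm (\<kappa> s *\<^sub>R ?a) \<le> norm (z s) / 2" .
    moreover have "norm (z s) \<le> norm (e s) + norm (\<kappa> s *\<^sub>R ?a)"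
      using norm_triangle_ineq[of "e s" "\<kappa> s *\<^sub>R ?a"] by (simp add: e_eq)
    ultimately show ?thesis by linarith
  qed
  have inner_der: "((\<lambda>s. f s \<bullet> h s) has_real_derivative f s \<bullet> h' + f' \<bullet> h s) (at s)"
    if "(f has_vector_derivative f') (at s)" "(h has_vector_derivative h') (at s)"
    for f h :: "real \<Rightarrow> 'a" and f' h' s
    using bounded_bilinear.has_vector_derivative[OF bounded_bilinear_inner that]
    by (simp add: has_real_derivative_iff_has_vector_derivative)
  \<comment> \<open>The value of this derivative is irrelevant: it multiplies
    \<open>S (?w s)\<close>, which \<open>orth\<close> annihilates.\<close>
  have "\<exists>k. (\<kappa> has_real_derivative k) (at s)" for s
    unfolding \<kappa>_def[abs_def]
    by (rule exI, rule DERIV_divide[OF inner_der[OF S_\<phi>_der z_der] inner_der[OF S_\<phi>_der S_\<phi>_der]])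
       (simp add: Snz)
  then obtain \<kappa>' where \<kappa>': "\<And>s. (\<kappa> has_real_derivative \<kappa>' s) (at s)"
    using choice[of "\<lambda>s k. (\<kappa> has_real_derivative k) (at s)"] by blast
  define e' where "e' s = z' s - (\<kappa> s *\<^sub>R accel (?w s) + \<kappa>' s *\<^sub>R S (?w s))" for s
  have e_der: "(e has_vector_derivative e' s) (at s)" for s
    unfolding e_eq[abs_def] e'_def
    by (intro has_vector_derivative_diff has_vector_derivative_scaleR z_der \<kappa>' S_\<phi>_der)
  have e_err: "e' s - lin (?w s) (e s) = orth (S (?w s)) (R s) + (\<sigma>' s - 1) *\<^sub>R orth (S (?w s)) (S (?w' s) - S (?w s))" for s
  proof -
    let ?a = "S (?w s)" and ?B = "blinfun_apply (vf_deriv S (?w s))"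
    \<comment> \<open>The inner product vanishes identically, so its derivative is 0. This gives the
      tangential part of \<open>e' s\<close>, which agrees with that of \<open>lin\<close>; the rest
      of the computation concerns orthogonal parts.\<close>
    have "((\<lambda>s. S (?w s) \<bullet> e s) has_real_derivative ?a \<bullet> e' s + accel (?w s) \<bullet> e s) (at s)"
      by (rule inner_der[OF S_\<phi>_der e_der])
    moreover have "((\<lambda>s. S (?w s) \<bullet> e s) has_real_derivative 0) (at s)" by (simp add: e_tr)
    ultimately have ae': "?a \<bullet> e' s = - (accel (?w s) \<bullet> e s)"
      using DERIV_unique by fastforce
    have "orth ?a (e' s) = orth ?a (z' s) - \<kappa> s *\<^sub>R orth ?a (accel (?w s))"
      by (simp add: e'_def linear_diff[OF linear_orth] linear_add[OF linear_orth] linear_scale[OF linear_orth] orth_self)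
    moreover have "orth ?a (z' s) = \<sigma>' s *\<^sub>R orth ?a (S (?w' s) - ?a)"
      by (simp add: z'_def linear_diff[OF linear_orth] linear_scale[OF linear_orth] orth_self)
    moreover have "S (?w' s) - ?a = ?B (e s) + \<kappa> s *\<^sub>R accel (?w s) + R s"
      by (simp add: R_def e_eq blinfun.diff_right blinfun.scaleR_right)
    then have "orth ?a (S (?w' s) - ?a) = orth ?a (?B (e s)) + \<kappa> s *\<^sub>R orth ?a (accel (?w s)) + orth ?a (R s)"
      by (simp only: linear_add[OF linear_orth] linear_scale[OF linear_orth])
    ultimately have "orth ?a (e' s) = orth ?a (?B (e s)) + orth ?a (R s) + (\<sigma>' s - 1) *\<^sub>R orth ?a (S (?w' s) - ?a)"
      by (simp add: scaleR_diff_left)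
    moreover have "e' s = orth ?a (e' s) - ((accel (?w s) \<bullet> e s) / (?a \<bullet> ?a)) *\<^sub>R ?a"
      by (simp add: orth_def ae')
    ultimately show ?thesis by (simp add: lin_def)
  qed
  have "e 0 = 0"
  proof (rule bounded_almost_solution_eq_0[OF dich w e_der])
    show "e s \<in> transversal S (?w s)" for s using e_tr by (simp add: transversal_def)
    show "norm (e s) \<le> 2 * r" for s unfolding e_def using norm_orth z_le by (rule order_trans)
    fix s
    have "norm (e' s - lin (?w s) (e s)) \<le> \<eta> * norm (z s) + (4 * \<eta>) * ((K + 1) * norm (z s))"
      unfolding e_err
    proof (intro norm_triangle_mono)
      show "norm (orth (S (?w s)) (R s)) \<le> \<eta> * norm (z s)" using norm_orth R_le by (rule order_trans)
      have "norm (orth (S (?w s)) (S (?w' s) - S (?w s))) \<le> (K + 1) * norm (z s)"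
        using norm_orth dS by (rule order_trans)
      then show "norm ((\<sigma>' s - 1) *\<^sub>R orth (S (?w s)) (S (?w' s) - S (?w s))) \<le> 4 * \<eta> * ((K + 1) * norm (z s))"
        unfolding norm_scaleR using \<sigma>'_le \<eta>(1) by (intro mult_mono) auto
    qed
    \<comment> \<open>The coefficient is \<eta> + 4 \<eta> (K + 1); passing from z to e doubles it
      to (10 + 8 K) \<eta>.\<close>
    also have "\<dots> = ((5 + 4 * K) * \<eta>) * norm (z s)" by (simp add: algebra_simps)
    also have "\<dots> \<le> ((5 + 4 * K) * \<eta>) * (2 * norm (e s))"
      using z_e K(1) \<eta>(1) by (intro mult_left_mono) auto
    also have "\<dots> = ((10 + 8 * K) * \<eta>) * norm (e s)" by (simp add: algebra_simps)
    also have "\<dots> \<le> \<eta>0 * norm (e s)" using \<eta>\<eta>0 by (rule mult_right_mono) simp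
    finally show "norm (e' s - lin (?w s) (e s)) \<le> \<eta>0 * norm (e s)" .
  qed
  then have "z 0 = 0" using z_e[of 0] by simp
  then show "w = w'" by (simp add: z_def \<sigma>_def \<tau>(1) \<theta>0)
qed

lemma H_homeomorphism: "\<exists>G. homeomorphism \<Lambda> (H ` \<Lambda>) H G"
proof -
  have cl: "closedin (top_of_set (H ` \<Lambda>)) (H ` U)" if "closedin (top_of_set \<Lambda>) U" for U
  proof -
    have "closed U" "U \<subseteq> \<Lambda>" using that \<Lambda>_closed closedin_closed_eq closedin_subset by (blast, force)
    then show ?thesis using closed_H_image by (intro closed_subset) auto
  qed
  show ?thesis
    using homeomorphism_injective_closed_map[OF continuous_H refl inj_on_H cl] by blast
qed

lemma shadowing:
  "\<exists>\<Lambda>V H. closed \<Lambda>V \<and> (\<exists>G. homeomorphism \<Lambda> \<Lambda>V H G) \<and> (\<forall>w\<in>\<Lambda>. norm (H w - w) \<le> r) \<and>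
     (\<forall>w\<in>\<Lambda>. \<exists>p. H ` orbit S w \<subseteq> orbit V p \<and> orbit V p \<subseteq> \<Lambda>V) \<and>
     (\<forall>w\<in>\<Lambda>. H w \<in> cross_section S w) \<and>
     (\<forall>w\<in>\<Lambda>. \<forall>t. cs_flow S \<phi> V t w (H w) (H (\<phi> t w)))"
  using closed_H_image[OF order_refl \<Lambda>_closed] H_homeomorphism H_dist H_orbit_eq H_cross_section H_cs_flow
  by (intro exI[of _ "H ` \<Lambda>"] exI[of _ H]) blast

end

theorem shadowing_near:
  assumes "0 < \<epsilon>"
  shows "\<exists>\<delta>>0. \<forall>V. near S \<delta> V \<longrightarrow> (\<exists>\<Lambda>V H. closed \<Lambda>V \<and> (\<exists>G. homeomorphism \<Lambda> \<Lambda>V H G) \<and>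
     (\<forall>w\<in>\<Lambda>. norm (H w - w) < \<epsilon>) \<and>
     (\<forall>w\<in>\<Lambda>. \<exists>p. H ` orbit S w \<subseteq> orbit V p \<and> orbit V p \<subseteq> \<Lambda>V) \<and>
     (\<forall>w\<in>\<Lambda>. H w \<in> cross_section S w) \<and>
     (\<forall>w\<in>\<Lambda>. \<forall>t. cs_flow S \<phi> V t w (H w) (H (\<phi> t w))))"
proof -
  obtain T c \<eta>0 where dich: "dichotomy T c \<eta>0" using dichotomy_exists by blast
  have \<eta>0: "0 < \<eta>0" using dich by (simp add: dichotomy_def)
  have K': "0 < 10 + 8 * K" using K(1) by simp
  \<comment> \<open>The choices are made in the order \<open>\<eta>0\<close>, \<eta>, \<rho>, r,
    \<delta>; only r and \<delta> depend on the prescribed \<epsilon>.\<close>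
  define \<eta> where "\<eta> = min (1 / 2) (min (m / 4) (\<eta>0 / (10 + 8 * K)))"
  have "\<eta> \<le> \<eta>0 / (10 + 8 * K)" unfolding \<eta>_def by (intro min.coboundedI2 min.cobounded2)
  then have \<eta>\<eta>0: "(10 + 8 * K) * \<eta> \<le> \<eta>0" using K' by (simp add: pos_le_divide_eq mult.commute)
  have \<eta>: "0 < \<eta>" using m(1) \<eta>0 K' by (simp add: \<eta>_def)
  have \<eta>': "\<eta> \<le> 1 / 2" "\<eta> \<le> m / 4"
    unfolding \<eta>_def by (rule min.cobounded1, intro min.coboundedI2 min.cobounded1)
  obtain \<rho> where \<rho>: "0 < \<rho>" and good: "\<And>V. near S \<rho> V \<Longrightarrow> good \<eta> \<rho> V"
    and S_lin: "\<And>w x. w \<in> \<Lambda> \<Longrightarrow> norm x \<le> \<rho> \<Longrightarrow> norm (S (w + x) - S w - vf_deriv S w x) \<le> \<eta> * norm x"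
    using near_good[OF \<eta>] by auto
  \<comment> \<open>Half of \<epsilon> makes the final distance strict.\<close>
  define r where "r = min (\<epsilon> / 2) (min (\<rho> / 2) (m / 2 / (K + 1)))"
  have r0: "0 < r" using assms \<rho> m(1) K(1) by (simp add: r_def)
  have "r \<le> \<epsilon> / 2" "r \<le> \<rho> / 2" "r \<le> m / 2 / (K + 1)"
    unfolding r_def by (rule min.cobounded1, intro min.coboundedI2 min.cobounded1, intro min.coboundedI2 min.cobounded2)
  then have r: "r < \<epsilon>" "2 * r \<le> \<rho>" "(K + 1) * r \<le> m / 2"
    using assms pos_le_divide_eq[of "K + 1" r "m / 2"] K(1) by (auto simp: mult.commute)
  have bd: "0 \<le> bd T c" by (rule bd_nonneg[OF dich])
  \<comment> \<open>The bound by \<rho> makes V \<open>good\<close>. The added 1 keeps the quotient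
    meaningful, as \<open>bd T c\<close> is only known to be nonnegative.\<close>
  define \<delta> where "\<delta> = min \<rho> (r / (bd T c + 1))"
  have \<delta>: "0 < \<delta>" using \<rho> r0 bd by (simp add: \<delta>_def)
  have \<delta>': "\<delta> \<le> \<rho>" "\<delta> \<le> r / (bd T c + 1)" unfolding \<delta>_def by (rule min.cobounded1, rule min.cobounded2)
  have "bd T c * \<delta> \<le> (bd T c + 1) * (r / (bd T c + 1))"
    using bd \<delta> \<delta>'(2) by (intro mult_mono) auto
  then have bd\<delta>: "bd T c * \<delta> \<le> r" using bd by simp
  show ?thesis
  proof (intro exI[of _ \<delta>] conjI allI impI \<delta>)
    fix V assume V: "near S \<delta> V"
    have "\<And>w. w \<in> \<Lambda> \<Longrightarrow> norm (V w - S w) \<le> \<delta>" using V by (simp add: near_def)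
    then obtain \<Lambda>V H where *: "closed \<Lambda>V" "\<exists>G. homeomorphism \<Lambda> \<Lambda>V H G"
      "\<forall>w\<in>\<Lambda>. norm (H w - w) \<le> r"
      "\<forall>w\<in>\<Lambda>. \<exists>p. H ` orbit S w \<subseteq> orbit V p \<and> orbit V p \<subseteq> \<Lambda>V"
      "\<forall>w\<in>\<Lambda>. H w \<in> cross_section S w" "\<forall>w\<in>\<Lambda>. \<forall>t. cs_flow S \<phi> V t w (H w) (H (\<phi> t w))"
      using shadowing[OF dich \<eta> \<eta>' \<eta>\<eta>0 \<rho> good[OF near_mono[OF V \<delta>'(1)]] S_lin r0 r(2,3) _ less_imp_le[OF \<delta>] bd\<delta>]
      by auto
    have "\<forall>w\<in>\<Lambda>. norm (H w - w) < \<epsilon>" using *(3) r(1) by (meson order_le_less_trans)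
    with * show "\<exists>\<Lambda>V H. closed \<Lambda>V \<and> (\<exists>G. homeomorphism \<Lambda> \<Lambda>V H G) \<and>
     (\<forall>w\<in>\<Lambda>. norm (H w - w) < \<epsilon>) \<and>
     (\<forall>w\<in>\<Lambda>. \<exists>p. H ` orbit S w \<subseteq> orbit V p \<and> orbit V p \<subseteq> \<Lambda>V) \<and>
     (\<forall>w\<in>\<Lambda>. H w \<in> cross_section S w) \<and>
     (\<forall>w\<in>\<Lambda>. \<forall>t. cs_flow S \<phi> V t w (H w) (H (\<phi> t w)))"
      by (intro exI[of _ \<Lambda>V] exI[of _ H]) simp
  qed
qed

end

theorem mainTheorem1:
  fixes S :: "'a::euclidean_space \<Rightarrow> 'a"
    and \<phi> :: "real \<Rightarrow> 'a \<Rightarrow> 'a"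
    and \<Lambda> :: "'a set"
  assumes dim: "DIM('a) \<ge> 2"
    and C1: "C1_field S"
    and flow: "is_flow_of S \<phi>"
    and hyp: "hyperbolic_set S \<phi> \<Lambda>"
    and U1: "bounded (vf_deriv S ` \<Lambda>)"
    and U2: "0 < (INF w\<in>\<Lambda>. ereal (norm (S w)))" "(SUP w\<in>\<Lambda>. ereal (norm (S w))) < \<infinity>"
    and U3: "\<forall>\<epsilon>>0. \<exists>\<delta>>0. \<forall>w0\<in>\<Lambda>. \<forall>w. norm (w - w0) < \<delta> \<longrightarrow>
               norm (vf_deriv S w - vf_deriv S w0) < \<epsilon>"
  shows "\<forall>\<epsilon>>0. \<exists>U. C1_neighborhood S U \<and>
           (\<forall>V\<in>U. \<exists>\<Lambda>V H.
              closed \<Lambda>V \<and> (\<exists>G. homeomorphism \<Lambda> \<Lambda>V H G) \<and>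
              (\<forall>w\<in>\<Lambda>. norm (H w - w) < \<epsilon>) \<and>
              (\<forall>w\<in>\<Lambda>. \<exists>p. H ` orbit S w \<subseteq> orbit V p \<and> orbit V p \<subseteq> \<Lambda>V) \<and>
              (\<forall>w\<in>\<Lambda>. H w \<in> cross_section S w) \<and>
              (\<forall>w\<in>\<Lambda>. \<forall>t. cs_flow S \<phi> V t w (H w) (H (\<phi> t w))))"
proof (intro allI impI)
  fix \<epsilon> :: real assume \<epsilon>: "0 < \<epsilon>"
  obtain m where m: "0 < m" "\<And>w. w \<in> \<Lambda> \<Longrightarrow> m \<le> norm (S w)"
  proof -
    \<comment> \<open>A real strictly below the infimum; this also covers an empty \<Lambda>, where
      the infimum is infinite.\<close>
    obtain m where m: "0 < ereal m" "ereal m < (INF w\<in>\<Lambda>. ereal (norm (S w)))"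
      using ereal_dense2[OF U2(1)] by auto
    have "m \<le> norm (S w)" if "w \<in> \<Lambda>" for w
    proof -
      have "ereal m < ereal (norm (S w))"
        using m(2) INF_lower[OF that] by (rule less_le_trans)
      then show ?thesis by simp
    qed
    then show thesis using m(1) by (intro that[of m]) auto
  qed
  obtain M where M: "0 < M" "\<And>w. w \<in> \<Lambda> \<Longrightarrow> norm (S w) \<le> M"
  proof -
    obtain M where M: "(SUP w\<in>\<Lambda>. ereal (norm (S w))) < ereal M"
      using ereal_dense2[OF U2(2)] by auto
    \<comment> \<open>For an empty \<Lambda> the supremum is negative infinity and M may be
      negative; the maximum with 1 secures a positive bound.\<close>
    have "norm (S w) \<le> max 1 M" if "w \<in> \<Lambda>" for w
    proof -
      have "ereal (norm (S w)) < ereal M"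
        using SUP_upper[OF that] M by (rule le_less_trans)
      then show ?thesis by simp
    qed
    then show thesis by (intro that[of "max 1 M"]) auto
  qed
  obtain K where K: "0 < K" "\<And>w. w \<in> \<Lambda> \<Longrightarrow> norm (vf_deriv S w) \<le> K"
    using U1 unfolding bounded_pos by (metis imageI)
  have "uniform_flow S \<phi> \<Lambda> K m M"
  proof
    show "closed \<Lambda>" "\<phi> t ` \<Lambda> = \<Lambda>" for t using hyp by (auto simp: hyperbolic_set_def)
  qed (use C1 flow K m M U3 in auto)
  then interpret uniform_flow S \<phi> \<Lambda> K m M .
  obtain C \<mu> Ts Tu where "hyperbolic_flow S \<phi> \<Lambda> K m M C \<mu> Ts Tu"
    using hyperbolic_flowI[OF hyp] by blast
  then interpret hyperbolic_flow S \<phi> \<Lambda> K m M C \<mu> Ts Tu .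
  obtain \<delta> where \<delta>: "0 < \<delta>" and main: "\<And>V. near S \<delta> V \<Longrightarrow> (\<exists>\<Lambda>V H. closed \<Lambda>V \<and>
     (\<exists>G. homeomorphism \<Lambda> \<Lambda>V H G) \<and> (\<forall>w\<in>\<Lambda>. norm (H w - w) < \<epsilon>) \<and>
     (\<forall>w\<in>\<Lambda>. \<exists>p. H ` orbit S w \<subseteq> orbit V p \<and> orbit V p \<subseteq> \<Lambda>V) \<and>
     (\<forall>w\<in>\<Lambda>. H w \<in> cross_section S w) \<and>
     (\<forall>w\<in>\<Lambda>. \<forall>t. cs_flow S \<phi> V t w (H w) (H (\<phi> t w))))"
    using shadowing_near[OF \<epsilon>] by auto
  let ?U = "{V. C1_field V \<and> C1_norm (\<lambda>w. V w - S w) < ereal \<delta>}"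
  have U: "near S \<delta> V" if "V \<in> ?U" for V
    using that C1_norm_lessD[of "\<lambda>w. V w - S w" \<delta>] vf_deriv_diff[OF _ S]
    unfolding near_def by (auto intro: less_imp_le)
  have "C1_neighborhood S ?U" unfolding C1_neighborhood_def using \<delta> by blast
  then show "\<exists>U. C1_neighborhood S U \<and>
           (\<forall>V\<in>U. \<exists>\<Lambda>V H.
              closed \<Lambda>V \<and> (\<exists>G. homeomorphism \<Lambda> \<Lambda>V H G) \<and>
              (\<forall>w\<in>\<Lambda>. norm (H w - w) < \<epsilon>) \<and>
              (\<forall>w\<in>\<Lambda>. \<exists>p. H ` orbit S w \<subseteq> orbit V p \<and> orbit V p \<subseteq> \<Lambda>V) \<and>
              (\<forall>w\<in>\<Lambda>. H w \<in> cross_section S w) \<and>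
              (\<forall>w\<in>\<Lambda>. \<forall>t. cs_flow S \<phi> V t w (H w) (H (\<phi> t w))))"
    using main[OF U] by (intro exI[of _ ?U] conjI ballI)
qed

end
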